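(* Let $k\in\mathbb{N}$ and let $X\subset\mathbb{R}^{N}$ be a smooth, real affine algebraic variety of dimension $d\geq 2$. Then no maximal ideal of the ring $\mathcal{R}^{k}(X)$ of $k$-regulous functions on $X$ is finitely generated. In particular, the ring $\mathcal{R}^{k}(X)$ is not noetherian, provided that $\dim X\geq 2$.
   Context: $\mathbb{N}=\{0,1,2,\dots\}$. A real affine algebraic variety $X\subset\mathbb{R}^N$ is a real algebraic set, i.e. the common zero set in $\mathbb{R}^N$ of a family of polynomials. It is smooth (nonsingular) of dimension $d$ if $\dim X=d$ and every point of $X$ is a nonsingular point in dimension $d$, i.e. the local ring of regular functions at each point $x\in X$ (the localization of $\mathbb{R}[x_1,\dots,x_N]/I$, where $I$ is the ideal of all polynomials vanishing on $X$, at the maximal ideal of classes of polynomials vanishing at $x$) is a regular local ring of dimension $d$; in particular $X$ is then a $\mathcal{C}^\infty$ submanifold of $\mathbb{R}^N$ of dimension $d$. A function $f:X\to\mathbb{R}$ is $k$-regulous if it is of class $\mathcal{C}^k$ on the manifold $X$ and is rational on $X$, i.e. there is a Zariski open, Zariski dense subset of $X$ on which $f$ is a regular function (a quotient $p/q$ of polynomials with $q$ nowhere vanishing on that subset). $\mathcal{R}^k(X)$ is the (commutative, unital) ring of $k$-regulous functions on $X$ with pointwise operations. *)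

theory Defs
  imports "HOL-Analysis.Analysis" "HOL-Algebra.QuotRing" "HOL-Algebra.Ring_Divisibility"
begin

section \<open>Commutative algebra\<close>

subsection \<open>Localization\<close>

definition frac_rel :: "('a, 'm) ring_scheme \<Rightarrow> 'a set \<Rightarrow> (('a \<times> 'a) \<times> ('a \<times> 'a)) set" where
  "frac_rel R S = {((a, s), (b, t)). a \<in> carrier R \<and> b \<in> carrier R \<and> s \<in> S \<and> t \<in> S \<and>
     (\<exists>u\<in>S. u \<otimes>\<^bsub>R\<^esub> (a \<otimes>\<^bsub>R\<^esub> t) = u \<otimes>\<^bsub>R\<^esub> (b \<otimes>\<^bsub>R\<^esub> s))}"

definition frac_class :: "('a, 'm) ring_scheme \<Rightarrow> 'a set \<Rightarrow> 'a \<Rightarrow> 'a \<Rightarrow> ('a \<times> 'a) set" where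
  "frac_class R S a s = frac_rel R S `` {(a, s)}"

text \<open>
  The operations are written on whole equivalence classes, as for cosets in \<^const>\<open>FactRing\<close>;
  \<open>frac_class_mult\<close> and \<open>frac_class_add\<close> below give the usual formulas on representatives.
\<close>

definition localization :: "('a, 'm) ring_scheme \<Rightarrow> 'a set \<Rightarrow> ('a \<times> 'a) set ring" where
  "localization R S =
    \<lparr>carrier = (carrier R \<times> S) // frac_rel R S,
     mult = (\<lambda>A B. \<Union>(a, s)\<in>A. \<Union>(b, t)\<in>B. frac_class R S (a \<otimes>\<^bsub>R\<^esub> b) (s \<otimes>\<^bsub>R\<^esub> t)),
     one = frac_class R S \<one>\<^bsub>R\<^esub> \<one>\<^bsub>R\<^esub>,
     zero = frac_class R S \<zero>\<^bsub>R\<^esub> \<one>\<^bsub>R\<^esub>,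
     add = (\<lambda>A B. \<Union>(a, s)\<in>A. \<Union>(b, t)\<in>B.
              frac_class R S (a \<otimes>\<^bsub>R\<^esub> t \<oplus>\<^bsub>R\<^esub> b \<otimes>\<^bsub>R\<^esub> s) (s \<otimes>\<^bsub>R\<^esub> t))\<rparr>"

locale mult_set = cring R for R (structure) +
  fixes S
  assumes S_sub: "S \<subseteq> carrier R"
    and S_one: "\<one> \<in> S"
    and S_mult: "\<lbrakk>s \<in> S; t \<in> S\<rbrakk> \<Longrightarrow> s \<otimes> t \<in> S"
begin

lemma S_closed: "s \<in> S \<Longrightarrow> s \<in> carrier R"
  using S_sub by blast

lemma equiv_frac_rel: "equiv (carrier R \<times> S) (frac_rel R S)"
proof (rule equivI)
  show "frac_rel R S \<subseteq> (carrier R \<times> S) \<times> (carrier R \<times> S)"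
    by (auto simp: frac_rel_def)
  show "refl_on (carrier R \<times> S) (frac_rel R S)"
    using S_one by (auto simp: refl_on_def frac_rel_def)
  show "sym (frac_rel R S)"
    by (force simp: sym_def frac_rel_def)
  show "trans (frac_rel R S)"
  proof (rule transI, clarify)
    fix a s b t c r
    assume "((a, s), (b, t)) \<in> frac_rel R S" "((b, t), (c, r)) \<in> frac_rel R S"
    then obtain u v where c: "a \<in> carrier R" "b \<in> carrier R" "c \<in> carrier R" "s \<in> S" "t \<in> S" "r \<in> S"
      "u \<in> S" "v \<in> S" and 1: "u \<otimes> (a \<otimes> t) = u \<otimes> (b \<otimes> s)" and 2: "v \<otimes> (b \<otimes> r) = v \<otimes> (c \<otimes> t)"
      by (auto simp: frac_rel_def)
    note cc = c(1-3) c(4-8)[THEN S_closed]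
    have "(u \<otimes> v \<otimes> t) \<otimes> (a \<otimes> r) = (v \<otimes> r) \<otimes> (u \<otimes> (a \<otimes> t))"
      using cc by (simp add: m_ac)
    also have "\<dots> = (u \<otimes> s) \<otimes> (v \<otimes> (b \<otimes> r))"
      using cc by (simp add: 1 m_ac)
    also have "\<dots> = (u \<otimes> v \<otimes> t) \<otimes> (c \<otimes> s)"
      using cc by (simp add: 2 m_ac)
    finally have "(u \<otimes> v \<otimes> t) \<otimes> (a \<otimes> r) = (u \<otimes> v \<otimes> t) \<otimes> (c \<otimes> s)" .
    then show "((a, s), (c, r)) \<in> frac_rel R S"
      using c by (auto simp: frac_rel_def intro!: S_mult bexI[of _ "u \<otimes> v \<otimes> t"])
  qed
qed

lemma frac_class_closed: "a \<in> carrier R \<Longrightarrow> s \<in> S \<Longrightarrow> frac_class R S a s \<in> carrier (localization R S)"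
  by (auto simp: frac_class_def localization_def intro: quotientI)

lemma frac_class_cases:
  assumes "A \<in> carrier (localization R S)"
  obtains a s where "a \<in> carrier R" "s \<in> carrier R" "s \<in> S" "A = frac_class R S a s"
proof -
  from assms obtain a s where "a \<in> carrier R" "s \<in> S" "A = frac_class R S a s"
    by (auto simp: frac_class_def localization_def elim!: quotientE)
  with that S_closed show thesis by blast
qed

lemma frac_class_eq_iff:
  assumes "a \<in> carrier R" "s \<in> S" "b \<in> carrier R" "t \<in> S"
  shows "frac_class R S a s = frac_class R S b t \<longleftrightarrow> (\<exists>u\<in>S. u \<otimes> (a \<otimes> t) = u \<otimes> (b \<otimes> s))"
proof -
  have "frac_class R S a s = frac_class R S b t \<longleftrightarrow> ((a, s), (b, t)) \<in> frac_rel R S"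
    unfolding frac_class_def using assms by (subst eq_equiv_class_iff[OF equiv_frac_rel]) auto
  then show ?thesis using assms by (auto simp: frac_rel_def)
qed

lemma frac_class_eqI:
  assumes "a \<in> carrier R" "s \<in> S" "b \<in> carrier R" "t \<in> S" "a \<otimes> t = b \<otimes> s"
  shows "frac_class R S a s = frac_class R S b t"
  using assms S_one by (auto simp: frac_class_eq_iff)

lemma frac_class_mult:
  assumes "a \<in> carrier R" "s \<in> S" "b \<in> carrier R" "t \<in> S"
  shows "frac_class R S a s \<otimes>\<^bsub>localization R S\<^esub> frac_class R S b t = frac_class R S (a \<otimes> b) (s \<otimes> t)"
proof -
  have *: "frac_class R S (a' \<otimes> b') (s' \<otimes> t') = frac_class R S (a \<otimes> b) (s \<otimes> t)"
    if r: "((a, s), (a', s')) \<in> frac_rel R S" "((b, t), (b', t')) \<in> frac_rel R S" for a' s' b' t'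
  proof -
    obtain u v where c: "a' \<in> carrier R" "b' \<in> carrier R" "s' \<in> S" "t' \<in> S" "u \<in> S" "v \<in> S"
      and 1: "u \<otimes> (a \<otimes> s') = u \<otimes> (a' \<otimes> s)" and 2: "v \<otimes> (b \<otimes> t') = v \<otimes> (b' \<otimes> t)"
      using r by (auto simp: frac_rel_def)
    note cc = c(1-2) c(3-6)[THEN S_closed] assms assms(2,4)[THEN S_closed]
    have "(u \<otimes> v) \<otimes> ((a' \<otimes> b') \<otimes> (s \<otimes> t)) = (u \<otimes> (a' \<otimes> s)) \<otimes> (v \<otimes> (b' \<otimes> t))"
      using cc by (simp add: m_ac)
    also have "\<dots> = (u \<otimes> v) \<otimes> ((a \<otimes> b) \<otimes> (s' \<otimes> t'))"
      unfolding 1[symmetric] 2[symmetric] using cc by (simp add: m_ac)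
    finally show ?thesis
      using c assms by (subst frac_class_eq_iff) (auto intro: S_mult)
  qed
  have "((a, s), (a, s)) \<in> frac_rel R S" "((b, t), (b, t)) \<in> frac_rel R S"
    using equiv_frac_rel assms by (auto simp: equiv_def refl_on_def)
  then have mem: "(a, s) \<in> frac_class R S a s" "(b, t) \<in> frac_class R S b t"
    by (simp_all add: frac_class_def)
  have "frac_class R S (a' \<otimes> b') (s' \<otimes> t') = frac_class R S (a \<otimes> b) (s \<otimes> t)"
    if "(a', s') \<in> frac_class R S a s" "(b', t') \<in> frac_class R S b t" for a' s' b' t'
    using * that by (simp add: frac_class_def)
  then have "(\<Union>(a', s')\<in>frac_class R S a s. \<Union>(b', t')\<in>frac_class R S b t. frac_class R S (a' \<otimes> b') (s' \<otimes> t'))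
      = (\<Union>p\<in>frac_class R S a s. \<Union>q\<in>frac_class R S b t. frac_class R S (a \<otimes> b) (s \<otimes> t))"
    by (intro SUP_cong refl; clarify; simp only: prod.case; intro SUP_cong refl; clarify;
        simp only: prod.case)
  also have "\<dots> = frac_class R S (a \<otimes> b) (s \<otimes> t)" using mem by blast
  finally show ?thesis by (simp add: localization_def)
qed

lemma frac_class_add:
  assumes "a \<in> carrier R" "s \<in> S" "b \<in> carrier R" "t \<in> S"
  shows "frac_class R S a s \<oplus>\<^bsub>localization R S\<^esub> frac_class R S b t = frac_class R S (a \<otimes> t \<oplus> b \<otimes> s) (s \<otimes> t)"
proof -
  have *: "frac_class R S (a' \<otimes> t' \<oplus> b' \<otimes> s') (s' \<otimes> t') = frac_class R S (a \<otimes> t \<oplus> b \<otimes> s) (s \<otimes> t)"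
    if r: "((a, s), (a', s')) \<in> frac_rel R S" "((b, t), (b', t')) \<in> frac_rel R S" for a' s' b' t'
  proof -
    obtain u v where c: "a' \<in> carrier R" "b' \<in> carrier R" "s' \<in> S" "t' \<in> S" "u \<in> S" "v \<in> S"
      and 1: "u \<otimes> (a \<otimes> s') = u \<otimes> (a' \<otimes> s)" and 2: "v \<otimes> (b \<otimes> t') = v \<otimes> (b' \<otimes> t)"
      using r by (auto simp: frac_rel_def)
    note cc = c(1-2) c(3-6)[THEN S_closed] assms assms(2,4)[THEN S_closed]
    have "(u \<otimes> v) \<otimes> ((a' \<otimes> t' \<oplus> b' \<otimes> s') \<otimes> (s \<otimes> t))
        = (v \<otimes> t \<otimes> t') \<otimes> (u \<otimes> (a' \<otimes> s)) \<oplus> (u \<otimes> s \<otimes> s') \<otimes> (v \<otimes> (b' \<otimes> t))"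
      using cc by (simp add: m_ac l_distr r_distr)
    also have "\<dots> = (u \<otimes> v) \<otimes> ((a \<otimes> t \<oplus> b \<otimes> s) \<otimes> (s' \<otimes> t'))"
      unfolding 1[symmetric] 2[symmetric] using cc by (simp add: m_ac l_distr r_distr)
    finally show ?thesis
      using c assms by (subst frac_class_eq_iff) (auto intro: S_mult S_closed)
  qed
  have "((a, s), (a, s)) \<in> frac_rel R S" "((b, t), (b, t)) \<in> frac_rel R S"
    using equiv_frac_rel assms by (auto simp: equiv_def refl_on_def)
  then have mem: "(a, s) \<in> frac_class R S a s" "(b, t) \<in> frac_class R S b t"
    by (simp_all add: frac_class_def)
  have "frac_class R S (a' \<otimes> t' \<oplus> b' \<otimes> s') (s' \<otimes> t') = frac_class R S (a \<otimes> t \<oplus> b \<otimes> s) (s \<otimes> t)"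
    if "(a', s') \<in> frac_class R S a s" "(b', t') \<in> frac_class R S b t" for a' s' b' t'
    using * that by (simp add: frac_class_def)
  then have "(\<Union>(a', s')\<in>frac_class R S a s. \<Union>(b', t')\<in>frac_class R S b t. frac_class R S (a' \<otimes> t' \<oplus> b' \<otimes> s') (s' \<otimes> t'))
      = (\<Union>p\<in>frac_class R S a s. \<Union>q\<in>frac_class R S b t. frac_class R S (a \<otimes> t \<oplus> b \<otimes> s) (s \<otimes> t))"
    by (intro SUP_cong refl; clarify; simp only: prod.case; intro SUP_cong refl; clarify;
        simp only: prod.case)
  also have "\<dots> = frac_class R S (a \<otimes> t \<oplus> b \<otimes> s) (s \<otimes> t)" using mem by blast
  finally show ?thesis by (simp add: localization_def)
qed

lemma frac_class_zero: "\<zero>\<^bsub>localization R S\<^esub> = frac_class R S \<zero> \<one>"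
  and frac_class_one: "\<one>\<^bsub>localization R S\<^esub> = frac_class R S \<one> \<one>"
  by (simp_all add: localization_def)

lemma cring_localization: "cring (localization R S)"
proof -
  note [simp] = frac_class_mult frac_class_add frac_class_zero frac_class_one frac_class_closed S_one S_mult
  have neg: "frac_class R S (\<ominus> a) s \<oplus>\<^bsub>localization R S\<^esub> frac_class R S a s = \<zero>\<^bsub>localization R S\<^esub>"
    if "a \<in> carrier R" "s \<in> S" for a s
    using that S_closed[of s] by (simp add: l_minus l_neg, intro frac_class_eqI) auto
  show ?thesis
  proof (rule cringI)
    show "abelian_group (localization R S)"
    proof (rule abelian_groupI)
      show "\<exists>y\<in>carrier (localization R S). y \<oplus>\<^bsub>localization R S\<^esub> x = \<zero>\<^bsub>localization R S\<^esub>"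
        if x: "x \<in> carrier (localization R S)" for x
      proof -
        obtain a s where "a \<in> carrier R" "s \<in> S" "x = frac_class R S a s"
          using frac_class_cases[OF x] by blast
        then show ?thesis
          using neg by (intro bexI[of _ "frac_class R S (\<ominus> a) s"]) auto
      qed
    qed (auto del: equalityI subsetI elim!: frac_class_cases intro!: frac_class_eqI
          simp: m_ac a_ac l_distr r_distr)
    show "comm_monoid (localization R S)"
      by (rule comm_monoidI)
        (auto del: equalityI subsetI elim!: frac_class_cases intro!: frac_class_eqI simp: m_ac)
  qed (auto del: equalityI subsetI elim!: frac_class_cases intro!: frac_class_eqI
          simp: m_ac a_ac l_distr r_distr)
qed

end

subsection \<open>Dimension and regularity\<close>

definition prime_chain :: "('a, 'm) ring_scheme \<Rightarrow> nat \<Rightarrow> (nat \<Rightarrow> 'a set) \<Rightarrow> bool" where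
  "prime_chain R n P \<longleftrightarrow> (\<forall>i\<le>n. primeideal (P i) R) \<and> (\<forall>i<n. P i \<subset> P (Suc i))"

text \<open>The zero ring has no Krull dimension in this sense.\<close>

definition has_krull_dim :: "('a, 'm) ring_scheme \<Rightarrow> nat \<Rightarrow> bool" where
  "has_krull_dim R d \<longleftrightarrow>
     (\<exists>P. prime_chain R d P) \<and> (\<forall>n P. prime_chain R n P \<longrightarrow> n \<le> d)"

definition fin_gen_ideal :: "'a set \<Rightarrow> ('a, 'm) ring_scheme \<Rightarrow> bool" where
  "fin_gen_ideal I R \<longleftrightarrow> (\<exists>A \<subseteq> carrier R. finite A \<and> I = genideal R A)"

definition regular_local_ring :: "('a, 'm) ring_scheme \<Rightarrow> nat \<Rightarrow> bool" where
  "regular_local_ring R d \<longleftrightarrow> cring R \<and> noetherian_ring R \<and> has_krull_dim R d \<and>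
     (\<exists>!M. maximalideal M R) \<and>
     (\<exists>M. maximalideal M R \<and> (\<exists>A \<subseteq> carrier R. finite A \<and> card A = d \<and> M = genideal R A))"


section \<open>Real algebraic sets\<close>

definition real_algebraic_set :: "(real ^ 'n) set \<Rightarrow> bool" where
  "real_algebraic_set X \<longleftrightarrow>
     (\<exists>F. (\<forall>p\<in>F. real_polynomial_function p) \<and> X = {x. \<forall>p\<in>F. p x = 0})"

text \<open>As the base field is infinite, polynomials are identified with polynomial functions.\<close>

definition poly_ring :: "(real ^ 'n \<Rightarrow> real) ring" where
  "poly_ring =
    \<lparr>carrier = {p. real_polynomial_function p},
     mult = (\<lambda>p q x. p x * q x), one = (\<lambda>x. 1), zero = (\<lambda>x. 0), add = (\<lambda>p q x. p x + q x)\<rparr>"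

definition vanishing_ideal :: "(real ^ 'n) set \<Rightarrow> (real ^ 'n \<Rightarrow> real) set" where
  "vanishing_ideal X = {p. real_polynomial_function p \<and> (\<forall>x\<in>X. p x = 0)}"

definition coord_ring :: "(real ^ 'n) set \<Rightarrow> (real ^ 'n \<Rightarrow> real) set ring" where
  "coord_ring X = poly_ring Quot vanishing_ideal X"

definition point_ideal :: "(real ^ 'n) set \<Rightarrow> real ^ 'n \<Rightarrow> (real ^ 'n \<Rightarrow> real) set set" where
  "point_ideal X x =
     {vanishing_ideal X +>\<^bsub>poly_ring\<^esub> p | p. real_polynomial_function p \<and> p x = 0}"

definition local_ring_at ::
    "(real ^ 'n) set \<Rightarrow> real ^ 'n \<Rightarrow> ((real ^ 'n \<Rightarrow> real) set \<times> (real ^ 'n \<Rightarrow> real) set) set ring" where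
  "local_ring_at X x = localization (coord_ring X) (carrier (coord_ring X) - point_ideal X x)"

definition smooth_variety :: "(real ^ 'n) set \<Rightarrow> nat \<Rightarrow> bool" where
  "smooth_variety X d \<longleftrightarrow> real_algebraic_set X \<and> has_krull_dim (coord_ring X) d \<and>
     (\<forall>x\<in>X. regular_local_ring (local_ring_at X x) d)"

lemma cring_poly_ring: "cring poly_ring"
proof (rule cringI)
  show "abelian_group poly_ring"
  proof (rule abelian_groupI)
    fix p :: "real ^ 'n \<Rightarrow> real" assume "p \<in> carrier poly_ring"
    then have "real_polynomial_function (\<lambda>x. (- 1) * p x)"
      unfolding poly_ring_def by (intro real_polynomial_function.intros(2,4)) auto
    then show "\<exists>q\<in>carrier poly_ring. q \<oplus>\<^bsub>poly_ring\<^esub> p = \<zero>\<^bsub>poly_ring\<^esub>"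
      by (auto simp: poly_ring_def intro!: bexI[of _ "\<lambda>x. (- 1) * p x"])
  qed (auto simp: poly_ring_def algebra_simps)
  show "comm_monoid poly_ring"
    by (rule comm_monoidI) (auto simp: poly_ring_def algebra_simps)
qed (auto simp: poly_ring_def algebra_simps)

lemma ideal_vanishing_ideal:
  fixes X :: "(real ^ 'n) set"
  shows "ideal (vanishing_ideal X) poly_ring"
proof -
  interpret P: cring "poly_ring :: (real ^ 'n \<Rightarrow> real) ring" by (rule cring_poly_ring)
  have inv: "(\<ominus>\<^bsub>poly_ring\<^esub> p) = (\<lambda>x. - p x)" if "p \<in> carrier poly_ring" for p :: "real ^ 'n \<Rightarrow> real"
  proof (rule P.minus_equality)
    have "real_polynomial_function (\<lambda>x. (- 1) * p x)"
      using that unfolding poly_ring_def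
      by (intro real_polynomial_function.intros(2,4)) auto
    then show "(\<lambda>x. - p x) \<in> carrier poly_ring" by (simp add: poly_ring_def)
  qed (use that in \<open>auto simp: poly_ring_def\<close>)
  show ?thesis
  proof (rule idealI)
    show "subgroup (vanishing_ideal X) (add_monoid poly_ring)"
    proof (rule P.add.subgroupI)
      show "\<ominus>\<^bsub>poly_ring\<^esub> p \<in> vanishing_ideal X" if "p \<in> vanishing_ideal X" for p
      proof -
        have p: "p \<in> carrier poly_ring" using that by (simp add: vanishing_ideal_def poly_ring_def)
        then have "\<ominus>\<^bsub>poly_ring\<^esub> p \<in> carrier poly_ring" by simp
        then show ?thesis using that unfolding inv[OF p]
          by (simp add: vanishing_ideal_def poly_ring_def)
      qed
    qed (auto simp: vanishing_ideal_def poly_ring_def intro: exI[of _ "\<lambda>x. 0"])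
  qed (auto simp: vanishing_ideal_def poly_ring_def P.ring_axioms[unfolded poly_ring_def])
qed

lemma cring_coord_ring: "cring (coord_ring X)"
  unfolding coord_ring_def
  by (rule ideal.quotient_is_cring[OF ideal_vanishing_ideal cring_poly_ring])

lemma coord_ring_carrier:
  "carrier (coord_ring X) = {vanishing_ideal X +>\<^bsub>poly_ring\<^esub> p | p. real_polynomial_function p}"
  by (auto simp: coord_ring_def FactRing_def A_RCOSETS_def' poly_ring_def)

lemma coset_mem_point_ideal_iff:
  assumes "x \<in> X" "real_polynomial_function p"
  shows "vanishing_ideal X +>\<^bsub>poly_ring\<^esub> p \<in> point_ideal X x \<longleftrightarrow> p x = 0"
proof
  assume "vanishing_ideal X +>\<^bsub>poly_ring\<^esub> p \<in> point_ideal X x"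
  then obtain q where q: "real_polynomial_function q" "q x = 0"
    and eq: "vanishing_ideal X +>\<^bsub>poly_ring\<^esub> p = vanishing_ideal X +>\<^bsub>poly_ring\<^esub> q"
    by (auto simp: point_ideal_def)
  have "p \<in> vanishing_ideal X +>\<^bsub>poly_ring\<^esub> p"
    unfolding a_r_coset_def' by (auto simp: vanishing_ideal_def poly_ring_def intro!: bexI[of _ "\<lambda>x. 0"])
  then have "p \<in> vanishing_ideal X +>\<^bsub>poly_ring\<^esub> q" by (simp only: eq)
  then show "p x = 0"
    unfolding a_r_coset_def' using q assms by (auto simp: vanishing_ideal_def poly_ring_def)
qed (use assms in \<open>auto simp: point_ideal_def\<close>)

lemma mult_set_point:
  assumes "x \<in> X"
  shows "mult_set (coord_ring X) (carrier (coord_ring X) - point_ideal X x)"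
proof -
  interpret C: cring "coord_ring X" by (rule cring_coord_ring)
  interpret I: ideal "vanishing_ideal X" poly_ring by (rule ideal_vanishing_ideal)
  have one: "\<one>\<^bsub>coord_ring X\<^esub> = vanishing_ideal X +>\<^bsub>poly_ring\<^esub> (\<lambda>x. 1)"
    by (simp add: coord_ring_def FactRing_def poly_ring_def)
  have mult: "(vanishing_ideal X +>\<^bsub>poly_ring\<^esub> p) \<otimes>\<^bsub>coord_ring X\<^esub> (vanishing_ideal X +>\<^bsub>poly_ring\<^esub> q)
      = vanishing_ideal X +>\<^bsub>poly_ring\<^esub> (\<lambda>x. p x * q x)"
    if "real_polynomial_function p" "real_polynomial_function q" for p q
    using I.rcoset_mult_add[of p q] that by (simp add: coord_ring_def FactRing_def poly_ring_def)
  show ?thesis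
  proof
    show "\<one>\<^bsub>coord_ring X\<^esub> \<in> carrier (coord_ring X) - point_ideal X x"
      using coset_mem_point_ideal_iff[OF assms, of "\<lambda>x. 1"] C.one_closed by (auto simp: one)
  next
    fix s t assume s: "s \<in> carrier (coord_ring X) - point_ideal X x"
      and t: "t \<in> carrier (coord_ring X) - point_ideal X x"
    obtain p q where pq: "real_polynomial_function p" "s = vanishing_ideal X +>\<^bsub>poly_ring\<^esub> p"
      "real_polynomial_function q" "t = vanishing_ideal X +>\<^bsub>poly_ring\<^esub> q"
      using s t by (auto simp: coord_ring_carrier)
    have "p x \<noteq> 0" "q x \<noteq> 0" using s t pq coset_mem_point_ideal_iff[OF assms] by auto
    then show "s \<otimes>\<^bsub>coord_ring X\<^esub> t \<in> carrier (coord_ring X) - point_ideal X x"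
      using pq mult coset_mem_point_ideal_iff[OF assms, of "\<lambda>x. p x * q x"]
      by (auto simp: coord_ring_carrier)
  qed auto
qed

lemma cring_local_ring_at: "x \<in> X \<Longrightarrow> cring (local_ring_at X x)"
  unfolding local_ring_at_def by (rule mult_set.cring_localization[OF mult_set_point])


section \<open>Regulous functions\<close>

text \<open>
  \<open>Ck_on k f U\<close> is meant for open \<open>U\<close>: \<open>f\<close> is \<open>k\<close> times (Frechet) differentiable on \<open>U\<close> and its
  iterated directional derivatives up to order \<open>k\<close> are continuous.
\<close>

fun Ck_on :: "nat \<Rightarrow> ('a::euclidean_space \<Rightarrow> real) \<Rightarrow> 'a set \<Rightarrow> bool" where
  "Ck_on 0 f U \<longleftrightarrow> continuous_on U f"
| "Ck_on (Suc k) f U \<longleftrightarrow> (\<forall>x\<in>U. f differentiable (at x)) \<and>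
     (\<forall>v. Ck_on k (\<lambda>x. frechet_derivative f (at x) v) U)"

text \<open>
  A function on a submanifold \<open>X\<close> of Euclidean space is of class \<open>C\<^sup>k\<close> iff it extends locally,
  around each point of \<open>X\<close>, to a \<open>C\<^sup>k\<close> function on an open subset of the ambient space.
\<close>

definition Ck_function :: "nat \<Rightarrow> 'a::euclidean_space set \<Rightarrow> ('a \<Rightarrow> real) \<Rightarrow> bool" where
  "Ck_function k X f \<longleftrightarrow>
     (\<forall>x\<in>X. \<exists>U g. open U \<and> x \<in> U \<and> Ck_on k g U \<and> (\<forall>y\<in>X \<inter> U. f y = g y))"

definition zariski_open :: "(real ^ 'n) set \<Rightarrow> (real ^ 'n) set \<Rightarrow> bool" where
  "zariski_open X U \<longleftrightarrow> (\<exists>Z. real_algebraic_set Z \<and> U = X - Z)"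

definition zariski_dense :: "(real ^ 'n) set \<Rightarrow> (real ^ 'n) set \<Rightarrow> bool" where
  "zariski_dense X U \<longleftrightarrow> U \<subseteq> X \<and> (\<forall>Z. real_algebraic_set Z \<and> U \<subseteq> Z \<longrightarrow> X \<subseteq> Z)"

definition regular_function :: "(real ^ 'n) set \<Rightarrow> (real ^ 'n \<Rightarrow> real) \<Rightarrow> bool" where
  "regular_function U f \<longleftrightarrow> (\<exists>p q. real_polynomial_function p \<and> real_polynomial_function q \<and>
     (\<forall>x\<in>U. q x \<noteq> 0 \<and> f x = p x / q x))"

definition rational_function :: "(real ^ 'n) set \<Rightarrow> (real ^ 'n \<Rightarrow> real) \<Rightarrow> bool" where
  "rational_function X f \<longleftrightarrow>
     (\<exists>U. zariski_open X U \<and> zariski_dense X U \<and> regular_function U f)"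

definition regulous :: "nat \<Rightarrow> (real ^ 'n) set \<Rightarrow> (real ^ 'n \<Rightarrow> real) \<Rightarrow> bool" where
  "regulous k X f \<longleftrightarrow> Ck_function k X f \<and> rational_function X f"

text \<open>
  Functions on \<open>X\<close> are represented by functions on the ambient space that are \<^const>\<open>undefined\<close>
  outside \<open>X\<close>, so that equality in the ring is equality on \<open>X\<close>.
\<close>

definition regulous_ring :: "nat \<Rightarrow> (real ^ 'n) set \<Rightarrow> (real ^ 'n \<Rightarrow> real) ring" where
  "regulous_ring k X =
    \<lparr>carrier = {f \<in> extensional X. regulous k X f},
     mult = (\<lambda>f g. \<lambda>x\<in>X. f x * g x), one = (\<lambda>x\<in>X. 1),
     zero = (\<lambda>x\<in>X. 0), add = (\<lambda>f g. \<lambda>x\<in>X. f x + g x)\<rparr>"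

lemma Ck_on_subset: "Ck_on k f U \<Longrightarrow> V \<subseteq> U \<Longrightarrow> Ck_on k f V"
  by (induction k arbitrary: f) (auto intro: continuous_on_subset)

lemma Ck_on_cong:
  assumes "open U" "\<And>x. x \<in> U \<Longrightarrow> f x = g x" "Ck_on k f U"
  shows "Ck_on k g U"
  using assms(2,3)
proof (induction k arbitrary: f g)
  case 0
  then show ?case using continuous_on_cong[of U U f g] by simp
next
  case (Suc k)
  have D: "(g has_derivative frechet_derivative f (at x)) (at x)" if "x \<in> U" for x
    using Suc.prems that assms(1)
    by (auto intro: has_derivative_transform_within_open[of f _ x UNIV U g] simp: frechet_derivative_works)
  have fd: "frechet_derivative f (at x) = frechet_derivative g (at x)" if "x \<in> U" for x
    using D[OF that] by (rule frechet_derivative_at)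
  show ?case
    using D Suc.IH[of "\<lambda>x. frechet_derivative f (at x) v" "\<lambda>x. frechet_derivative g (at x) v" for v]
      Suc.prems(2) fd by (auto simp: differentiable_def)
qed

lemma Ck_on_Suc_le: "Ck_on (Suc k) f U \<Longrightarrow> Ck_on k f U"
proof (induction k arbitrary: f)
  case 0
  then show ?case
    by (simp add: continuous_at_imp_continuous_on differentiable_imp_continuous_within)
next
  case (Suc k)
  have "Ck_on k (\<lambda>x. frechet_derivative f (at x) v) U" for v
    using Suc.prems unfolding Ck_on.simps(2)[of "Suc k" f] by (intro Suc.IH) blast
  moreover have "\<forall>x\<in>U. f differentiable (at x)"
    using Suc.prems unfolding Ck_on.simps(2)[of "Suc k" f] by blast
  ultimately show ?case unfolding Ck_on.simps(2)[of k f] by blast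
qed

lemma Ck_on_const: "Ck_on k (\<lambda>x. c) U"
  by (induction k arbitrary: c) auto

lemma Ck_on_add:
  assumes "open U" "Ck_on k f U" "Ck_on k g U"
  shows "Ck_on k (\<lambda>x. f x + g x) U"
  using assms(2,3)
proof (induction k arbitrary: f g)
  case 0
  then show ?case by (auto intro: continuous_intros)
next
  case (Suc k)
  have "Ck_on k (\<lambda>x. frechet_derivative (\<lambda>x. f x + g x) (at x) v) U" for v
  proof (rule Ck_on_cong[OF assms(1)])
    show "Ck_on k (\<lambda>x. frechet_derivative f (at x) v + frechet_derivative g (at x) v) U"
      using Suc by auto
    fix x assume "x \<in> U"
    then have "((\<lambda>x. f x + g x) has_derivative
        (\<lambda>v. frechet_derivative f (at x) v + frechet_derivative g (at x) v)) (at x)"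
      using Suc.prems by (intro has_derivative_add) (auto simp: frechet_derivative_works)
    from frechet_derivative_at[OF this]
    show "frechet_derivative f (at x) v + frechet_derivative g (at x) v
        = frechet_derivative (\<lambda>x. f x + g x) (at x) v"
      by (auto dest: fun_cong)
  qed
  then show ?case using Suc.prems by auto
qed

lemma Ck_on_mult:
  assumes "open U" "Ck_on k f U" "Ck_on k g U"
  shows "Ck_on k (\<lambda>x. f x * g x) U"
  using assms(2,3)
proof (induction k arbitrary: f g)
  case 0
  then show ?case by (auto intro: continuous_intros)
next
  case (Suc k)
  have "Ck_on k (\<lambda>x. frechet_derivative (\<lambda>x. f x * g x) (at x) v) U" for v
  proof (rule Ck_on_cong[OF assms(1)])
    show "Ck_on k (\<lambda>x. f x * frechet_derivative g (at x) v + frechet_derivative f (at x) v * g x) U"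
      using Suc.prems by (intro Ck_on_add assms(1) Suc.IH Ck_on_Suc_le[OF Suc.prems(1)]
          Ck_on_Suc_le[OF Suc.prems(2)]) auto
    fix x assume "x \<in> U"
    then have "((\<lambda>x. f x * g x) has_derivative
        (\<lambda>v. f x * frechet_derivative g (at x) v + frechet_derivative f (at x) v * g x)) (at x)"
      using Suc.prems by (intro has_derivative_mult) (auto simp: frechet_derivative_works)
    from frechet_derivative_at[OF this]
    show "f x * frechet_derivative g (at x) v + frechet_derivative f (at x) v * g x
        = frechet_derivative (\<lambda>x. f x * g x) (at x) v"
      by (auto dest: fun_cong)
  qed
  then show ?case using Suc.prems by (auto intro: differentiable_mult)
qed

lemma Ck_function_binop:
  fixes X :: "'a::euclidean_space set"
  assumes "Ck_function k X f" "Ck_function k X g"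
    and op: "\<And>(U :: 'a set) f g. open U \<Longrightarrow> Ck_on k f U \<Longrightarrow> Ck_on k g U \<Longrightarrow> Ck_on k (\<lambda>x. h (f x) (g x)) U"
  shows "Ck_function k X (\<lambda>x\<in>X. h (f x) (g x))"
  unfolding Ck_function_def
proof
  fix x assume x: "x \<in> X"
  obtain U a where U: "open U" "x \<in> U" "Ck_on k a U" "\<forall>y\<in>X \<inter> U. f y = a y"
    using assms(1) x unfolding Ck_function_def by blast
  obtain V b where V: "open V" "x \<in> V" "Ck_on k b V" "\<forall>y\<in>X \<inter> V. g y = b y"
    using assms(2) x unfolding Ck_function_def by blast
  have "Ck_on k (\<lambda>x. h (a x) (b x)) (U \<inter> V)"
    using op[OF open_Int[OF U(1) V(1)] Ck_on_subset[OF U(3) Int_lower1] Ck_on_subset[OF V(3) Int_lower2]] .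
  then show "\<exists>W c. open W \<and> x \<in> W \<and> Ck_on k c W \<and> (\<forall>y\<in>X \<inter> W. (\<lambda>x\<in>X. h (f x) (g x)) y = c y)"
    using U V by (intro exI[of _ "U \<inter> V"] exI[of _ "\<lambda>x. h (a x) (b x)"]) auto
qed

lemma real_algebraic_set_Un:
  assumes "real_algebraic_set Y" "real_algebraic_set Z"
  shows "real_algebraic_set (Y \<union> Z)"
proof -
  obtain F G where F: "\<forall>p\<in>F. real_polynomial_function p" "Y = {x. \<forall>p\<in>F. p x = 0}"
    and G: "\<forall>p\<in>G. real_polynomial_function p" "Z = {x. \<forall>p\<in>G. p x = 0}"
    using assms by (auto simp: real_algebraic_set_def)
  let ?H = "{\<lambda>x. p x * q x | p q. p \<in> F \<and> q \<in> G}"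
  have "\<forall>h\<in>?H. real_polynomial_function h" using F G by auto
  moreover have "Y \<union> Z = {x. \<forall>h\<in>?H. h x = 0}"
  proof
    show "{x. \<forall>h\<in>?H. h x = 0} \<subseteq> Y \<union> Z"
    proof clarify
      fix x assume x: "\<forall>h\<in>?H. h x = 0" "x \<notin> Z"
      from x(2) obtain q where q: "q \<in> G" "q x \<noteq> 0" by (auto simp: G)
      have "p x = 0" if "p \<in> F" for p
      proof -
        have "(\<lambda>x. p x * q x) \<in> ?H" using that q by blast
        then have "p x * q x = 0" using x(1) by fast
        then show ?thesis using q by simp
      qed
      then show "x \<in> Y" by (simp add: F)
    qed
  qed (auto simp: F G)
  ultimately show ?thesis unfolding real_algebraic_set_def by blast
qed

lemma zariski_open_dense_Int:
  assumes "zariski_open X U" "zariski_dense X U" "zariski_open X V" "zariski_dense X V"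
  shows "zariski_open X (U \<inter> V)" "zariski_dense X (U \<inter> V)"
proof -
  obtain Y Z where Y: "real_algebraic_set Y" "U = X - Y" and Z: "real_algebraic_set Z" "V = X - Z"
    using assms by (auto simp: zariski_open_def)
  have "U \<inter> V = X - (Y \<union> Z)" using Y Z by auto
  then show "zariski_open X (U \<inter> V)"
    using real_algebraic_set_Un[OF Y(1) Z(1)] by (auto simp: zariski_open_def)
  show "zariski_dense X (U \<inter> V)" unfolding zariski_dense_def
  proof (intro conjI allI impI)
    fix W assume W: "real_algebraic_set W \<and> U \<inter> V \<subseteq> W"
    then have "V \<subseteq> W \<union> Y" using Y Z by auto
    moreover have "real_algebraic_set (W \<union> Y)" using W Y by (auto intro: real_algebraic_set_Un)
    ultimately have "X \<subseteq> W \<union> Y" using assms(4) unfolding zariski_dense_def by blast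
    then have "U \<subseteq> W" using Y by auto
    then show "X \<subseteq> W" using W assms(2) unfolding zariski_dense_def by blast
  qed (use assms in \<open>auto simp: zariski_dense_def\<close>)
qed

lemma rational_function_binop:
  fixes X :: "(real ^ 'n) set"
  assumes "rational_function X f" "rational_function X g"
    and op: "\<And>(U :: (real ^ 'n) set) f g. regular_function U f \<Longrightarrow> regular_function U g \<Longrightarrow> regular_function U (\<lambda>x. h (f x) (g x))"
  shows "rational_function X (\<lambda>x\<in>X. h (f x) (g x))"
proof -
  obtain U V where U: "zariski_open X U" "zariski_dense X U" "regular_function U f"
    and V: "zariski_open X V" "zariski_dense X V" "regular_function V g"
    using assms unfolding rational_function_def by blast
  have "regular_function (U \<inter> V) f" "regular_function (U \<inter> V) g"
    using U(3) V(3) unfolding regular_function_def by blast+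
  then have "regular_function (U \<inter> V) (\<lambda>x. h (f x) (g x))" by (rule op[of "U \<inter> V" f g])
  moreover have "U \<inter> V \<subseteq> X" using U by (auto simp: zariski_dense_def)
  ultimately have "regular_function (U \<inter> V) (\<lambda>x\<in>X. h (f x) (g x))"
    unfolding regular_function_def by (metis (no_types, lifting) restrict_apply' subsetD)
  then show ?thesis
    using zariski_open_dense_Int[OF U(1,2) V(1,2)] unfolding rational_function_def by blast
qed

lemma regular_function_add:
  assumes "regular_function U f" "regular_function U g"
  shows "regular_function U (\<lambda>x. f x + g x)"
proof -
  obtain p q r s where *: "real_polynomial_function p" "real_polynomial_function q"
    "real_polynomial_function r" "real_polynomial_function s"
    "\<forall>x\<in>U. q x \<noteq> 0 \<and> f x = p x / q x" "\<forall>x\<in>U. s x \<noteq> 0 \<and> g x = r x / s x"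
    using assms unfolding regular_function_def by blast
  then show ?thesis unfolding regular_function_def
    by (intro exI[of _ "\<lambda>x. p x * s x + r x * q x"] exI[of _ "\<lambda>x. q x * s x"])
      (auto simp: add_frac_eq)
qed

lemma regular_function_mult:
  assumes "regular_function U f" "regular_function U g"
  shows "regular_function U (\<lambda>x. f x * g x)"
proof -
  obtain p q r s where *: "real_polynomial_function p" "real_polynomial_function q"
    "real_polynomial_function r" "real_polynomial_function s"
    "\<forall>x\<in>U. q x \<noteq> 0 \<and> f x = p x / q x" "\<forall>x\<in>U. s x \<noteq> 0 \<and> g x = r x / s x"
    using assms unfolding regular_function_def by blast
  then show ?thesis unfolding regular_function_def
    by (intro exI[of _ "\<lambda>x. p x * r x"] exI[of _ "\<lambda>x. q x * s x"]) auto
qed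

lemma regulous_add:
  assumes "regulous k X f" "regulous k X g"
  shows "regulous k X (\<lambda>x\<in>X. f x + g x)"
proof -
  have "Ck_function k X (\<lambda>x\<in>X. f x + g x)"
    using assms by (intro Ck_function_binop Ck_on_add) (auto simp: regulous_def)
  moreover have "rational_function X (\<lambda>x\<in>X. f x + g x)"
    using assms by (intro rational_function_binop regular_function_add) (auto simp: regulous_def)
  ultimately show ?thesis by (simp add: regulous_def)
qed

lemma regulous_mult:
  assumes "regulous k X f" "regulous k X g"
  shows "regulous k X (\<lambda>x\<in>X. f x * g x)"
proof -
  have "Ck_function k X (\<lambda>x\<in>X. f x * g x)"
    using assms by (intro Ck_function_binop Ck_on_mult) (auto simp: regulous_def)
  moreover have "rational_function X (\<lambda>x\<in>X. f x * g x)"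
    using assms by (intro rational_function_binop regular_function_mult) (auto simp: regulous_def)
  ultimately show ?thesis by (simp add: regulous_def)
qed

lemma regulous_const: "regulous k X (\<lambda>x\<in>X. c)"
proof -
  have "Ck_function k X (\<lambda>x\<in>X. c)"
    unfolding Ck_function_def by (auto intro!: exI[of _ UNIV] exI[of _ "\<lambda>x. c"] Ck_on_const)
  moreover have "zariski_open X X"
    unfolding zariski_open_def real_algebraic_set_def
    by (rule exI[of _ "{}"]) (auto intro!: exI[of _ "{\<lambda>x. 1}"])
  moreover have "zariski_dense X X" by (auto simp: zariski_dense_def)
  moreover have "regular_function X (\<lambda>x\<in>X. c)"
    unfolding regular_function_def by (intro exI[of _ "\<lambda>x. c"] exI[of _ "\<lambda>x. 1"]) auto
  ultimately show ?thesis unfolding regulous_def rational_function_def by blast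
qed

lemma cring_regulous_ring: "cring (regulous_ring k X)"
proof (rule cringI)
  show "abelian_group (regulous_ring k X)"
  proof (rule abelian_groupI)
    fix f assume f: "f \<in> carrier (regulous_ring k X)"
    have "(\<lambda>x\<in>X. (\<lambda>x\<in>X. - 1) x * f x) \<in> carrier (regulous_ring k X)"
      using f regulous_mult[OF regulous_const[of k X "- 1"]] by (auto simp: regulous_ring_def)
    moreover have "(\<lambda>x\<in>X. (\<lambda>x\<in>X. - 1) x * f x) \<oplus>\<^bsub>regulous_ring k X\<^esub> f = \<zero>\<^bsub>regulous_ring k X\<^esub>"
      by (auto simp: regulous_ring_def)
    ultimately show "\<exists>g\<in>carrier (regulous_ring k X). g \<oplus>\<^bsub>regulous_ring k X\<^esub> f = \<zero>\<^bsub>regulous_ring k X\<^esub>"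
      by blast
  qed (auto simp: regulous_ring_def regulous_add regulous_const algebra_simps extensional_def
      intro!: ext)
  show "comm_monoid (regulous_ring k X)"
    by (rule comm_monoidI)
      (auto simp: regulous_ring_def regulous_mult regulous_const algebra_simps extensional_def
        intro!: ext)
qed (auto simp: regulous_ring_def algebra_simps intro!: ext)

end

theory Submission
  imports Defs
begin

text \<open>
  A finitely generated maximal ideal is the ideal \<open>M\<^sub>x\<close> of a point \<open>x\<close>: otherwise the sum of the
  squares of the generators has no zero on \<open>X\<close> and is a unit. If \<open>M\<^sub>x\<close> were finitely generated, then
  \<open>M\<^sub>x / M\<^sub>x\<^sup>2\<close> would be finite dimensional.

  Regularity of the local ring gives \<open>d\<close> coordinates at \<open>x\<close> and derivations of the polynomial ring
  dual to them that kill the local equations of \<open>X\<close>. As the local dimension is \<open>d\<close>, Krull's height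
  theorem shows that no nonzero form in the \<open>d\<close> coordinates is the leading form of a polynomial
  vanishing on \<open>X\<close>; hence the flows give analytic arcs \<open>\<gamma>\<^sub>v\<close> in \<open>X\<close> through \<open>x\<close> for all
  directions \<open>v\<close>, and the Taylor coefficients of a polynomial along \<open>\<gamma>\<^sub>v\<close> are polynomial in \<open>v\<close>. Hence,
  for fixed finitely many generators, the coefficient of order \<open>k + 1\<close> along \<open>\<gamma>\<^sub>v\<close> of an element
  of \<open>M\<^sub>x\<^sup>2\<close> is polynomial on suitable lines of directions \<open>v\<close>. Let \<open>\<rho>\<close> be the squared distance to
  \<open>x\<close> and \<open>\<ell>\<close> a linear form at \<open>x\<close>. The functions \<open>\<ell>\<^bsup>k + 1\<^esup> (\<ell>\<^sup>2 / \<rho>)\<^sup>j\<close> belong to \<open>M\<^sub>x\<close>, and on a line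
  on which \<open>\<ell>\<close> is constant, which exists as \<open>d \<ge> 2\<close>, their coefficients are powers of the reciprocal
  of a quadratic polynomial. No nontrivial combination of these powers is a polynomial, so
  infinitely many of these functions are independent modulo \<open>M\<^sub>x\<^sup>2\<close>.
\<close>

section \<open>Ideals in commutative rings\<close>

text \<open>The obstacle is that an element of M_x is only of class C^k and need not have a
  coefficient of order k + 1 along an arc, so M_x / M_x^2 cannot be studied through jets of single
  functions. Products gain one order. If k > 0, each factor is a polynomial up to o(t^k) and is
  itself O(t), so the product agrees with a product of polynomials up to o(t^(k+1)). If k = 0,
  continuity says nothing about order 1, and rationality takes its place: along a power series arc a
  rational function is a quotient of power series, so when it tends to 0 it is O(t), and a product
  of two elements of M_x is o(t). Directions in which the arc misses the common domain of the
  generators must be avoided; this costs finitely many points of a line. The test functions are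
  homogeneous of degree k + 1 in y - x. This makes them C^k, while their coefficient of order k + 1
  is their value at the velocity of the arc. Regularity supplies equations of X near x, but their
  common zeros might a priori form a larger set than X. The length of the prime chain rules this
  out; it is the substitute for an implicit function theorem.\<close>

interpretation rmod: Modules.module "(*) :: 'a::comm_ring_1 \<Rightarrow> 'a \<Rightarrow> 'a"
  by unfold_locales (auto simp: algebra_simps)

declare rmod.scale_scale [simp del]

text \<open>With the ring as a module over itself, \<open>rmod.subspace\<close> means "ideal" and
  \<open>rmod.span\<close> is the generated ideal, so the theory of modules serves as ideal theory
  throughout.\<close>

definition prime_id :: "'a::comm_ring_1 set \<Rightarrow> bool" where
  "prime_id P \<longleftrightarrow> rmod.subspace P \<and> 1 \<notin> P \<and> (\<forall>a b. a * b \<in> P \<longrightarrow> a \<in> P \<or> b \<in> P)"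

lemma prime_id_subspace: "prime_id P \<Longrightarrow> rmod.subspace P"
  by (simp add: prime_id_def)

lemma prime_id_multD: "prime_id P \<Longrightarrow> a * b \<in> P \<Longrightarrow> a \<in> P \<or> b \<in> P"
  by (auto simp: prime_id_def)

lemma prime_id_one: "prime_id P \<Longrightarrow> 1 \<notin> P"
  by (simp add: prime_id_def)

lemma prime_id_powerD: "prime_id P \<Longrightarrow> a ^ n \<in> P \<Longrightarrow> a \<in> P"
proof (induction n)
  case 0
  then show ?case using prime_id_one[of P] by simp
next
  case (Suc n)
  then show ?case using prime_id_multD[of P a "a ^ n"] by auto
qed

lemma ideal_mult_left: "rmod.subspace I \<Longrightarrow> a \<in> I \<Longrightarrow> r * a \<in> I"
  using rmod.subspace_scale by blast

lemma ideal_mult_right: "rmod.subspace I \<Longrightarrow> a \<in> I \<Longrightarrow> a * r \<in> I"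
  using rmod.subspace_scale[of I a r] by (simp add: mult.commute)

lemma ideal_one: "rmod.subspace I \<Longrightarrow> 1 \<in> I \<Longrightarrow> I = UNIV"
  using ideal_mult_left[of I 1] by auto

lemma span_insert_cases:
  assumes "y \<in> rmod.span (insert e I)" "rmod.subspace I"
  obtains c z where "z \<in> I" "y = z + c * e"
proof -
  from assms obtain k where "y - k * e \<in> I"
    unfolding rmod.span_breakdown_eq assms(2)[folded rmod.span_eq_iff] by blast
  then show thesis by (rule that) simp
qed

lemma ideal_plus:
  assumes "rmod.subspace I" "rmod.subspace J"
  shows "rmod.subspace {a + b | a b. a \<in> I \<and> b \<in> J}"
proof -
  have "rmod.span I = I" "rmod.span J = J" using assms by (simp_all only: rmod.span_eq_iff)
  then have "rmod.span (I \<union> J) = {a + b | a b. a \<in> I \<and> b \<in> J}" by (simp only: rmod.span_Un)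
  then show ?thesis using rmod.subspace_span[of "I \<union> J"] by simp
qed

text \<open>The contraction to the ring of the extension of \<open>I\<close> to the localization at
  \<open>P\<close>. Local statements are made through \<open>sat\<close>, without fractions.\<close>

definition sat :: "'a::comm_ring_1 set \<Rightarrow> 'a set \<Rightarrow> 'a set" where
  "sat P I = {y. \<exists>t. t \<notin> P \<and> t * y \<in> I}"

lemma satI: "t \<notin> P \<Longrightarrow> t * y \<in> I \<Longrightarrow> y \<in> sat P I"
  by (auto simp: sat_def)

lemma satE:
  assumes "y \<in> sat P I"
  obtains t where "t \<notin> P" "t * y \<in> I"
  using assms by (auto simp: sat_def)

lemma prime_id_mult_notin: "prime_id P \<Longrightarrow> s \<notin> P \<Longrightarrow> t \<notin> P \<Longrightarrow> s * t \<notin> P"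
  by (auto dest: prime_id_multD)

lemma ideal_sat:
  assumes P: "prime_id P" and I: "rmod.subspace I"
  shows "rmod.subspace (sat P I)"
proof (rule rmod.subspaceI)
  show "0 \<in> sat P I" using prime_id_one[OF P] rmod.subspace_0[OF I] by (auto intro: satI[of 1])
next
  fix x y assume "x \<in> sat P I" "y \<in> sat P I"
  then obtain s t where st: "s \<notin> P" "s * x \<in> I" "t \<notin> P" "t * y \<in> I" by (auto elim!: satE)
  have "(s * t) * (x + y) = t * (s * x) + s * (t * y)" by (simp add: algebra_simps)
  also have "\<dots> \<in> I"
    by (rule rmod.subspace_add[OF I ideal_mult_left[OF I st(2)] ideal_mult_left[OF I st(4)]])
  finally have "(s * t) * (x + y) \<in> I" .
  then show "x + y \<in> sat P I" using prime_id_mult_notin[OF P] st by (blast intro: satI)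
next
  fix c x assume "x \<in> sat P I"
  then obtain s where "s \<notin> P" "s * x \<in> I" by (auto elim!: satE)
  then have "s * (c * x) \<in> I" using ideal_mult_left[OF I, of "s * x" c] by (simp add: algebra_simps)
  then show "c * x \<in> sat P I" using \<open>s \<notin> P\<close> by (blast intro: satI)
qed

lemma sat_superset: "prime_id P \<Longrightarrow> I \<subseteq> sat P I"
  using prime_id_one[of P] by (auto intro: satI[of 1])

lemma sat_mono: "I \<subseteq> J \<Longrightarrow> sat P I \<subseteq> sat P J"
  by (auto simp: sat_def)

lemma sat_sat:
  assumes P: "prime_id P"
  shows "sat P (sat P I) \<subseteq> sat P I"
proof
  fix y assume "y \<in> sat P (sat P I)"
  then obtain s t where "s \<notin> P" "t \<notin> P" "t * (s * y) \<in> I" unfolding sat_def by blast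
  then show "y \<in> sat P I"
    using prime_id_mult_notin[OF P, of t s] by (intro satI[of "t * s"]) (auto simp: mult.assoc)
qed

lemma sat_cancel:
  assumes "prime_id P" "t \<notin> P" "t * y \<in> sat P I"
  shows "y \<in> sat P I"
  using satI[OF assms(2,3)] sat_sat[OF assms(1)] by blast

lemma sat_prime:
  assumes "prime_id Q" "Q \<subseteq> P" shows "sat P Q \<subseteq> Q"
  using assms prime_id_multD[OF assms(1)] unfolding sat_def by blast

text \<open>Nakayama's lemma in the localization at \<open>P\<close>, by Gaussian elimination of the generators.\<close>

lemma local_nakayama:
  assumes P: "prime_id P" and K: "rmod.subspace K" and "finite F"
    and "\<And>f. f \<in> F \<Longrightarrow> \<exists>t z c. t \<notin> P \<and> z \<in> K \<and> (\<forall>g\<in>F. c g \<in> P) \<and> t * f = z + (\<Sum>g\<in>F. c g * g)"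
  shows "F \<subseteq> sat P K"
  using \<open>finite F\<close> assms(4)
proof (induction F rule: finite_induct)
  case (insert f F)
  note sP = prime_id_subspace[OF P]
  obtain t z c where f: "t \<notin> P" "z \<in> K" "\<forall>g\<in>insert f F. c g \<in> P" "t * f = z + (\<Sum>g\<in>insert f F. c g * g)"
    using insert.prems[of f] by auto
  \<comment> \<open>The summand of \<open>f\<close> itself is moved to the left. As
    \<open>c f\<close> lies in \<open>P\<close>, the new coefficient of \<open>f\<close> still lies
    outside \<open>P\<close>.\<close>
  define t' where "t' = t - c f"
  have t': "t' \<notin> P"
    using f rmod.subspace_add[OF sP, of "t - c f" "c f"] by (auto simp: t'_def)
  have tf: "t' * f = z + (\<Sum>g\<in>F. c g * g)"
    using f(4) insert.hyps by (simp add: t'_def algebra_simps)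
  have F: "F \<subseteq> sat P K"
  proof (rule insert.IH)
    fix h assume h: "h \<in> F"
    obtain s y e where e: "s \<notin> P" "y \<in> K" "\<forall>g\<in>insert f F. e g \<in> P" "s * h = y + (\<Sum>g\<in>insert f F. e g * g)"
      using insert.prems[of h] h by auto
    \<comment> \<open>After multiplication by \<open>t'\<close> the generator \<open>f\<close> can
      be eliminated from the relation of \<open>h\<close>.\<close>
    have "(t' * s) * h = t' * (y + e f * f + (\<Sum>g\<in>F. e g * g))"
      using e(4) insert.hyps by (simp add: mult.assoc add.assoc)
    also have "\<dots> = t' * y + e f * (t' * f) + t' * (\<Sum>g\<in>F. e g * g)"
      by (simp add: algebra_simps)
    also have "\<dots> = (t' * y + e f * z) + (\<Sum>g\<in>F. (e f * c g + t' * e g) * g)"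
      unfolding tf by (simp add: algebra_simps sum.distrib sum_distrib_left)
    finally have "(t' * s) * h = (t' * y + e f * z) + (\<Sum>g\<in>F. (e f * c g + t' * e g) * g)" .
    moreover have "t' * y + e f * z \<in> K"
      using e f by (intro rmod.subspace_add[OF K] ideal_mult_left[OF K])
    moreover have "\<forall>g\<in>F. e f * c g + t' * e g \<in> P"
      using e f by (auto intro!: rmod.subspace_add[OF sP] ideal_mult_left[OF sP])
    ultimately show "\<exists>t z c. t \<notin> P \<and> z \<in> K \<and> (\<forall>g\<in>F. c g \<in> P) \<and> t * h = z + (\<Sum>g\<in>F. c g * g)"
      using prime_id_mult_notin[OF P t' e(1)]
      by (intro exI[of _ "t' * s"] exI[of _ "t' * y + e f * z"] exI[of _ "\<lambda>g. e f * c g + t' * e g"]) auto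
  qed
  note sS = ideal_sat[OF P K]
  have "t' * f \<in> sat P K"
    unfolding tf using f(2) F sat_superset[OF P, of K]
    by (intro rmod.subspace_add[OF sS] rmod.subspace_sum[OF sS] ideal_mult_left[OF sS]) auto
  then have "f \<in> sat P K" using t' sat_cancel[OF P] by blast
  then show ?case using F by simp
qed simp

text \<open>The elements of \<open>F\<close> act nilpotently modulo \<open>K\<close>. Multiplying
  \<open>e0\<close>, for one \<open>u\<close> after the other, by the highest power of
  \<open>u\<close> that does not yet lead into \<open>K\<close> gives a multiple that is nonzero
  modulo \<open>K\<close> and killed by all of \<open>F\<close>.\<close>

lemma socle:
  fixes K :: "'a::comm_ring_1 set"
  assumes K: "rmod.subspace K" and "finite F" and "\<And>u. u \<in> F \<Longrightarrow> \<exists>r::nat. u ^ r \<in> K" and "e0 \<notin> K"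
  shows "\<exists>c. c * e0 \<notin> K \<and> (\<forall>u\<in>F. u * (c * e0) \<in> K)"
  using assms(2,3)
proof (induction F rule: finite_induct)
  case empty
  show ?case using assms(4) by (intro exI[of _ 1]) auto
next
  case (insert u F)
  then obtain c where c: "c * e0 \<notin> K" "\<forall>v\<in>F. v * (c * e0) \<in> K" by auto
  obtain r where "u ^ r \<in> K" using insert.prems by auto
  then have ex: "u ^ r * (c * e0) \<in> K" by (rule ideal_mult_right[OF K])
  define n where "n = (LEAST r. u ^ r * (c * e0) \<in> K)"
  have n: "u ^ n * (c * e0) \<in> K" unfolding n_def using ex by (rule LeastI)
  have "n \<noteq> 0" using n c by (intro notI) simp
  then obtain m where m: "n = Suc m" using not0_implies_Suc by blast
  have "u ^ m * (c * e0) \<notin> K" using not_less_Least[of m "\<lambda>r. u ^ r * (c * e0) \<in> K"] m by (simp add: n_def)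
  moreover have "u * (u ^ m * (c * e0)) \<in> K" using n unfolding m power_Suc mult.assoc .
  moreover have "v * (u ^ m * (c * e0)) \<in> K" if "v \<in> F" for v
    using ideal_mult_left[OF K, of "v * (c * e0)" "u ^ m"] c that by (subst mult.left_commute) blast
  ultimately have "(u ^ m * c) * e0 \<notin> K \<and> (\<forall>v\<in>insert u F. v * ((u ^ m * c) * e0) \<in> K)"
    unfolding mult.assoc by blast
  then show ?case by (rule exI)
qed

subsection \<open>Noetherian rings\<close>

class noeth_ring = comm_ring_1 +
  assumes ideal_fg: "0 \<in> I \<Longrightarrow> (\<And>a b. a \<in> I \<Longrightarrow> b \<in> I \<Longrightarrow> a + b \<in> I) \<Longrightarrow> (\<And>r a. a \<in> I \<Longrightarrow> r * a \<in> I) \<Longrightarrow>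
    \<exists>F. finite F \<and> F \<subseteq> I \<and> (\<forall>a\<in>I. \<exists>c. a = (\<Sum>f\<in>F. c f * f))"

lemma ideal_finite_span:
  fixes I :: "'a::noeth_ring set"
  assumes "rmod.subspace I"
  obtains F where "finite F" "F \<subseteq> I" "I = rmod.span F"
proof -
  have "\<exists>F. finite F \<and> F \<subseteq> I \<and> (\<forall>a\<in>I. \<exists>c. a = (\<Sum>f\<in>F. c f * f))"
    by (rule ideal_fg[OF rmod.subspace_0[OF assms] rmod.subspace_add[OF assms] ideal_mult_left[OF assms]])
  then obtain F where F: "finite F" "F \<subseteq> I" "\<forall>a\<in>I. \<exists>c. a = (\<Sum>f\<in>F. c f * f)"
    by (elim exE conjE)
  have "I \<subseteq> rmod.span F" unfolding rmod.span_finite[OF F(1)] using F(3) by blast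
  then have "I = rmod.span F" using rmod.span_minimal[OF F(2) assms] by (rule equalityI)
  then show thesis by (rule that[OF F(1,2)])
qed

text \<open>The union of a chain of ideals has finitely many generators, which already lie in one
  member, so Zorn's lemma applies. Several proofs below use it to pick a maximal
  counterexample.\<close>

lemma noeth_maximal:
  fixes C :: "'a::noeth_ring set set"
  assumes "I0 \<in> C" and C: "\<And>I. I \<in> C \<Longrightarrow> rmod.subspace I"
  shows "\<exists>M\<in>C. I0 \<subseteq> M \<and> (\<forall>I\<in>C. M \<subseteq> I \<longrightarrow> I = M)"
proof -
  define D where "D = {I \<in> C. I0 \<subseteq> I}"
  have "\<exists>M\<in>D. \<forall>X\<in>D. M \<subseteq> X \<longrightarrow> X = M"
  proof (rule subset_Zorn_nonempty)
    show "D \<noteq> {}" using assms(1) by (auto simp: D_def)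
    fix c assume c: "c \<noteq> {}" "subset.chain D c"
    have cD: "c \<subseteq> D" and tot: "\<And>X Y. X \<in> c \<Longrightarrow> Y \<in> c \<Longrightarrow> X \<subseteq> Y \<or> Y \<subseteq> X"
      using c(2) by (auto simp: subset_chain_def)
    have sub: "rmod.subspace X" if "X \<in> c" for X using that cD C by (auto simp: D_def)
    have "rmod.subspace (\<Union>c)"
    proof (rule rmod.subspaceI)
      show "0 \<in> \<Union>c" using c(1) sub rmod.subspace_0 by blast
      show "x + y \<in> \<Union>c" if xy: "x \<in> \<Union>c" "y \<in> \<Union>c" for x y
      proof -
        obtain X Y where XY: "X \<in> c" "x \<in> X" "Y \<in> c" "y \<in> Y" using xy by blast
        with tot[of X Y] show ?thesis using rmod.subspace_add[OF sub] by blast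
      qed
      show "r * x \<in> \<Union>c" if "x \<in> \<Union>c" for r x using that sub ideal_mult_left by blast
    qed
    then obtain F where F: "finite F" "F \<subseteq> \<Union>c" "\<Union>c = rmod.span F" by (rule ideal_finite_span)
    obtain X where X: "X \<in> c" "F \<subseteq> X"
      using finite_subset_Union_chain[OF F(1,2) c(1)] c(2) by blast
    have "\<Union>c \<subseteq> X" unfolding F(3) using X sub by (intro rmod.span_minimal) auto
    then have "\<Union>c = X" using X by auto
    then show "\<Union>c \<in> D" using X cD by auto
  qed
  then obtain M where M: "M \<in> D" "\<forall>X\<in>D. M \<subseteq> X \<longrightarrow> X = M" by (elim bexE)
  show ?thesis
  proof (intro bexI conjI ballI impI)
    show "M \<in> C" "I0 \<subseteq> M" using M(1) by (simp_all add: D_def)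
    fix I assume "I \<in> C" "M \<subseteq> I"
    then have "I \<in> D" using \<open>I0 \<subseteq> M\<close> unfolding D_def by blast
    then show "I = M" using \<open>M \<subseteq> I\<close> by (rule M(2)[rule_format])
  qed
qed

text \<open>An ideal maximal among those disjoint from \<open>S\<close> is prime: if it contained a
  product but neither factor, enlarging it by either factor would meet \<open>S\<close>, and the
  product of the two elements met would lie both in \<open>S\<close> and in the ideal.\<close>

lemma prime_id_exists:
  fixes I :: "'a::noeth_ring set"
  assumes I: "rmod.subspace I" and S: "1 \<in> S" "\<And>s t. s \<in> S \<Longrightarrow> t \<in> S \<Longrightarrow> s * t \<in> S" and dis: "I \<inter> S = {}"
  obtains Q where "prime_id Q" "I \<subseteq> Q" "Q \<inter> S = {}"
proof -
  define C where "C = {J. rmod.subspace J \<and> J \<inter> S = {}}"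
  have "\<exists>Q\<in>C. I \<subseteq> Q \<and> (\<forall>J\<in>C. Q \<subseteq> J \<longrightarrow> J = Q)"
    by (rule noeth_maximal) (simp_all add: C_def I dis)
  then obtain Q where Q: "Q \<in> C" "I \<subseteq> Q" "\<forall>J\<in>C. Q \<subseteq> J \<longrightarrow> J = Q" by (elim bexE conjE)
  have sQ: "rmod.subspace Q" and dQ: "Q \<inter> S = {}" using Q(1) by (auto simp: C_def)
  have meet: "\<exists>z\<in>Q. \<exists>c. z + c * a \<in> S" if "a \<notin> Q" for a
  proof -
    have "rmod.span (insert a Q) \<noteq> Q" using that rmod.span_base[of a "insert a Q"] by auto
    then have "rmod.span (insert a Q) \<notin> C" using Q(3) rmod.span_superset[of "insert a Q"] by blast
    then obtain y where "y \<in> S" "y \<in> rmod.span (insert a Q)" by (auto simp: C_def)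
    from \<open>y \<in> rmod.span (insert a Q)\<close> sQ obtain c z where "z \<in> Q" "y = z + c * a" by (rule span_insert_cases)
    then show ?thesis using \<open>y \<in> S\<close> by blast
  qed
  have "prime_id Q" unfolding prime_id_def
  proof (intro conjI allI impI sQ)
    show "1 \<notin> Q" using S dQ by blast
    fix a b assume ab: "a * b \<in> Q"
    show "a \<in> Q \<or> b \<in> Q"
    proof (rule ccontr)
      assume "\<not> (a \<in> Q \<or> b \<in> Q)"
      then obtain z c w d where *: "z \<in> Q" "z + c * a \<in> S" "w \<in> Q" "w + d * b \<in> S"
        using meet[of a] meet[of b] by blast
      have "(z + c * a) * (w + d * b) = z * (w + d * b) + w * (c * a) + (c * d) * (a * b)"
        by (simp add: algebra_simps)
      also have "\<dots> \<in> Q"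
        by (intro rmod.subspace_add[OF sQ] ideal_mult_left[OF sQ ab] ideal_mult_right[OF sQ *(1)] ideal_mult_right[OF sQ *(3)])
      finally show False using S(2)[OF *(2,4)] dQ by blast
    qed
  qed
  then show thesis using Q(2) dQ by (rule that)
qed

text \<open>The products \<open>t * p ^ r\<close> with \<open>t\<close> outside \<open>P\<close>
  form a multiplicative set. If \<open>I\<close> were disjoint from it, some prime above
  \<open>I\<close> would be disjoint from it too, hence contained in \<open>P\<close> but without
  \<open>p\<close>, against minimality.\<close>

lemma minimal_prime_nilpotent:
  fixes I :: "'a::noeth_ring set"
  assumes P: "prime_id P" and I: "rmod.subspace I"
    and min: "\<And>Q. prime_id Q \<Longrightarrow> I \<subseteq> Q \<Longrightarrow> Q \<subseteq> P \<Longrightarrow> Q = P"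
    and p: "p \<in> P"
  shows "\<exists>t r. t \<notin> P \<and> t * p ^ r \<in> I"
proof (rule ccontr)
  assume no: "\<nexists>t r. t \<notin> P \<and> t * p ^ r \<in> I"
  define S where "S = {t * p ^ r | t r. t \<notin> P}"
  obtain Q where Q: "prime_id Q" "I \<subseteq> Q" "Q \<inter> S = {}"
  proof (rule prime_id_exists[OF I, of S])
    show "1 \<in> S"
      unfolding S_def using prime_id_one[OF P] by (intro CollectI exI[of _ 1] exI[of _ "0::nat"]) simp
    fix s t assume "s \<in> S" "t \<in> S"
    then obtain a m b n where "s = a * p ^ m" "t = b * p ^ n" "a \<notin> P" "b \<notin> P" by (auto simp: S_def)
    then show "s * t \<in> S" unfolding S_def using prime_id_mult_notin[OF P, of a b]
      by (auto intro!: exI[of _ "a * b"] exI[of _ "m + n"] simp: power_add algebra_simps)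
  qed (use no in \<open>auto simp: S_def\<close>)
  have "t \<in> S" if "t \<notin> P" for t
    unfolding S_def using that by (intro CollectI exI[of _ t] exI[of _ 0]) simp
  then have "Q \<subseteq> P" using Q(3) by blast
  moreover have "p \<in> S"
    unfolding S_def using prime_id_one[OF P] by (intro CollectI exI[of _ 1] exI[of _ "1::nat"]) simp
  ultimately show False using min[OF Q(1,2)] p Q(3) by blast
qed

subsection \<open>Krull's height theorem\<close>

text \<open>The descending chain condition for ideals of the localization at \<open>P\<close> that contain \<open>I\<close>.\<close>

definition local_dcc :: "'a::comm_ring_1 set \<Rightarrow> 'a set \<Rightarrow> bool" where
  "local_dcc P I \<longleftrightarrow> (\<forall>K::nat \<Rightarrow> 'a set.
     (\<forall>n. rmod.subspace (K n) \<and> sat P (K n) \<subseteq> K n \<and> I \<subseteq> K n \<and> K (Suc n) \<subseteq> K n) \<longrightarrow>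
     (\<exists>m. \<forall>n\<ge>m. K n = K m))"

text \<open>\<open>P\<close> annihilates \<open>e\<close> modulo \<open>I\<close>, so adjoining
  \<open>e\<close> changes local length by at most one. Either all members of a chain contain
  \<open>e\<close>, or from some index on none does; in the second case a member is recovered from
  its sum with \<open>e\<close>.\<close>

lemma local_dcc_step:
  fixes I :: "'a::comm_ring_1 set"
  assumes P: "prime_id P" and e: "\<And>u. u \<in> P \<Longrightarrow> u * e \<in> I"
    and dcc: "local_dcc P (sat P (rmod.span (insert e I)))"
  shows "local_dcc P I"
  unfolding local_dcc_def
proof (intro allI impI)
  fix K :: "nat \<Rightarrow> 'a set"
  assume K: "\<forall>n. rmod.subspace (K n) \<and> sat P (K n) \<subseteq> K n \<and> I \<subseteq> K n \<and> K (Suc n) \<subseteq> K n"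
  have Ks: "rmod.subspace (K n)" and Ksat: "sat P (K n) \<subseteq> K n" and IK: "I \<subseteq> K n" and Kd: "K (Suc n) \<subseteq> K n" for n
    using K by simp_all
  define L where "L n = sat P (rmod.span (insert e (K n)))" for n
  have "rmod.subspace (L n) \<and> sat P (L n) \<subseteq> L n \<and> sat P (rmod.span (insert e I)) \<subseteq> L n \<and> L (Suc n) \<subseteq> L n" for n
    unfolding L_def by (intro conjI ideal_sat[OF P] sat_sat[OF P] sat_mono rmod.span_mono rmod.subspace_span insert_mono IK Kd)
  then obtain m where m: "\<forall>n\<ge>m. L n = L m" using dcc unfolding local_dcc_def by blast
  have dec: "K n \<subseteq> K m" if "m \<le> n" for m n by (rule lift_Suc_antimono_le[of K, OF Kd that])
  show "\<exists>m. \<forall>n\<ge>m. K n = K m"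
  proof (cases "\<forall>n. e \<in> K n")
    case True
    have "L n = K n" for n
    proof -
      have "rmod.span (insert e (K n)) = K n" using True Ks by (simp add: insert_absorb rmod.span_eq_iff)
      then show ?thesis unfolding L_def using Ksat[of n] sat_superset[OF P, of "K n"] by auto
    qed
    then show ?thesis using m by auto
  next
    case False
    then obtain k where k: "e \<notin> K k" by blast
    define j where "j = max m k"
    have "K j \<subseteq> K n" if n: "n \<ge> j" for n
    proof
      fix y assume y: "y \<in> K j"
      have "y \<in> rmod.span (insert e (K j))" using y by (intro rmod.span_base) simp
      then have "y \<in> L j" unfolding L_def using sat_superset[OF P] by (rule set_mp[rotated])
      moreover have "L j = L m" "L n = L m" using n by (intro m[rule_format], simp add: j_def)+
      ultimately have "y \<in> L n" by simp
      then obtain t where t: "t \<notin> P" "t * y \<in> rmod.span (insert e (K n))" unfolding L_def by (rule satE)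
      from t(2) Ks obtain c z where z: "z \<in> K n" "t * y = z + c * e" by (rule span_insert_cases)
      have "z \<in> K j" using dec[OF n] z by blast
      with ideal_mult_left[OF Ks y] have "t * y - z \<in> K j" by (rule rmod.subspace_diff[OF Ks])
      then have ce: "c * e \<in> K j" using z by simp
      \<comment> \<open>A coefficient outside \<open>P\<close> is locally a unit and would put
        \<open>e\<close> into \<open>K j\<close>.\<close>
      have "c \<in> P"
      proof (rule ccontr)
        assume "c \<notin> P"
        then have "e \<in> K j" using satI[OF _ ce] Ksat by blast
        then show False using dec[of k j] k by (auto simp: j_def)
      qed
      then have "c * e \<in> K n" using e IK by blast
      then have "t * y \<in> K n" unfolding z(2) by (rule rmod.subspace_add[OF Ks z(1)])
      then show "y \<in> K n" using satI[OF t(1)] Ksat by blast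
    qed
    then show ?thesis using dec by (intro exI[of _ j]) blast
  qed
qed

text \<open>Finite length of the localized quotient, by noetherian induction: a maximal ideal
  \<open>M\<close> violating the chain condition is enlarged by a socle element \<open>c\<close>,
  and \<open>local_dcc_step\<close> carries the chain condition from the larger ideal back to
  \<open>M\<close>.\<close>

lemma local_dcc_nilpotent:
  fixes I :: "'a::noeth_ring set"
  assumes P: "prime_id P" and I: "rmod.subspace I" and nil: "\<And>p. p \<in> P \<Longrightarrow> \<exists>t r. t \<notin> P \<and> t * p ^ r \<in> I"
  shows "local_dcc P (sat P I)"
proof (rule ccontr)
  assume no: "\<not> local_dcc P (sat P I)"
  define C where "C = {J. rmod.subspace J \<and> sat P J \<subseteq> J \<and> I \<subseteq> J \<and> \<not> local_dcc P J}"
  have "sat P I \<in> C" unfolding C_def using no ideal_sat[OF P I] sat_sat[OF P] sat_superset[OF P] by blast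
  then have "\<exists>M\<in>C. sat P I \<subseteq> M \<and> (\<forall>J\<in>C. M \<subseteq> J \<longrightarrow> J = M)"
    by (rule noeth_maximal) (simp add: C_def)
  then obtain M where M: "M \<in> C" "\<forall>J\<in>C. M \<subseteq> J \<longrightarrow> J = M" by (elim bexE conjE)
  have sM: "rmod.subspace M" and satM: "sat P M \<subseteq> M" and IM: "I \<subseteq> M" and nM: "\<not> local_dcc P M"
    using M(1) by (auto simp: C_def)
  have "M \<noteq> UNIV"
  proof
    assume "M = UNIV"
    then have "local_dcc P M" unfolding local_dcc_def by (auto simp: top.extremum_unique)
    then show False using nM by blast
  qed
  then have one: "1 \<notin> M" using ideal_one[OF sM] by blast
  obtain F where F: "finite F" "F \<subseteq> P" "P = rmod.span F" using ideal_finite_span[OF prime_id_subspace[OF P]] .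
  have "\<exists>r. u ^ r \<in> M" if "u \<in> F" for u
    using nil[of u] that F(2) IM satM by (blast intro: satI)
  then obtain c where c: "c * 1 \<notin> M" "\<forall>u\<in>F. u * (c * 1) \<in> M" using socle[OF sM F(1) _ one] by blast
  have ann: "u * c \<in> M" if "u \<in> P" for u
  proof -
    have "rmod.subspace {u. u * c \<in> M}"
      using rmod.subspace_0[OF sM] rmod.subspace_add[OF sM] ideal_mult_left[OF sM]
      by (intro rmod.subspaceI) (auto simp: distrib_right mult.assoc)
    then have "P \<subseteq> {u. u * c \<in> M}" unfolding F(3) using c by (intro rmod.span_minimal) auto
    then show ?thesis using that by blast
  qed
  define J where "J = sat P (rmod.span (insert c M))"
  have "M \<subseteq> J" unfolding J_def using sat_superset[OF P] rmod.span_superset[of "insert c M"] by blast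
  moreover have "c \<in> J" unfolding J_def using sat_superset[OF P] rmod.span_superset[of "insert c M"] by blast
  moreover have "c \<notin> M" using c by simp
  ultimately have "J \<notin> C" using M(2) by blast
  moreover have "rmod.subspace J" "sat P J \<subseteq> J" unfolding J_def by (intro ideal_sat[OF P] rmod.subspace_span sat_sat[OF P])+
  ultimately have "local_dcc P J" using \<open>M \<subseteq> J\<close> IM by (auto simp: C_def)
  then have D: "local_dcc P (sat P (rmod.span (insert c M)))" unfolding J_def .
  have "local_dcc P M" by (rule local_dcc_step[OF P _ D]) (rule ann)
  then show False using nM by contradiction
qed

text \<open>Krull's principal ideal theorem, by the saturations \<open>J n\<close> of \<open>Q + (x\<^sup>n)\<close> with respect to \<open>a\<close>.\<close>

lemma principal_ideal:
  fixes P :: "'a::noeth_ring set"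
  assumes Q: "prime_id Q" and Q1: "prime_id Q1" and P: "prime_id P"
    and sub: "Q \<subset> Q1" "Q1 \<subset> P" and aP: "a \<in> P"
    and min: "\<And>Q'. prime_id Q' \<Longrightarrow> Q \<subseteq> Q' \<Longrightarrow> a \<in> Q' \<Longrightarrow> Q' \<subseteq> P \<Longrightarrow> Q' = P"
  shows False
proof -
  have aQ1: "a \<notin> Q1" using min[OF Q1] sub by auto
  obtain x where x: "x \<in> Q1" "x \<notin> Q" using sub by blast
  note sQ = prime_id_subspace[OF Q]
  have nil: "\<exists>t r. t \<notin> P \<and> t * p ^ r \<in> rmod.span (insert a Q)" if "p \<in> P" for p
  proof (rule minimal_prime_nilpotent[OF P rmod.subspace_span _ that])
    fix Q' assume "prime_id Q'" "rmod.span (insert a Q) \<subseteq> Q'" "Q' \<subseteq> P"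
    then show "Q' = P" using rmod.span_superset[of "insert a Q"] by (intro min) auto
  qed
  have dcc: "local_dcc P (sat P (rmod.span (insert a Q)))"
    by (rule local_dcc_nilpotent[OF P rmod.subspace_span nil])
  define J where "J n = {y. \<exists>t r. t \<notin> P \<and> a ^ r * (t * y) \<in> rmod.span (insert (x ^ n) Q)}" for n
  have J1: "rmod.subspace (J n)" for n
  proof (rule rmod.subspaceI)
    show "0 \<in> J n" unfolding J_def using prime_id_one[OF P] rmod.span_zero by (auto intro!: exI[of _ 1])
  next
    fix y z assume "y \<in> J n" "z \<in> J n"
    then obtain s q t r where *: "s \<notin> P" "a ^ q * (s * y) \<in> rmod.span (insert (x ^ n) Q)"
        "t \<notin> P" "a ^ r * (t * z) \<in> rmod.span (insert (x ^ n) Q)" unfolding J_def by blast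
    have "a ^ (q + r) * ((s * t) * (y + z)) = (a ^ r * t) * (a ^ q * (s * y)) + (a ^ q * s) * (a ^ r * (t * z))"
      by (simp add: algebra_simps power_add)
    also have "\<dots> \<in> rmod.span (insert (x ^ n) Q)"
      by (intro rmod.span_add rmod.span_scale *(2) *(4))
    finally show "y + z \<in> J n" unfolding J_def using prime_id_mult_notin[OF P *(1,3)] by blast
  next
    fix c y assume "y \<in> J n"
    then obtain t r where *: "t \<notin> P" "a ^ r * (t * y) \<in> rmod.span (insert (x ^ n) Q)" unfolding J_def by blast
    have "a ^ r * (t * (c * y)) = c * (a ^ r * (t * y))" by (simp add: algebra_simps)
    also have "\<dots> \<in> rmod.span (insert (x ^ n) Q)" by (intro rmod.span_scale *(2))
    finally show "c * y \<in> J n" unfolding J_def using *(1) by blast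
  qed
  have JQ: "Q \<subseteq> J n" for n
  proof
    fix y assume "y \<in> Q"
    then have "a ^ 0 * (1 * y) \<in> rmod.span (insert (x ^ n) Q)" by (simp add: rmod.span_base)
    then show "y \<in> J n" unfolding J_def using prime_id_one[OF P] by blast
  qed
  have Ja: "y \<in> J n" if ay: "a * y \<in> J n" for y n
  proof -
    obtain t r where *: "t \<notin> P" "a ^ r * (t * (a * y)) \<in> rmod.span (insert (x ^ n) Q)"
      using ay unfolding J_def by blast
    then have "a ^ Suc r * (t * y) \<in> rmod.span (insert (x ^ n) Q)" by (simp add: mult_ac)
    then show ?thesis using *(1) unfolding J_def by blast
  qed
  have Jsat: "sat P (J n) \<subseteq> J n" for n
  proof
    fix y assume "y \<in> sat P (J n)"
    then obtain s where s: "s \<notin> P" "s * y \<in> J n" by (rule satE)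
    then obtain t r where *: "t \<notin> P" "a ^ r * (t * (s * y)) \<in> rmod.span (insert (x ^ n) Q)"
      unfolding J_def by blast
    then have "a ^ r * ((t * s) * y) \<in> rmod.span (insert (x ^ n) Q)" by (simp add: mult_ac)
    then show "y \<in> J n" using prime_id_mult_notin[OF P *(1) s(1)] unfolding J_def by blast
  qed
  have Jdec: "J (Suc n) \<subseteq> J n" for n
  proof -
    have "rmod.span (insert (x ^ Suc n) Q) \<subseteq> rmod.span (insert (x ^ n) Q)"
    proof (rule rmod.span_minimal)
      have "x * x ^ n \<in> rmod.span (insert (x ^ n) Q)" by (intro rmod.span_scale rmod.span_base) simp
      then show "insert (x ^ Suc n) Q \<subseteq> rmod.span (insert (x ^ n) Q)"
        using rmod.span_superset[of "insert (x ^ n) Q"] by auto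
    qed (rule rmod.subspace_span)
    then show ?thesis unfolding J_def by blast
  qed
  \<comment> \<open>The chain condition is available above \<open>Q + (a)\<close>, so it is applied
    to the sums of \<open>J n\<close> with \<open>(a)\<close>. Since \<open>J m\<close> is saturated
    with respect to \<open>a\<close>, stability gives, locally, that \<open>J m\<close> lies in
    \<open>J (Suc m) + a * J m\<close>, which is the input for Nakayama's lemma.\<close>
  define K where "K n = sat P (rmod.span (insert a (J n)))" for n
  have "\<forall>n. rmod.subspace (K n) \<and> sat P (K n) \<subseteq> K n \<and> sat P (rmod.span (insert a Q)) \<subseteq> K n \<and> K (Suc n) \<subseteq> K n"
    unfolding K_def
    by (intro allI conjI ideal_sat[OF P] sat_sat[OF P] sat_mono rmod.span_mono rmod.subspace_span insert_mono JQ Jdec)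
  then obtain m where m: "\<forall>n\<ge>m. K n = K m" using dcc unfolding local_dcc_def by blast
  have "K (Suc m) = K m" by (rule m[rule_format]) simp
  obtain F where F: "finite F" "F \<subseteq> J m" "J m = rmod.span F" using ideal_finite_span[OF J1] .
  have "F \<subseteq> sat P (J (Suc m))"
  proof (rule local_nakayama[OF P J1 F(1)])
    fix f assume "f \<in> F"
    then have "f \<in> J m" using F by blast
    then have "f \<in> K m"
      unfolding K_def using sat_superset[OF P] rmod.span_superset[of "insert a (J m)"] by blast
    then have "f \<in> K (Suc m)" using \<open>K (Suc m) = K m\<close> by simp
    then obtain t where t: "t \<notin> P" "t * f \<in> rmod.span (insert a (J (Suc m)))" unfolding K_def by (rule satE)
    from t(2) J1 obtain w z where z: "z \<in> J (Suc m)" "t * f = z + w * a" by (rule span_insert_cases)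
    have "z \<in> J m" using z Jdec by blast
    have "t * f - z \<in> J m" by (rule rmod.subspace_diff[OF J1 ideal_mult_left[OF J1 \<open>f \<in> J m\<close>] \<open>z \<in> J m\<close>])
    then have "a * w \<in> J m" using z by (simp add: mult.commute)
    then have "w \<in> J m" by (rule Ja)
    then obtain c where c: "w = (\<Sum>g\<in>F. c g * g)" using F by (auto simp: rmod.span_finite)
    have "t * f = z + (\<Sum>g\<in>F. (a * c g) * g)"
      using z c by (simp add: sum_distrib_left sum_distrib_right mult_ac)
    moreover have "\<forall>g\<in>F. a * c g \<in> P" using ideal_mult_right[OF prime_id_subspace[OF P] aP] by blast
    ultimately show "\<exists>t z c. t \<notin> P \<and> z \<in> J (Suc m) \<and> (\<forall>g\<in>F. c g \<in> P) \<and> t * f = z + (\<Sum>g\<in>F. c g * g)"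
      using t(1) z(1) by (intro exI[of _ t] exI[of _ z] exI[of _ "\<lambda>g. a * c g"]) simp
  qed
  then have "J m \<subseteq> J (Suc m)" unfolding F(3) using Jsat J1 by (intro rmod.span_minimal) blast+
  moreover have "x ^ m \<in> J m"
  proof -
    have "a ^ 0 * (1 * x ^ m) \<in> rmod.span (insert (x ^ m) Q)" by (simp add: rmod.span_base)
    then show ?thesis unfolding J_def using prime_id_one[OF P] by blast
  qed
  ultimately have "x ^ m \<in> J (Suc m)" by blast
  then obtain t r where t: "t \<notin> P" "a ^ r * (t * x ^ m) \<in> rmod.span (insert (x ^ Suc m) Q)" unfolding J_def by blast
  from t(2) sQ obtain c z where z: "z \<in> Q" "a ^ r * (t * x ^ m) = z + c * x ^ Suc m" by (rule span_insert_cases)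
  \<comment> \<open>As \<open>x\<close> is not in \<open>Q\<close>, the power \<open>x ^ m\<close>
    cancels modulo \<open>Q\<close>. Since \<open>x\<close> lies in \<open>Q1\<close>, this puts
    \<open>a ^ r * t\<close> into \<open>Q1\<close>, which contains neither \<open>a\<close> nor
    \<open>t\<close>.\<close>
  then have "x ^ m * (a ^ r * t - c * x) = z" by (simp add: algebra_simps)
  then have "x ^ m * (a ^ r * t - c * x) \<in> Q" using z by simp
  then have "a ^ r * t - c * x \<in> Q" using prime_id_multD[OF Q] prime_id_powerD[OF Q] x(2) by blast
  then have "a ^ r * t - c * x \<in> Q1" using sub by blast
  then have "a ^ r * t - c * x + c * x \<in> Q1"
    by (rule rmod.subspace_add[OF prime_id_subspace[OF Q1] _ ideal_mult_left[OF prime_id_subspace[OF Q1] x(1)]])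
  then have "a ^ r * t \<in> Q1" by simp
  then show False using prime_id_multD[OF Q1] prime_id_powerD[OF Q1] aQ1 t(1) sub by blast
qed

text \<open>The height theorem in contrapositive form: above a strict chain of \<open>n + 1\<close>
  primes, \<open>P\<close> is not minimal over \<open>I\<close> and \<open>n\<close> elements. In
  the induction \<open>P'\<close> is chosen with no prime strictly between it and \<open>P\<close>.
  A generator \<open>u\<close> outside \<open>P'\<close> then makes \<open>P\<close> minimal over
  \<open>P' + (u)\<close>, so locally powers of the other generators lie in \<open>P' + (u)\<close>.
  Their components \<open>b w\<close> in \<open>P'\<close> are one fewer than the generators, and
  the induction hypothesis applies to them below \<open>P'\<close>.\<close>

lemma krull_height:
  fixes P :: "'a::noeth_ring set"
  assumes "\<And>i. i \<le> n \<Longrightarrow> prime_id (C i)" "\<And>i. i < n \<Longrightarrow> C i \<subset> C (Suc i)" "prime_id P" "C n \<subset> P"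
    and "I \<subseteq> C 0" "finite U" "card U \<le> n" "U \<subseteq> P"
  shows "\<exists>Q. prime_id Q \<and> I \<union> U \<subseteq> Q \<and> Q \<subset> P"
  using assms
proof (induction n arbitrary: P U)
  case 0
  then show ?case by (intro exI[of _ "C 0"]) auto
next
  case (Suc n)
  have IC: "I \<subseteq> C i" if "i \<le> Suc n" for i
    using that
  proof (induction i)
    case (Suc i)
    then show ?case using Suc.prems Suc.IH \<open>\<And>i. i < Suc n \<Longrightarrow> C i \<subset> C (Suc i)\<close>[of i] by auto
  qed (use Suc.prems in auto)
  define D where "D = {P'. prime_id P' \<and> C (Suc n) \<subseteq> P' \<and> P' \<subset> P}"
  have "C (Suc n) \<in> D" using Suc.prems by (auto simp: D_def)
  then have "\<exists>M\<in>D. C (Suc n) \<subseteq> M \<and> (\<forall>J\<in>D. M \<subseteq> J \<longrightarrow> J = M)"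
    by (rule noeth_maximal) (simp add: D_def prime_id_subspace)
  then obtain P' where P': "P' \<in> D" "\<forall>J\<in>D. P' \<subseteq> J \<longrightarrow> J = P'" by (elim bexE conjE)
  have pP': "prime_id P'" and CP': "C (Suc n) \<subseteq> P'" and P'P: "P' \<subset> P" using P'(1) by (simp_all add: D_def)
  have IP': "I \<subseteq> P'" using IC[of "Suc n"] CP' by auto
  show ?case
  proof (cases "U \<subseteq> P'")
    case True
    then show ?thesis using pP' IP' P'P by (intro exI[of _ P']) auto
  next
    case False
    then obtain u where u: "u \<in> U" "u \<notin> P'" by blast
    show ?thesis
    proof (rule ccontr)
      assume no: "\<nexists>Q. prime_id Q \<and> I \<union> U \<subseteq> Q \<and> Q \<subset> P"
      have "\<exists>b t r c. b \<in> P' \<and> t \<notin> P \<and> t * w ^ r = b + c * u" if w: "w \<in> U" for w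
      proof -
        have "\<exists>t r. t \<notin> P \<and> t * w ^ r \<in> rmod.span (insert u P')"
        proof (rule minimal_prime_nilpotent[OF \<open>prime_id P\<close> rmod.subspace_span])
          fix Q assume Q: "prime_id Q" "rmod.span (insert u P') \<subseteq> Q" "Q \<subseteq> P"
          then have "insert u P' \<subseteq> Q" using rmod.span_superset[of "insert u P'"] by blast
          show "Q = P"
          proof (rule ccontr)
            assume "Q \<noteq> P"
            then have "Q \<in> D" using Q CP' \<open>insert u P' \<subseteq> Q\<close> by (auto simp: D_def)
            then have "Q = P'" by (rule P'(2)[rule_format]) (use \<open>insert u P' \<subseteq> Q\<close> in auto)
            then show False using u \<open>insert u P' \<subseteq> Q\<close> by auto
          qed
        qed (use w Suc.prems in auto)
        then obtain t r where t: "t \<notin> P" "t * w ^ r \<in> rmod.span (insert u P')" by blast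
        from t(2) prime_id_subspace[OF pP'] obtain c z where "z \<in> P'" "t * w ^ r = z + c * u"
          by (rule span_insert_cases)
        then show ?thesis using t by blast
      qed
      then obtain b t r c where b: "\<And>w. w \<in> U \<Longrightarrow> b w \<in> P' \<and> t w \<notin> P \<and> t w * w ^ r w = b w + c w * u"
        by metis
      define U' where "U' = b ` (U - {u})"
      have "\<exists>Q. prime_id Q \<and> I \<union> U' \<subseteq> Q \<and> Q \<subset> P'"
      proof (rule Suc.IH)
        show "C n \<subset> P'" using Suc.prems(2)[of n] CP' by auto
        show "U' \<subseteq> P'" using b by (auto simp: U'_def)
        have "card U' \<le> card (U - {u})" unfolding U'_def by (rule card_image_le) (use Suc.prems in auto)
        then show "card U' \<le> n" using Suc.prems u by auto
      qed (use Suc.prems pP' in \<open>auto simp: U'_def\<close>)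
      then obtain Q where Q: "prime_id Q" "I \<union> U' \<subseteq> Q" "Q \<subset> P'" by blast
      \<comment> \<open>A prime between \<open>Q + (u)\<close> and \<open>P\<close> contains every
        \<open>b w + c w * u\<close>, hence all of \<open>U\<close>. So \<open>P\<close> is minimal
        over \<open>Q + (u)\<close> although \<open>P'\<close> lies strictly between
        \<open>Q\<close> and \<open>P\<close>.\<close>
      show False
      proof (rule principal_ideal[OF Q(1) pP' \<open>prime_id P\<close> Q(3) P'P])
        show "u \<in> P" using u Suc.prems by auto
        fix Q' assume Q': "prime_id Q'" "Q \<subseteq> Q'" "u \<in> Q'" "Q' \<subseteq> P"
        have "w \<in> Q'" if w: "w \<in> U" for w
        proof (cases "w = u")
          case False
          then have "b w \<in> Q'" using w Q(2) Q'(2) by (auto simp: U'_def)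
          then have "b w + c w * u \<in> Q'"
            by (rule rmod.subspace_add[OF prime_id_subspace[OF Q'(1)] _ ideal_mult_left[OF prime_id_subspace[OF Q'(1)] Q'(3)]])
          then have "t w * w ^ r w \<in> Q'" using b[OF w] by simp
          then show ?thesis using prime_id_multD[OF Q'(1)] prime_id_powerD[OF Q'(1)] b[OF w] Q'(4) by blast
        qed (use Q' in simp)
        then show "Q' = P" using no Q' Q(2) by blast
      qed
    qed
  qed
qed

subsection \<open>Powers of ideals and Krull's intersection theorem\<close>

primrec ipow :: "'a::comm_ring_1 set \<Rightarrow> nat \<Rightarrow> 'a set" where
  "ipow I 0 = UNIV"
| "ipow I (Suc n) = rmod.span {a * b | a b. a \<in> I \<and> b \<in> ipow I n}"

lemma ideal_ipow: "rmod.subspace (ipow I n)"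
  by (cases n) auto

lemma ipow_SucI: "a \<in> I \<Longrightarrow> b \<in> ipow I n \<Longrightarrow> a * b \<in> ipow I (Suc n)"
  unfolding ipow.simps by (intro rmod.span_base) blast

lemma ipow_Suc_least:
  assumes "rmod.subspace K" "\<And>a b. a \<in> I \<Longrightarrow> b \<in> ipow I n \<Longrightarrow> a * b \<in> K"
  shows "ipow I (Suc n) \<subseteq> K"
  unfolding ipow.simps using assms by (intro rmod.span_minimal) auto

lemma ipow_1: "rmod.subspace I \<Longrightarrow> ipow I (Suc 0) = I"
proof
  assume I: "rmod.subspace I"
  show "ipow I (Suc 0) \<subseteq> I" using ideal_mult_right[OF I] by (intro ipow_Suc_least[OF I])
  show "I \<subseteq> ipow I (Suc 0)" using ipow_SucI[of _ I 1 0] by auto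
qed

lemma ipow_Suc_subset: "ipow I (Suc n) \<subseteq> ipow I n"
  by (intro ipow_Suc_least ideal_ipow ideal_mult_left)

lemma ipow_antimono: "m \<le> n \<Longrightarrow> ipow I n \<subseteq> ipow I m"
  by (rule lift_Suc_antimono_le[of "ipow I", OF ipow_Suc_subset])

lemma ipow_mult: "a \<in> ipow I m \<Longrightarrow> b \<in> ipow I n \<Longrightarrow> a * b \<in> ipow I (m + n)"
proof (induction m arbitrary: a)
  case 0
  then show ?case using ideal_mult_left[OF ideal_ipow] by simp
next
  case (Suc m)
  have "ipow I (Suc m) \<subseteq> {a. a * b \<in> ipow I (Suc m + n)}"
  proof (rule ipow_Suc_least)
    show "rmod.subspace {a. a * b \<in> ipow I (Suc m + n)}"
      using rmod.subspace_0[OF ideal_ipow] rmod.subspace_add[OF ideal_ipow] ideal_mult_left[OF ideal_ipow]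
      by (intro rmod.subspaceI) (auto simp: distrib_right mult.assoc simp del: ipow.simps)
    fix x y assume "x \<in> I" "y \<in> ipow I m"
    then have "x * (y * b) \<in> ipow I (Suc (m + n))" using Suc by (intro ipow_SucI) auto
    then show "x * y \<in> {a. a * b \<in> ipow I (Suc m + n)}" by (simp add: mult.assoc del: ipow.simps)
  qed
  then show ?case using Suc.prems by blast
qed

lemma ipow_power: "a \<in> I \<Longrightarrow> a ^ n \<in> ipow I n"
  by (induction n) (auto intro: ipow_SucI simp del: ipow.simps(2))

text \<open>The scheme of \<open>local_dcc_nilpotent\<close>: \<open>I\<close> annihilates the socle
  element \<open>c\<close> modulo a maximal counterexample \<open>M\<close>, so a power of
  \<open>I\<close> inside \<open>M + (c)\<close> needs just one more factor to lie in
  \<open>M\<close>.\<close>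

lemma ipow_subset_nilpotent:
  fixes K :: "'a::noeth_ring set"
  assumes K: "rmod.subspace K" and I: "rmod.subspace I" and nil: "\<And>u. u \<in> I \<Longrightarrow> \<exists>r::nat. u ^ r \<in> K"
  shows "\<exists>n. ipow I n \<subseteq> K"
proof (rule ccontr)
  assume no: "\<nexists>n. ipow I n \<subseteq> K"
  define C where "C = {J. rmod.subspace J \<and> K \<subseteq> J \<and> (\<nexists>n. ipow I n \<subseteq> J)}"
  have "K \<in> C" using K no by (simp add: C_def)
  then have "\<exists>M\<in>C. K \<subseteq> M \<and> (\<forall>J\<in>C. M \<subseteq> J \<longrightarrow> J = M)"
    by (rule noeth_maximal) (simp add: C_def)
  then obtain M where M: "M \<in> C" "\<forall>J\<in>C. M \<subseteq> J \<longrightarrow> J = M" by (elim bexE conjE)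
  have sM: "rmod.subspace M" and KM: "K \<subseteq> M" and nM: "\<nexists>n. ipow I n \<subseteq> M" using M(1) by (simp_all add: C_def)
  have one: "1 \<notin> M"
  proof
    assume "1 \<in> M"
    then have "ipow I 0 \<subseteq> M" using ideal_one[OF sM] by simp
    then show False using nM by blast
  qed
  obtain F where F: "finite F" "F \<subseteq> I" "I = rmod.span F" using ideal_finite_span[OF I] .
  have "\<exists>r::nat. u ^ r \<in> M" if "u \<in> F" for u using nil[of u] that F(2) KM by blast
  then obtain c where c: "c * 1 \<notin> M" "\<forall>u\<in>F. u * (c * 1) \<in> M" using socle[OF sM F(1) _ one] by blast
  have "rmod.subspace {u. u * c \<in> M}"
    using rmod.subspace_0[OF sM] rmod.subspace_add[OF sM] ideal_mult_left[OF sM]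
    by (intro rmod.subspaceI) (auto simp: distrib_right mult.assoc)
  then have ann: "I \<subseteq> {u. u * c \<in> M}" unfolding F(3) using c by (intro rmod.span_minimal) auto
  define J where "J = rmod.span (insert c M)"
  have MJ: "insert c M \<subseteq> J" unfolding J_def by (rule rmod.span_superset)
  have "J \<notin> C"
  proof
    assume "J \<in> C"
    then have "J = M" by (rule M(2)[rule_format]) (use MJ in blast)
    then show False using MJ c by auto
  qed
  moreover have "rmod.subspace J" unfolding J_def by (rule rmod.subspace_span)
  moreover have "K \<subseteq> J" using KM MJ by blast
  ultimately have "\<exists>n. ipow I n \<subseteq> J" unfolding C_def by blast
  then obtain n where n: "ipow I n \<subseteq> J" by (rule exE)
  have "ipow I (Suc n) \<subseteq> M"
  proof (rule ipow_Suc_least[OF sM])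
    fix a b assume ab: "a \<in> I" "b \<in> ipow I n"
    have "b \<in> rmod.span (insert c M)" using n ab(2) unfolding J_def by (rule subsetD)
    then obtain d z where z: "z \<in> M" "b = z + d * c" using sM by (rule span_insert_cases)
    have "a * b = a * z + d * (a * c)" using z by (simp add: algebra_simps)
    moreover have "a * c \<in> M" using ann ab(1) by blast
    then have "a * z + d * (a * c) \<in> M"
      by (rule rmod.subspace_add[OF sM ideal_mult_left[OF sM z(1)] ideal_mult_left[OF sM]])
    ultimately show "a * b \<in> M" by simp
  qed
  then show False using nM by blast
qed

text \<open>Take \<open>K \<supseteq> K\<^sub>0 + P q\<close> maximal such that \<open>K\<close> meets \<open>(q)\<close> only in (the localization of)
  \<open>K\<^sub>0 + P q\<close>; maximality forces a power of every element of \<open>P\<close> into \<open>K\<close>.\<close>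

lemma krull_intersection:
  fixes P :: "'a::noeth_ring set"
  assumes P: "prime_id P" and K0: "rmod.subspace K0"
    and q: "\<And>n. \<exists>k\<in>K0. \<exists>h\<in>ipow P n. q = k + h"
  shows "q \<in> sat P K0"
proof -
  note sP = prime_id_subspace[OF P]
  define N where "N = {k + p * q | k p. k \<in> K0 \<and> p \<in> P}"
  have sN: "rmod.subspace N"
  proof (rule rmod.subspaceI)
    have "0 = 0 + 0 * q" by simp
    then show "0 \<in> N" unfolding N_def using rmod.subspace_0[OF K0] rmod.subspace_0[OF sP] by blast
    fix x y assume "x \<in> N" "y \<in> N"
    then obtain k p l r where *: "k \<in> K0" "p \<in> P" "x = k + p * q" "l \<in> K0" "r \<in> P" "y = l + r * q"
      unfolding N_def by blast
    then have "x + y = (k + l) + (p + r) * q" by (simp add: algebra_simps)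
    then show "x + y \<in> N" unfolding N_def using rmod.subspace_add[OF K0 *(1,4)] rmod.subspace_add[OF sP *(2,5)] by blast
  next
    fix c x assume "x \<in> N"
    then obtain k p where *: "k \<in> K0" "p \<in> P" "x = k + p * q" unfolding N_def by blast
    then have "c * x = c * k + (c * p) * q" by (simp add: algebra_simps)
    then show "c * x \<in> N" unfolding N_def using ideal_mult_left[OF K0 *(1)] ideal_mult_left[OF sP *(2)] by blast
  qed
  have K0N: "K0 \<subseteq> N"
  proof
    fix k assume "k \<in> K0"
    moreover have "k = k + 0 * q" by simp
    ultimately show "k \<in> N" unfolding N_def using rmod.subspace_0[OF sP] by blast
  qed
  have PqN: "p * q \<in> N" if "p \<in> P" for p
  proof -
    have "p * q = 0 + p * q" by simp
    then show ?thesis unfolding N_def using rmod.subspace_0[OF K0] that by blast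
  qed
  define C where "C = {K. rmod.subspace K \<and> N \<subseteq> K \<and> (\<forall>e. e * q \<in> K \<longrightarrow> e * q \<in> N)}"
  have "N \<in> C" using sN by (simp add: C_def)
  then have "\<exists>M\<in>C. N \<subseteq> M \<and> (\<forall>J\<in>C. M \<subseteq> J \<longrightarrow> J = M)"
    by (rule noeth_maximal) (simp add: C_def)
  then obtain K where K: "K \<in> C" "\<forall>J\<in>C. K \<subseteq> J \<longrightarrow> J = K" by (elim bexE conjE)
  have sK: "rmod.subspace K" and NK: "N \<subseteq> K" and Kq: "\<And>e. e * q \<in> K \<Longrightarrow> e * q \<in> N"
    using K(1) by (simp_all add: C_def)
  have "\<exists>r::nat. u ^ r \<in> K" if u: "u \<in> P" for u
  proof -
    \<comment> \<open>The colon ideals of \<open>K\<close> by the powers of \<open>u\<close>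
      stabilize. Once they do, adjoining \<open>u ^ r\<close> to \<open>K\<close> yields no new
      multiples of \<open>q\<close>, so the enlarged ideal is still in \<open>C\<close> and equals
      \<open>K\<close>.\<close>
    define L where "L r = {y. u ^ r * y \<in> K}" for r
    have sL: "rmod.subspace (L r)" for r
      unfolding L_def using rmod.subspace_0[OF sK] rmod.subspace_add[OF sK] ideal_mult_left[OF sK]
      by (intro rmod.subspaceI) (auto simp: distrib_left mult.left_commute)
    have "L 0 \<in> range L" by blast
    then have "\<exists>M\<in>range L. L 0 \<subseteq> M \<and> (\<forall>J\<in>range L. M \<subseteq> J \<longrightarrow> J = M)"
      by (rule noeth_maximal) (use sL in blast)
    then obtain r where r: "\<forall>J\<in>range L. L r \<subseteq> J \<longrightarrow> J = L r" by blast
    have LS: "L r \<subseteq> L (Suc r)" unfolding L_def using ideal_mult_left[OF sK, of _ u] by (auto simp: mult.assoc)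
    have L: "L (Suc r) = L r" by (rule r[rule_format]) (use LS in auto)
    define J where "J = rmod.span (insert (u ^ r) K)"
    have "J \<in> C" unfolding C_def
    proof (intro CollectI conjI allI impI)
      show "rmod.subspace J" by (simp add: J_def)
      show "N \<subseteq> J" using NK rmod.span_superset[of "insert (u ^ r) K"] by (auto simp: J_def)
      fix e assume "e * q \<in> J"
      then obtain c k where k: "k \<in> K" "e * q = k + c * u ^ r" using sK unfolding J_def by (rule span_insert_cases)
      have "(u * e) * q \<in> N" by (rule PqN) (rule ideal_mult_right[OF sP u])
      then have "u * (e * q) \<in> K" using NK by (auto simp: mult.assoc)
      then have "u * (e * q) - u * k \<in> K" by (rule rmod.subspace_diff[OF sK _ ideal_mult_left[OF sK k(1)]])
      then have "u ^ Suc r * c \<in> K" using k(2) by (simp add: algebra_simps)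
      then have "c \<in> L (Suc r)" by (simp add: L_def)
      then have "u ^ r * c \<in> K" unfolding L by (simp add: L_def)
      then have "e * q \<in> K" unfolding k(2) using rmod.subspace_add[OF sK k(1)] by (simp add: mult.commute)
      then show "e * q \<in> N" by (rule Kq)
    qed
    then have "J = K" by (rule K(2)[rule_format]) (use rmod.span_superset[of "insert (u ^ r) K"] in \<open>auto simp: J_def\<close>)
    then show ?thesis using rmod.span_superset[of "insert (u ^ r) K"] by (auto simp: J_def)
  qed
  then obtain n where n: "ipow P n \<subseteq> K" using ipow_subset_nilpotent[OF sK sP] by blast
  obtain k h where kh: "k \<in> K0" "h \<in> ipow P n" "q = k + h" using q by blast
  have "k + h \<in> K" using kh n K0N NK by (intro rmod.subspace_add[OF sK]) blast+
  then have "1 * q \<in> K" using kh by simp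
  then have "1 * q \<in> N" by (rule Kq)
  then obtain l p where l: "l \<in> K0" "p \<in> P" "q = l + p * q" unfolding N_def by auto
  \<comment> \<open>A power of \<open>P\<close> lies in \<open>K\<close>, so \<open>q\<close> itself
    does, and then \<open>q\<close> lies in \<open>K0 + P q\<close>. The factor \<open>1 - p\<close>
    is a unit locally at \<open>P\<close>.\<close>
  have "(1 - p) * q = q - p * q" by (simp add: algebra_simps)
  also have "\<dots> = l" using l(3) by (metis add_diff_cancel_right')
  finally have "(1 - p) * q \<in> K0" using l(1) by simp
  moreover have "1 - p \<notin> P" using rmod.subspace_add[OF sP _ l(2), of "1 - p"] prime_id_one[OF P] by auto
  ultimately show ?thesis by (blast intro: satI)
qed

section \<open>The ring of polynomial functions and Hilbert's basis theorem\<close>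

subsection \<open>Adjoining one element to a Noetherian subring\<close>

definition subring_set :: "'a::comm_ring_1 set \<Rightarrow> bool" where
  "subring_set A \<longleftrightarrow> 0 \<in> A \<and> 1 \<in> A \<and> - 1 \<in> A \<and>
     (\<forall>a\<in>A. \<forall>b\<in>A. a + b \<in> A) \<and> (\<forall>a\<in>A. \<forall>b\<in>A. a * b \<in> A)"

definition submod :: "'a::comm_ring_1 set \<Rightarrow> 'a set \<Rightarrow> bool" where
  "submod A J \<longleftrightarrow> 0 \<in> J \<and> (\<forall>a\<in>J. \<forall>b\<in>J. a + b \<in> J) \<and> (\<forall>r\<in>A. \<forall>a\<in>J. r * a \<in> J)"

text \<open>Everything is relative to a subring of one fixed ring, so that variables can be adjoined
  one by one inside the same type. That \<open>F\<close> generates \<open>I\<close> over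
  \<open>A\<close> is expressed through all submodules containing \<open>F\<close>.\<close>

definition noeth_over :: "'a::comm_ring_1 set \<Rightarrow> bool" where
  "noeth_over A \<longleftrightarrow> (\<forall>I. submod A I \<longrightarrow> I \<subseteq> A \<longrightarrow>
     (\<exists>F. finite F \<and> F \<subseteq> I \<and> (\<forall>J. submod A J \<longrightarrow> F \<subseteq> J \<longrightarrow> I \<subseteq> J)))"

text \<open>\<open>lead A z D a p\<close>: \<open>p\<close> is a polynomial in \<open>z\<close> of formal degree \<open>D\<close> over \<open>A\<close> with
  coefficient \<open>a\<close> (possibly \<open>0\<close>) at \<open>z\<^sup>D\<close>; the representation need not be unique.\<close>

definition lead :: "'a::comm_ring_1 set \<Rightarrow> 'a \<Rightarrow> nat \<Rightarrow> 'a \<Rightarrow> 'a \<Rightarrow> bool" where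
  "lead A z D a p \<longleftrightarrow> (\<exists>c. (\<forall>j. c j \<in> A) \<and> c D = a \<and> p = (\<Sum>j\<le>D. c j * z ^ j))"

definition adjoin :: "'a::comm_ring_1 set \<Rightarrow> 'a \<Rightarrow> 'a set" where
  "adjoin A z = {p. \<exists>D a. lead A z D a p}"

lemma lead_add: "subring_set A \<Longrightarrow> lead A z D a p \<Longrightarrow> lead A z D b q \<Longrightarrow> lead A z D (a + b) (p + q)"
  unfolding lead_def subring_set_def
  by (elim exE conjE, rule_tac x="\<lambda>j. c j + ca j" in exI) (auto simp: sum.distrib distrib_right)

lemma lead_scale: "subring_set A \<Longrightarrow> r \<in> A \<Longrightarrow> lead A z D a p \<Longrightarrow> lead A z D (r * a) (r * p)"
  unfolding lead_def subring_set_def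
  by (elim exE conjE, rule_tac x="\<lambda>j. r * c j" in exI) (auto simp: sum_distrib_left mult.assoc)

lemma lead_shift:
  assumes "subring_set A" "lead A z D a p"
  shows "lead A z (Suc D) a (z * p)"
proof -
  obtain c where c: "\<forall>j. c j \<in> A" "c D = a" "p = (\<Sum>j\<le>D. c j * z ^ j)" using assms unfolding lead_def by blast
  have "z * p = (\<Sum>j\<le>Suc D. (case j of 0 \<Rightarrow> 0 | Suc i \<Rightarrow> c i) * z ^ j)"
    unfolding c(3) sum.atMost_Suc_shift by (simp add: sum_distrib_left mult_ac)
  then show ?thesis
    unfolding lead_def using assms(1) c
    by (intro exI[of _ "\<lambda>j. case j of 0 \<Rightarrow> 0 | Suc i \<Rightarrow> c i"]) (auto simp: subring_set_def split: nat.splits)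
qed

lemma lead_pad:
  assumes "subring_set A" "lead A z D a p"
  shows "lead A z (Suc D) 0 p"
proof -
  obtain c where c: "\<forall>j. c j \<in> A" "c D = a" "p = (\<Sum>j\<le>D. c j * z ^ j)" using assms unfolding lead_def by blast
  then show ?thesis
    unfolding lead_def using assms(1)
    by (intro exI[of _ "\<lambda>j. if j \<le> D then c j else 0"]) (auto simp: subring_set_def)
qed

lemma lead_pad_le:
  assumes "subring_set A" "lead A z D a p" "D \<le> E"
  shows "\<exists>b. lead A z E b p"
  using assms(3,2)
proof (induction E arbitrary: a rule: dec_induct)
  case (step n)
  then show ?case using lead_pad[OF assms(1)] by blast
qed blast

lemma lead_diff:
  assumes "subring_set A" "lead A z (Suc D) a p" "lead A z (Suc D) a q"
  shows "\<exists>b. lead A z D b (p - q)"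
proof -
  obtain c where c: "\<forall>j. c j \<in> A" "c (Suc D) = a" "p = (\<Sum>j\<le>Suc D. c j * z ^ j)"
    using assms unfolding lead_def by blast
  obtain d where d: "\<forall>j. d j \<in> A" "d (Suc D) = a" "q = (\<Sum>j\<le>Suc D. d j * z ^ j)"
    using assms unfolding lead_def by blast
  have "p - q = (\<Sum>j\<le>D. (c j + (- 1) * d j) * z ^ j)"
    using c d by (simp add: sum_subtractf algebra_simps)
  moreover have "\<forall>j. c j + (- 1) * d j \<in> A"
    using c(1) d(1) assms(1) unfolding subring_set_def by blast
  ultimately show ?thesis unfolding lead_def
    by (intro exI[of _ "c D + (- 1) * d D"] exI[of _ "\<lambda>j. c j + (- 1) * d j"]) auto
qed

lemma lead_0: "lead A z 0 a p \<Longrightarrow> p = a"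
  by (auto simp: lead_def)

lemma lead_const: "a \<in> A \<Longrightarrow> lead A z 0 a a"
  unfolding lead_def by (intro exI[of _ "\<lambda>_. a"]) auto

lemma lead_in: "lead A z D a p \<Longrightarrow> a \<in> A"
  unfolding lead_def by blast

lemma adjoin_add:
  assumes A: "subring_set A" and "p \<in> adjoin A z" "q \<in> adjoin A z"
  shows "p + q \<in> adjoin A z"
proof -
  obtain D a E b where *: "lead A z D a p" "lead A z E b q" using assms by (auto simp: adjoin_def)
  then obtain a' b' where "lead A z (max D E) a' p" "lead A z (max D E) b' q"
    using lead_pad_le[OF A *(1), of "max D E"] lead_pad_le[OF A *(2), of "max D E"] by auto
  then show ?thesis using lead_add[OF A] unfolding adjoin_def by blast
qed

lemma adjoin_mult_var: "subring_set A \<Longrightarrow> p \<in> adjoin A z \<Longrightarrow> z * p \<in> adjoin A z"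
  using lead_shift unfolding adjoin_def by blast

lemma adjoin_scale: "subring_set A \<Longrightarrow> r \<in> A \<Longrightarrow> p \<in> adjoin A z \<Longrightarrow> r * p \<in> adjoin A z"
  using lead_scale unfolding adjoin_def by blast

lemma adjoin_base: "a \<in> A \<Longrightarrow> a \<in> adjoin A z"
  using lead_const unfolding adjoin_def by blast

lemma adjoin_mult:
  assumes A: "subring_set A" and "p \<in> adjoin A z" "q \<in> adjoin A z"
  shows "p * q \<in> adjoin A z"
proof -
  obtain D c where c: "\<forall>j. c j \<in> A" "p = (\<Sum>j\<le>D. c j * z ^ j)" using assms(2) unfolding adjoin_def lead_def by blast
  have pow: "z ^ j * q \<in> adjoin A z" for j
    using assms(3) by (induction j) (auto simp: mult.assoc adjoin_mult_var[OF A])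
  have "(\<Sum>j\<in>J. c j * (z ^ j * q)) \<in> adjoin A z" if "finite J" for J
    using that
  proof (induction J rule: finite_induct)
    case empty
    then show ?case using A by (auto intro: adjoin_base simp: subring_set_def)
  next
    case (insert j J)
    have "c j * (z ^ j * q) \<in> adjoin A z" using c(1) by (intro adjoin_scale[OF A _ pow]) blast
    then show ?case using insert adjoin_add[OF A] by simp
  qed
  then show ?thesis unfolding c(2) by (simp add: sum_distrib_right mult.assoc)
qed

lemma subring_adjoin:
  assumes A: "subring_set A"
  shows "subring_set (adjoin A z)"
  using A adjoin_add[OF A] adjoin_mult[OF A] adjoin_base[of _ A z] by (auto simp: subring_set_def)

lemma var_adjoin: "subring_set A \<Longrightarrow> z \<in> adjoin A z"
  using adjoin_mult_var[of A 1 z] adjoin_base[of 1 A z] by (auto simp: subring_set_def)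

text \<open>Hilbert's argument with the ideals \<open>L I D\<close> of leading coefficients in
  formal degree \<open>D\<close>. Their union is already generated in one degree \<open>D0\<close>,
  and \<open>H\<close> lifts its generators and those of the degrees up to \<open>D0\<close>. A
  submodule containing \<open>H\<close> realizes all leading coefficients of \<open>I\<close>, and
  subtraction lowers the degree.\<close>

lemma noeth_over_adjoin:
  assumes A: "subring_set A" and N: "noeth_over A"
  shows "noeth_over (adjoin A z)"
  unfolding noeth_over_def
proof (intro allI impI)
  fix I assume I: "submod (adjoin A z) I" "I \<subseteq> adjoin A z"
  define L where "L K D = {a. \<exists>p\<in>K. lead A z D a p}" for K D
  have Lsub: "submod A (L K D)" if K: "submod (adjoin A z) K" for K D
    unfolding submod_def
  proof (intro conjI ballI)
    have "lead A z D 0 0" unfolding lead_def using A by (intro exI[of _ "\<lambda>_. 0"]) (auto simp: subring_set_def)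
    then show "0 \<in> L K D" using K unfolding L_def submod_def by blast
    show "a + b \<in> L K D" if "a \<in> L K D" "b \<in> L K D" for a b
      using that K lead_add[OF A] unfolding L_def submod_def by blast
    show "r * a \<in> L K D" if "r \<in> A" "a \<in> L K D" for r a
      using that K lead_scale[OF A] adjoin_base unfolding L_def submod_def by blast
  qed
  have LA: "L K D \<subseteq> A" for K D unfolding L_def using lead_in by blast
  have Linc: "L K D \<subseteq> L K E" if K: "submod (adjoin A z) K" and "D \<le> E" for K D E
  proof (rule lift_Suc_mono_le[of "L K", OF _ \<open>D \<le> E\<close>])
    show "L K n \<subseteq> L K (Suc n)" for n
      using K lead_shift[OF A] var_adjoin[OF A] unfolding L_def submod_def by blast
  qed
  have Usub: "submod A (\<Union>D. L I D)"
    unfolding submod_def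
  proof (intro conjI ballI)
    show "0 \<in> (\<Union>D. L I D)" using Lsub[OF I(1), of 0] unfolding submod_def by blast
    show "a + b \<in> (\<Union>D. L I D)" if "a \<in> (\<Union>D. L I D)" "b \<in> (\<Union>D. L I D)" for a b
    proof -
      obtain D E where "a \<in> L I D" "b \<in> L I E" using \<open>a \<in> _\<close> \<open>b \<in> _\<close> by blast
      then have "a \<in> L I (max D E)" "b \<in> L I (max D E)"
        using Linc[OF I(1), of D "max D E"] Linc[OF I(1), of E "max D E"] by auto
      then show ?thesis using Lsub[OF I(1), of "max D E"] unfolding submod_def by blast
    qed
    show "r * a \<in> (\<Union>D. L I D)" if "r \<in> A" "a \<in> (\<Union>D. L I D)" for r a
      using that Lsub[OF I(1)] unfolding submod_def by blast
  qed
  have fg: "\<exists>F. finite F \<and> F \<subseteq> K \<and> (\<forall>J. submod A J \<longrightarrow> F \<subseteq> J \<longrightarrow> K \<subseteq> J)" if "submod A K" "K \<subseteq> A" for K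
    using N that unfolding noeth_over_def by blast
  have "(\<Union>D. L I D) \<subseteq> A" using LA by blast
  from fg[OF Usub this] obtain F where F: "finite F" "F \<subseteq> (\<Union>D. L I D)"
      "\<forall>J. submod A J \<longrightarrow> F \<subseteq> J \<longrightarrow> (\<Union>D. L I D) \<subseteq> J"
    by (elim exE conjE)
  have "\<forall>D. \<exists>G. finite G \<and> G \<subseteq> L I D \<and> (\<forall>J. submod A J \<longrightarrow> G \<subseteq> J \<longrightarrow> L I D \<subseteq> J)"
    by (rule allI) (rule fg[OF Lsub[OF I(1)] LA])
  from choice[OF this] obtain G where
    "\<forall>D. finite (G D) \<and> G D \<subseteq> L I D \<and> (\<forall>J. submod A J \<longrightarrow> G D \<subseteq> J \<longrightarrow> L I D \<subseteq> J)"
    by (rule exE)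
  then have G: "finite (G D)" "G D \<subseteq> L I D" "submod A J \<Longrightarrow> G D \<subseteq> J \<Longrightarrow> L I D \<subseteq> J" for D J
    by simp_all
  obtain D0 where D0: "F \<subseteq> L I D0"
  proof -
    have "\<exists>D. F' \<subseteq> L I D" if "finite F'" "F' \<subseteq> F" for F'
      using that
    proof (induction F' rule: finite_induct)
      case (insert a F')
      then obtain D E where "F' \<subseteq> L I D" "a \<in> L I E" using F(2) by blast
      then show ?case using Linc[OF I(1), of D "max D E"] Linc[OF I(1), of E "max D E"]
        by (intro exI[of _ "max D E"]) auto
    qed simp
    then show thesis using that F(1) by blast
  qed
  define w where "w D a = (SOME p. p \<in> I \<and> lead A z D a p)" for D a
  have w: "w D a \<in> I \<and> lead A z D a (w D a)" if "a \<in> L I D" for D a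
    unfolding w_def by (rule someI_ex) (use that L_def in blast)
  define H where "H = w D0 ` F \<union> (\<Union>D\<le>D0. w D ` G D)"
  have "finite H" using F G by (auto simp: H_def)
  moreover have "H \<subseteq> I" unfolding H_def using w D0 G(2) by blast
  moreover have "I \<subseteq> J" if J: "submod (adjoin A z) J" "H \<subseteq> J" for J
  proof -
    \<comment> \<open>Leading coefficients are realized inside the intersection with
      \<open>I\<close>, so that the difference \<open>p - q\<close> below stays in
      \<open>I\<close>.\<close>
    define J' where "J' = I \<inter> J"
    have J': "submod (adjoin A z) J'" "H \<subseteq> J'"
      using I J \<open>H \<subseteq> I\<close> unfolding J'_def submod_def by blast+
    have LL: "L I D \<subseteq> L J' D" for D
    proof (cases "D \<le> D0")
      case True
      have "G D \<subseteq> L J' D"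
      proof
        fix a assume a: "a \<in> G D"
        then have "w D a \<in> J'" using J'(2) True unfolding H_def by blast
        then show "a \<in> L J' D" using w[of a D] G(2)[of D] a unfolding L_def by blast
      qed
      then show ?thesis by (rule G(3)[OF Lsub[OF J'(1)]])
    next
      case False
      have "F \<subseteq> L J' D0"
      proof
        fix a assume a: "a \<in> F"
        then have "w D0 a \<in> J'" using J'(2) unfolding H_def by blast
        then show "a \<in> L J' D0" using w[of a D0] D0 a unfolding L_def by blast
      qed
      then have "F \<subseteq> L J' D" using Linc[OF J'(1), of D0 D] False by auto
      then have "(\<Union>D. L I D) \<subseteq> L J' D" by (rule F(3)[rule_format, OF Lsub[OF J'(1)]])
      then show ?thesis by blast
    qed
    have "p \<in> J" if "p \<in> I" "lead A z D a p" for D a p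
      using that
    proof (induction D arbitrary: a p)
      case 0
      then have "a \<in> L J' 0" using LL[of 0] unfolding L_def by blast
      then obtain q where "q \<in> J'" "lead A z 0 a q" unfolding L_def by blast
      then show ?case using lead_0 0 unfolding J'_def by blast
    next
      case (Suc D)
      then have "a \<in> L J' (Suc D)" using LL[of "Suc D"] unfolding L_def by blast
      then obtain q where q: "q \<in> I" "q \<in> J" "lead A z (Suc D) a q" unfolding L_def J'_def by blast
      obtain b where "lead A z D b (p - q)" using lead_diff[OF A Suc.prems(2) q(3)] by blast
      moreover have "p - q \<in> I"
      proof -
        have "- 1 \<in> adjoin A z" using subring_adjoin[OF A] by (auto simp: subring_set_def)
        then have "p + (- 1) * q \<in> I" using I(1) Suc.prems(1) q(1) unfolding submod_def by blast
        then show ?thesis by simp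
      qed
      ultimately have "p - q \<in> J" using Suc.IH by blast
      then have "(p - q) + q \<in> J" using J(1) q(2) unfolding submod_def by blast
      then show ?case by simp
    qed
    then show ?thesis using I(2) unfolding adjoin_def by blast
  qed
  ultimately show "\<exists>F. finite F \<and> F \<subseteq> I \<and> (\<forall>J. submod (adjoin A z) J \<longrightarrow> F \<subseteq> J \<longrightarrow> I \<subseteq> J)"
    by blast
qed

subsection \<open>Polynomial functions\<close>

text \<open>A type of its own makes the polynomial functions an instance of
  \<open>comm_ring_1\<close>, to which the ideal theory above applies. The maps \<open>cls\<close>
  and \<open>germ\<close> link it to the carrier-based rings.\<close>

typedef (overloaded) ('n::finite) polyfun = "{p :: real ^ 'n \<Rightarrow> real. real_polynomial_function p}"
  morphisms ev Polyfun
  by (rule exI[of _ "\<lambda>_. 0"]) auto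

setup_lifting type_definition_polyfun

lemma polyfun_eqI: "(\<And>y. ev p y = ev q y) \<Longrightarrow> p = q"
  by (metis ev_inject ext)

lemma real_polynomial_ev: "real_polynomial_function (ev p)"
  using ev[of p] by simp

lemma ev_Polyfun: "real_polynomial_function p \<Longrightarrow> ev (Polyfun p) = p"
  by (simp add: Polyfun_inverse)

instantiation polyfun :: (finite) comm_ring_1
begin

lift_definition zero_polyfun :: "'a polyfun" is "\<lambda>_. 0" by auto
lift_definition one_polyfun :: "'a polyfun" is "\<lambda>_. 1" by auto
lift_definition plus_polyfun :: "'a polyfun \<Rightarrow> 'a polyfun \<Rightarrow> 'a polyfun" is "\<lambda>p q x. p x + q x" by auto
lift_definition times_polyfun :: "'a polyfun \<Rightarrow> 'a polyfun \<Rightarrow> 'a polyfun" is "\<lambda>p q x. p x * q x" by auto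
lift_definition minus_polyfun :: "'a polyfun \<Rightarrow> 'a polyfun \<Rightarrow> 'a polyfun" is "\<lambda>p q x. p x - q x"
  by (rule real_polynomial_function_diff)
lift_definition uminus_polyfun :: "'a polyfun \<Rightarrow> 'a polyfun" is "\<lambda>p x. - p x"
  by (rule real_polynomial_function_minus)

instance
  by standard (transfer; auto simp: algebra_simps fun_eq_iff)+

end

lift_definition cst :: "real \<Rightarrow> ('n::finite) polyfun" is "\<lambda>c _. c" by auto
lift_definition crd :: "'n \<Rightarrow> ('n::finite) polyfun" is "\<lambda>i y. y $ i"
  by (rule real_polynomial_function.intros(1)) (rule bounded_linear_vec_nth)

lemma ev_simps [simp]:
  "ev 0 y = 0" "ev 1 y = 1" "ev (p + q) y = ev p y + ev q y" "ev (p * q) y = ev p y * ev q y"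
  "ev (p - q) y = ev p y - ev q y" "ev (- p) y = - ev p y" "ev (cst c) y = c" "ev (crd i) y = y $ i"
  by (transfer; simp)+

lemma ev_sum [simp]: "ev (sum f A) y = (\<Sum>i\<in>A. ev (f i) y)"
  by (induction A rule: infinite_finite_induct) auto

lemma ev_prod [simp]: "ev (prod f A) y = (\<Prod>i\<in>A. ev (f i) y)"
  by (induction A rule: infinite_finite_induct) auto

lemma ev_power [simp]: "ev (p ^ n) y = ev p y ^ n"
  by (induction n) auto

lemma cst_simps: "cst 0 = 0" "cst 1 = 1" "cst (a + b) = cst a + cst b" "cst (a * b) = cst a * cst b"
  "cst (- a) = - cst a" "cst (a - b) = cst a - cst b"
  by (auto intro!: polyfun_eqI)

text \<open>In place of arbitrary bounded linear functions it is enough to treat coordinates, since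
  a linear function is a combination of them.\<close>

lemma polyfun_induct [case_names const coord add mult]:
  fixes p :: "'n::finite polyfun"
  assumes "\<And>c. Q (cst c)" "\<And>i. Q (crd i)" "\<And>p q. Q p \<Longrightarrow> Q q \<Longrightarrow> Q (p + q)" "\<And>p q. Q p \<Longrightarrow> Q q \<Longrightarrow> Q (p * q)"
  shows "Q p"
proof -
  have "Q (Polyfun f)" if "real_polynomial_function f" for f
    using that
  proof (induction f rule: real_polynomial_function.induct)
    case (linear f)
    have lin: "f y = (\<Sum>i\<in>UNIV. f (axis i 1) * y $ i)" for y
    proof -
      have "f y = f (\<Sum>i\<in>UNIV. y $ i *\<^sub>R axis i 1)" by (simp add: basis_expansion scalar_mult_eq_scaleR[symmetric])
      also have "\<dots> = (\<Sum>i\<in>UNIV. f (axis i 1) * y $ i)"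
        using bounded_linear.linear[OF linear] by (simp add: linear_sum linear_cmul mult.commute)
      finally show ?thesis .
    qed
    have "real_polynomial_function f" using linear by (rule real_polynomial_function.intros(1))
    then have "Polyfun f = (\<Sum>i\<in>UNIV. cst (f (axis i 1)) * crd i)"
      by (intro polyfun_eqI) (simp add: ev_Polyfun lin[symmetric])
    moreover have "Q (\<Sum>i\<in>S. cst (f (axis i 1)) * crd i)" if "finite S" for S
      using that
    proof (induction S rule: finite_induct)
      case empty
      then show ?case using assms(1)[of 0] by (simp add: cst_simps)
    qed (use assms in auto)
    ultimately show ?case by simp
  next
    case (const c)
    have "Polyfun (\<lambda>_. c) = (cst c :: 'n polyfun)" by (intro polyfun_eqI) (simp add: ev_Polyfun real_polynomial_function.intros(2))
    then show ?case using assms(1) by simp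
  next
    case (add f g)
    then have "Polyfun (\<lambda>x. f x + g x) = Polyfun f + Polyfun g"
      by (intro polyfun_eqI) (simp add: ev_Polyfun real_polynomial_function.intros(3))
    then show ?case using assms add by simp
  next
    case (mult f g)
    then have "Polyfun (\<lambda>x. f x * g x) = Polyfun f * Polyfun g"
      by (intro polyfun_eqI) (simp add: ev_Polyfun real_polynomial_function.intros(4))
    then show ?case using assms mult by simp
  qed
  from this[OF real_polynomial_ev[of p]] show ?thesis by (simp add: ev_inverse)
qed

lemma noeth_over_cst: "noeth_over (range cst :: 'n::finite polyfun set)"
  unfolding noeth_over_def
proof (intro allI impI)
  fix I :: "'n polyfun set" assume I: "submod (range cst) I" "I \<subseteq> range cst"
  show "\<exists>F. finite F \<and> F \<subseteq> I \<and> (\<forall>J. submod (range cst) J \<longrightarrow> F \<subseteq> J \<longrightarrow> I \<subseteq> J)"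
  proof (cases "I \<subseteq> {0}")
    case True
    then show ?thesis by (intro exI[of _ "{}"]) (auto simp: submod_def)
  next
    case False
    then obtain c where c: "cst c \<in> I" "cst c \<noteq> (0 :: 'n polyfun)" using I(2) by blast
    then have "c \<noteq> 0" by (auto simp: cst_simps)
    have "I \<subseteq> J" if J: "submod (range cst) J" "{cst c} \<subseteq> J" for J
    proof
      fix p assume "p \<in> I"
      then obtain b where "p = cst b" using I by blast
      then have "p = cst (b / c) * cst c" using \<open>c \<noteq> 0\<close> by (simp add: cst_simps(4)[symmetric])
      then show "p \<in> J" using J unfolding submod_def by blast
    qed
    then show ?thesis using c by (intro exI[of _ "{cst c}"]) auto
  qed
qed

lemma subring_cst: "subring_set (range cst :: 'n::finite polyfun set)"
  unfolding subring_set_def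
proof (intro conjI ballI)
  show "(0 :: 'n polyfun) \<in> range cst" by (rule range_eqI[of _ _ 0]) (simp add: cst_simps)
  show "(1 :: 'n polyfun) \<in> range cst" by (rule range_eqI[of _ _ 1]) (simp add: cst_simps)
  show "(- 1 :: 'n polyfun) \<in> range cst" by (rule range_eqI[of _ _ "- 1"]) (simp add: cst_simps)
qed (auto simp: cst_simps[symmetric])

lemma noeth_over_coords:
  "finite S \<Longrightarrow> \<exists>A :: 'n::finite polyfun set. subring_set A \<and> noeth_over A \<and> range cst \<subseteq> A \<and> crd ` S \<subseteq> A"
proof (induction S rule: finite_induct)
  case empty
  then show ?case using noeth_over_cst subring_cst by (intro exI[of _ "range cst"]) auto
next
  case (insert i S)
  then obtain A :: "'n polyfun set" where A: "subring_set A" "noeth_over A" "range cst \<subseteq> A" "crd ` S \<subseteq> A" by blast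
  then show ?case
    using subring_adjoin[OF A(1), of "crd i"] noeth_over_adjoin[OF A(1,2), of "crd i"] var_adjoin[OF A(1), of "crd i"]
      adjoin_base[of _ A "crd i"]
    by (intro exI[of _ "adjoin A (crd i)"]) blast
qed

theorem hilbert_basis:
  fixes I :: "'n::finite polyfun set"
  assumes "rmod.subspace I"
  obtains F where "finite F" "F \<subseteq> I" "I = rmod.span F"
proof -
  obtain A :: "'n polyfun set" where A: "subring_set A" "noeth_over A" "range cst \<subseteq> A" "crd ` UNIV \<subseteq> A"
    using noeth_over_coords[of "UNIV :: 'n set"] by auto
  have "p \<in> A" for p :: "'n polyfun"
    using A by (induction p rule: polyfun_induct) (auto simp: subring_set_def)
  then have U: "A = UNIV" by auto
  have sub: "submod UNIV J \<longleftrightarrow> rmod.subspace J" for J :: "'n polyfun set"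
    unfolding submod_def rmod.subspace_def by blast
  have "\<exists>F. finite F \<and> F \<subseteq> I \<and> (\<forall>J. submod UNIV J \<longrightarrow> F \<subseteq> J \<longrightarrow> I \<subseteq> J)"
    using A(2) assms unfolding U noeth_over_def sub by blast
  then obtain F where F: "finite F" "F \<subseteq> I" "\<forall>J. rmod.subspace J \<longrightarrow> F \<subseteq> J \<longrightarrow> I \<subseteq> J"
    unfolding sub by (elim exE conjE)
  have "I \<subseteq> rmod.span F" by (rule F(3)[rule_format, OF rmod.subspace_span rmod.span_superset])
  then have "I = rmod.span F" using rmod.span_minimal[OF F(2) assms] by (rule equalityI)
  then show thesis by (rule that[OF F(1,2)])
qed

instance polyfun :: (finite) noeth_ring
proof
  fix I :: "'a polyfun set"
  assume "0 \<in> I" "\<And>a b. a \<in> I \<Longrightarrow> b \<in> I \<Longrightarrow> a + b \<in> I" "\<And>r a. a \<in> I \<Longrightarrow> r * a \<in> I"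
  then have "rmod.subspace I" by (intro rmod.subspaceI)
  then obtain F where F: "finite F" "F \<subseteq> I" "I = rmod.span F" by (rule hilbert_basis)
  then show "\<exists>F. finite F \<and> F \<subseteq> I \<and> (\<forall>a\<in>I. \<exists>c. a = (\<Sum>f\<in>F. c f * f))"
    by (intro exI[of _ F]) (auto simp: rmod.span_finite)
qed

section \<open>From the local ring at a point to polynomial functions\<close>

definition van :: "(real ^ 'n) set \<Rightarrow> ('n::finite) polyfun set" where
  "van X = {p. \<forall>y\<in>X. ev p y = 0}"

abbreviation mx :: "real ^ 'n \<Rightarrow> ('n::finite) polyfun set" where
  "mx x \<equiv> van {x}"

lemma mx_iff: "p \<in> mx x \<longleftrightarrow> ev p x = 0"
  by (simp add: van_def)

lemma ideal_van: "rmod.subspace (van X)"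
  by (intro rmod.subspaceI) (auto simp: van_def)

lemma prime_mx: "prime_id (mx x)"
  unfolding prime_id_def using ideal_van[of "{x}"] by (simp add: mx_iff)

lemma van_subset_mx: "x \<in> X \<Longrightarrow> van X \<subseteq> mx x"
  by (auto simp: van_def)

text \<open>The properties of the map \<open>p \<mapsto> p / 1\<close> into a local ring from which
  primes and generators can be transported. Fractions as equivalence classes occur only where
  \<open>germ\<close> is shown to satisfy them.\<close>

locale localized_functions = cring A for A (structure) +
  fixes \<theta> :: "'n::finite polyfun \<Rightarrow> 'a" and X :: "(real ^ 'n) set" and x :: "real ^ 'n"
  assumes xX: "x \<in> X"
    and hom_closed: "\<theta> p \<in> carrier A"
    and hom_add: "\<theta> (p + q) = \<theta> p \<oplus> \<theta> q"
    and hom_mult: "\<theta> (p * q) = \<theta> p \<otimes> \<theta> q"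
    and hom_one: "\<theta> 1 = \<one>"
    and hom_zero: "p \<in> van X \<Longrightarrow> \<theta> p = \<zero>"
    and frac: "a \<in> carrier A \<Longrightarrow> \<exists>p s. s \<notin> mx x \<and> a \<otimes> \<theta> s = \<theta> p"
    and unit: "s \<notin> mx x \<Longrightarrow> \<theta> s \<in> Units A"
    and eqD: "\<theta> p = \<theta> q \<Longrightarrow> \<exists>s. s \<notin> mx x \<and> s * (p - q) \<in> van X"
begin

lemma prime_pullback:
  assumes "primeideal Q A"
  shows "prime_id (\<theta> -` Q)" "van X \<subseteq> \<theta> -` Q" "\<theta> -` Q \<subseteq> mx x"
proof -
  interpret Q: primeideal Q A by fact
  have one: "\<one> \<notin> Q" using Q.I_notcarr Q.one_imp_carrier by blast
  show "prime_id (\<theta> -` Q)" unfolding prime_id_def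
  proof (intro conjI allI impI rmod.subspaceI)
    have "\<theta> 0 = \<zero>" by (rule hom_zero) (simp add: van_def)
    then show "0 \<in> \<theta> -` Q" using Q.zero_closed by simp
    show "1 \<notin> \<theta> -` Q" using one by (simp add: hom_one)
    show "p + q \<in> \<theta> -` Q" if "p \<in> \<theta> -` Q" "q \<in> \<theta> -` Q" for p q
      using that by (simp add: hom_add Q.a_closed)
    show "c * p \<in> \<theta> -` Q" if "p \<in> \<theta> -` Q" for c p
      using that by (simp add: hom_mult Q.I_l_closed hom_closed)
    show "p \<in> \<theta> -` Q \<or> q \<in> \<theta> -` Q" if "p * q \<in> \<theta> -` Q" for p q
      using that Q.I_prime[of "\<theta> p" "\<theta> q"] by (simp add: hom_mult hom_closed)
  qed
  show "van X \<subseteq> \<theta> -` Q" using hom_zero Q.zero_closed by auto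
  show "\<theta> -` Q \<subseteq> mx x"
  proof (rule ccontr)
    assume "\<not> \<theta> -` Q \<subseteq> mx x"
    then obtain s where s: "\<theta> s \<in> Q" "s \<notin> mx x" by blast
    then have "inv (\<theta> s) \<otimes> \<theta> s \<in> Q" using unit Units_inv_closed by (intro Q.I_l_closed) auto
    then show False using one s(2) unit Units_l_inv by simp
  qed
qed

text \<open>The numerator of an element of \<open>Q\<close> outside \<open>P\<close> separates the
  two preimages.\<close>

lemma prime_pullback_strict:
  assumes "primeideal P A" "primeideal Q A" "P \<subset> Q"
  shows "\<theta> -` P \<subset> \<theta> -` Q"
proof -
  interpret P: primeideal P A by fact
  interpret Q: primeideal Q A by fact
  obtain a where a: "a \<in> Q" "a \<notin> P" using assms by blast
  then have aA: "a \<in> carrier A" by (simp add: Q.Icarr)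
  then obtain p s where ps: "s \<notin> mx x" "a \<otimes> \<theta> s = \<theta> p" using frac by blast
  have "\<theta> p \<in> Q" using ps(2)[symmetric] a(1) hom_closed Q.I_r_closed by simp
  moreover have "\<theta> p \<notin> P"
  proof
    assume "\<theta> p \<in> P"
    then have "a \<otimes> \<theta> s \<in> P" using ps by simp
    then have "\<theta> s \<in> P" using P.I_prime[OF aA hom_closed] a(2) by blast
    then show False using prime_pullback(3)[OF assms(1)] ps(1) by blast
  qed
  ultimately show ?thesis using assms(3) by blast
qed

text \<open>The extension of \<open>K\<close> to the local ring, described by the equation
  \<open>a \<otimes> \<theta> s = \<theta> p\<close> for fractions with numerator in
  \<open>K\<close>.\<close>

definition loc_ideal :: "'n polyfun set \<Rightarrow> 'a set" where
  "loc_ideal K = {a \<in> carrier A. \<exists>p\<in>K. \<exists>s. s \<notin> mx x \<and> a \<otimes> \<theta> s = \<theta> p}"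

lemma ideal_loc_ideal:
  assumes K: "rmod.subspace K"
  shows "ideal (loc_ideal K) A"
proof (rule idealI[OF ring_axioms])
  have one: "1 \<notin> mx x" by (simp add: mx_iff)
  show "subgroup (loc_ideal K) (add_monoid A)"
  proof (rule add.subgroupI)
    show "loc_ideal K \<subseteq> carrier A" by (auto simp: loc_ideal_def)
    have "\<zero> \<otimes> \<theta> 1 = \<theta> 0" using hom_closed hom_zero[of 0] by (simp add: van_def)
    then have "\<zero> \<in> loc_ideal K" using one rmod.subspace_0[OF K] unfolding loc_ideal_def by blast
    then show "loc_ideal K \<noteq> {}" by blast
    show "\<ominus> a \<in> loc_ideal K" if "a \<in> loc_ideal K" for a
    proof -
      obtain p s where *: "a \<in> carrier A" "p \<in> K" "s \<notin> mx x" "a \<otimes> \<theta> s = \<theta> p"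
        using \<open>a \<in> loc_ideal K\<close> unfolding loc_ideal_def by blast
      have "\<theta> (- p) \<oplus> \<theta> p = \<zero>" using hom_add[of "- p" p] hom_zero[of 0] by (simp add: van_def)
      then have "\<theta> (- p) = \<ominus> \<theta> p" using minus_equality[OF _ hom_closed hom_closed] by metis
      then have "(\<ominus> a) \<otimes> \<theta> s = \<theta> (- p)" using * hom_closed by (simp add: l_minus)
      then show ?thesis using * rmod.subspace_neg[OF K *(2)] unfolding loc_ideal_def by blast
    qed
    show "a \<oplus> b \<in> loc_ideal K" if ab: "a \<in> loc_ideal K" "b \<in> loc_ideal K" for a b
    proof -
      obtain p s where *: "a \<in> carrier A" "p \<in> K" "s \<notin> mx x" "a \<otimes> \<theta> s = \<theta> p"
        using ab(1) unfolding loc_ideal_def by blast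
      obtain q t where **: "b \<in> carrier A" "q \<in> K" "t \<notin> mx x" "b \<otimes> \<theta> t = \<theta> q"
        using ab(2) unfolding loc_ideal_def by blast
      have "(a \<oplus> b) \<otimes> \<theta> (s * t) = (a \<otimes> \<theta> s) \<otimes> \<theta> t \<oplus> (b \<otimes> \<theta> t) \<otimes> \<theta> s"
        unfolding hom_mult using *(1) **(1) hom_closed[of s] hom_closed[of t]
        by (simp add: l_distr m_assoc m_comm[of "\<theta> s" "\<theta> t"])
      also have "\<dots> = \<theta> (t * p + s * q)"
        unfolding hom_mult hom_add *(4) **(4) using hom_closed by (simp add: m_comm)
      finally have "(a \<oplus> b) \<otimes> \<theta> (s * t) = \<theta> (t * p + s * q)" .
      moreover have "s * t \<notin> mx x" by (rule prime_id_mult_notin[OF prime_mx *(3) **(3)])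
      moreover have "t * p + s * q \<in> K"
        by (rule rmod.subspace_add[OF K ideal_mult_left[OF K *(2)] ideal_mult_left[OF K **(2)]])
      ultimately show ?thesis using *(1) **(1) unfolding loc_ideal_def by blast
    qed
  qed
  have l: "b \<otimes> a \<in> loc_ideal K" if ab: "a \<in> loc_ideal K" "b \<in> carrier A" for a b
  proof -
    obtain p s where *: "a \<in> carrier A" "p \<in> K" "s \<notin> mx x" "a \<otimes> \<theta> s = \<theta> p"
      using ab(1) unfolding loc_ideal_def by blast
    obtain q t where **: "t \<notin> mx x" "b \<otimes> \<theta> t = \<theta> q" using frac[OF ab(2)] by blast
    have "(b \<otimes> a) \<otimes> \<theta> (t * s) = (b \<otimes> \<theta> t) \<otimes> (a \<otimes> \<theta> s)"
      unfolding hom_mult using *(1) ab(2) hom_closed by (simp add: m_ac)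
    also have "\<dots> = \<theta> (q * p)" unfolding hom_mult *(4) **(2) ..
    finally show ?thesis
      using prime_id_mult_notin[OF prime_mx **(1) *(3)] ideal_mult_left[OF K *(2)] *(1) ab(2)
      unfolding loc_ideal_def by blast
  qed
  show "b \<otimes> a \<in> loc_ideal K" if "a \<in> loc_ideal K" "b \<in> carrier A" for a b using l that .
  show "a \<otimes> b \<in> loc_ideal K" if ab: "a \<in> loc_ideal K" "b \<in> carrier A" for a b
    using l[OF ab] ab m_comm[of a b] by (auto simp: loc_ideal_def)
qed

lemma loc_idealD:
  assumes K: "rmod.subspace K" "van X \<subseteq> K" and "\<theta> p \<in> loc_ideal K"
  shows "\<exists>s. s \<notin> mx x \<and> s * p \<in> K"
proof -
  obtain q s where *: "q \<in> K" "s \<notin> mx x" "\<theta> p \<otimes> \<theta> s = \<theta> q"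
    using assms(3) unfolding loc_ideal_def by blast
  then have "\<theta> (p * s) = \<theta> q" by (simp add: hom_mult)
  then obtain t where t: "t \<notin> mx x" "t * (p * s - q) \<in> van X" using eqD by blast
  have "t * (p * s - q) + t * q \<in> K"
    using K t(2) by (intro rmod.subspace_add[OF K(1) _ ideal_mult_left[OF K(1) *(1)]]) blast
  then have "(t * s) * p \<in> K" by (simp add: algebra_simps)
  then show ?thesis using prime_id_mult_notin[OF prime_mx t(1) *(2)] by blast
qed

lemma maximal_loc_ideal: "maximalideal (loc_ideal (mx x)) A"
proof (rule maximalidealI[OF ideal_loc_ideal[OF ideal_van]])
  show "carrier A \<noteq> loc_ideal (mx x)"
  proof
    assume "carrier A = loc_ideal (mx x)"
    then have "\<theta> 1 \<in> loc_ideal (mx x)" using hom_closed by blast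
    then obtain s where "s \<notin> mx x" "s * 1 \<in> mx x"
      using loc_idealD[OF ideal_van van_subset_mx[OF xX]] by blast
    then show False by simp
  qed
  fix J assume J: "ideal J A" "loc_ideal (mx x) \<subseteq> J" "J \<subseteq> carrier A"
  interpret J: ideal J A by fact
  show "J = loc_ideal (mx x) \<or> J = carrier A"
  proof (cases "J \<subseteq> loc_ideal (mx x)")
    case False
    then obtain a where a: "a \<in> J" "a \<notin> loc_ideal (mx x)" by blast
    obtain p s where ps: "s \<notin> mx x" "a \<otimes> \<theta> s = \<theta> p" using frac a J by blast
    then have p: "p \<notin> mx x" using a J unfolding loc_ideal_def by blast
    have "\<theta> p \<in> J" using ps(2)[symmetric] a(1) hom_closed J.I_r_closed by simp
    then have "inv (\<theta> p) \<otimes> \<theta> p \<in> J" using unit[OF p] by (intro J.I_l_closed) auto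
    then have "\<one> \<in> J" using unit[OF p] by simp
    then show ?thesis using J.one_imp_carrier by simp
  qed (use J in auto)
qed

lemma regular_chain:
  assumes "regular_local_ring A d"
  shows "\<exists>P. (\<forall>i\<le>d. prime_id (P i) \<and> van X \<subseteq> P i \<and> P i \<subseteq> mx x) \<and> (\<forall>i<d. P i \<subset> P (Suc i))"
proof -
  obtain Q where Q: "prime_chain A d Q" using assms unfolding regular_local_ring_def has_krull_dim_def by blast
  then show ?thesis
    using prime_pullback prime_pullback_strict unfolding prime_chain_def
    by (intro exI[of _ "\<lambda>i. \<theta> -` Q i"]) auto
qed

text \<open>The maximal ideal of a local ring is unique, so the ideal with \<open>d\<close>
  generators must be \<open>loc_ideal (mx x)\<close>. The set \<open>U\<close> consists of
  numerators of these generators.\<close>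

lemma regular_generators:
  assumes "regular_local_ring A d"
  shows "\<exists>U. finite U \<and> card U \<le> d \<and> U \<subseteq> mx x \<and> (\<forall>p\<in>mx x. \<exists>s. s \<notin> mx x \<and> s * p \<in> rmod.span (U \<union> van X))"
proof -
  have uniq: "M = loc_ideal (mx x)" if "maximalideal M A" for M
    using assms that maximal_loc_ideal unfolding regular_local_ring_def by blast
  obtain M G where M: "maximalideal M A" "G \<subseteq> carrier A" "finite G" "card G = d" "M = genideal A G"
    using assms unfolding regular_local_ring_def by blast
  have G: "loc_ideal (mx x) = genideal A G" using uniq[OF M(1)] M(5) by simp
  have "\<forall>a\<in>G. \<exists>p. p \<in> mx x \<and> (\<exists>s. s \<notin> mx x \<and> a \<otimes> \<theta> s = \<theta> p)"
    using genideal_self[OF M(2)] unfolding G[symmetric] loc_ideal_def by blast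
  from bchoice[OF this] obtain f where f: "\<forall>a\<in>G. f a \<in> mx x \<and> (\<exists>s. s \<notin> mx x \<and> a \<otimes> \<theta> s = \<theta> (f a))" by (rule exE)
  \<comment> \<open>Different generators may receive the same numerator, hence only
    \<open>card U \<le> d\<close>.\<close>
  define U where "U = f ` G"
  have "G \<subseteq> loc_ideal (rmod.span (U \<union> van X))"
  proof
    fix a assume a: "a \<in> G"
    have "f a \<in> rmod.span (U \<union> van X)" using a by (intro rmod.span_base) (simp add: U_def)
    then show "a \<in> loc_ideal (rmod.span (U \<union> van X))" using f a M(2) unfolding loc_ideal_def by blast
  qed
  then have "genideal A G \<subseteq> loc_ideal (rmod.span (U \<union> van X))"
    by (rule genideal_minimal[OF ideal_loc_ideal[OF rmod.subspace_span]])
  then have sub: "loc_ideal (mx x) \<subseteq> loc_ideal (rmod.span (U \<union> van X))" using G by simp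
  have "\<exists>s. s \<notin> mx x \<and> s * p \<in> rmod.span (U \<union> van X)" if p: "p \<in> mx x" for p
  proof (rule loc_idealD[OF rmod.subspace_span])
    show "van X \<subseteq> rmod.span (U \<union> van X)" using rmod.span_superset[of "U \<union> van X"] by blast
    have "\<theta> p \<otimes> \<theta> 1 = \<theta> p" by (simp add: hom_one hom_closed)
    moreover have "1 \<notin> mx x" by (simp add: mx_iff)
    ultimately have "\<theta> p \<in> loc_ideal (mx x)" unfolding loc_ideal_def using p hom_closed by blast
    then show "\<theta> p \<in> loc_ideal (rmod.span (U \<union> van X))" using sub by blast
  qed
  moreover have "finite U" "card U \<le> d" "U \<subseteq> mx x"
    using M(3,4) f card_image_le[OF M(3), of f] unfolding U_def by auto
  ultimately show ?thesis by blast
qed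

end

section \<open>The map from polynomial functions to the local ring of a point\<close>

definition cls :: "(real ^ 'n) set \<Rightarrow> ('n::finite) polyfun \<Rightarrow> (real ^ 'n \<Rightarrow> real) set" where
  "cls X p = vanishing_ideal X +>\<^bsub>poly_ring\<^esub> ev p"

lemma cls_carrier: "cls X p \<in> carrier (coord_ring X)"
  by (auto simp: coord_ring_carrier cls_def intro: real_polynomial_ev)

lemma carrier_cls:
  assumes "c \<in> carrier (coord_ring X)"
  obtains p where "c = cls X p"
proof -
  obtain f where "real_polynomial_function f" "c = vanishing_ideal X +>\<^bsub>poly_ring\<^esub> f"
    using assms by (auto simp: coord_ring_carrier)
  then have "c = cls X (Polyfun f)" by (simp add: cls_def ev_Polyfun)
  then show thesis by (rule that)
qed

lemma cls_point: "x \<in> X \<Longrightarrow> cls X p \<in> point_ideal X x \<longleftrightarrow> p \<in> mx x"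
  using coset_mem_point_ideal_iff[OF _ real_polynomial_ev[of p]] by (simp add: cls_def mx_iff)

lemma cls_mult: "cls X p \<otimes>\<^bsub>coord_ring X\<^esub> cls X q = cls X (p * q)"
proof -
  interpret I: ideal "vanishing_ideal X" poly_ring by (rule ideal_vanishing_ideal)
  have "ev (p * q) = (\<lambda>x. ev p x * ev q x)" by auto
  then show ?thesis
    using I.rcoset_mult_add[of "ev p" "ev q"] real_polynomial_ev[of p] real_polynomial_ev[of q]
    by (simp add: cls_def coord_ring_def FactRing_def poly_ring_def)
qed

lemma cls_add: "cls X p \<oplus>\<^bsub>coord_ring X\<^esub> cls X q = cls X (p + q)"
proof -
  interpret I: ideal "vanishing_ideal X" poly_ring by (rule ideal_vanishing_ideal)
  have "ev (p + q) = (\<lambda>x. ev p x + ev q x)" by auto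
  then show ?thesis
    using I.a_rcos_sum[of "ev p" "ev q"] real_polynomial_ev[of p] real_polynomial_ev[of q]
    by (simp add: cls_def coord_ring_def FactRing_def poly_ring_def)
qed

lemma cls_one: "cls X 1 = \<one>\<^bsub>coord_ring X\<^esub>"
proof -
  have "ev (1 :: 'a polyfun) = (\<lambda>x. 1)" by auto
  then show ?thesis by (simp add: cls_def coord_ring_def FactRing_def poly_ring_def)
qed

lemma cls_eqD:
  assumes "cls X p = cls X q"
  shows "p - q \<in> van X"
proof -
  have "ev p \<in> cls X p"
    unfolding cls_def a_r_coset_def' by (auto simp: vanishing_ideal_def poly_ring_def intro!: bexI[of _ "\<lambda>x. 0"])
  then have "ev p \<in> cls X q" using assms by simp
  then show ?thesis unfolding cls_def a_r_coset_def' by (auto simp: vanishing_ideal_def poly_ring_def van_def)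
qed

lemma cls_zero:
  assumes "p \<in> van X"
  shows "cls X p = \<zero>\<^bsub>coord_ring X\<^esub>"
proof -
  interpret I: ideal "vanishing_ideal X" poly_ring by (rule ideal_vanishing_ideal)
  have "ev p \<in> vanishing_ideal X" using assms real_polynomial_ev[of p] by (auto simp: van_def vanishing_ideal_def)
  then show ?thesis using I.a_rcos_const by (simp add: cls_def coord_ring_def FactRing_def)
qed

definition germ :: "(real ^ 'n) set \<Rightarrow> real ^ 'n \<Rightarrow> ('n::finite) polyfun \<Rightarrow> ((real ^ 'n \<Rightarrow> real) set \<times> (real ^ 'n \<Rightarrow> real) set) set" where
  "germ X x p = frac_class (coord_ring X) (carrier (coord_ring X) - point_ideal X x) (cls X p) \<one>\<^bsub>coord_ring X\<^esub>"

lemma localized_functions_germ: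
  assumes x: "x \<in> X"
  shows "localized_functions (local_ring_at X x) (germ X x) X x"
proof -
  let ?C = "coord_ring X" and ?S = "carrier (coord_ring X) - point_ideal X x"
  interpret M: mult_set ?C ?S by (rule mult_set_point[OF x])
  interpret A: cring "local_ring_at X x" by (rule cring_local_ring_at[OF x])
  have loc: "localization ?C ?S = local_ring_at X x" by (simp add: local_ring_at_def)
  note mult = M.frac_class_mult[unfolded loc] and add = M.frac_class_add[unfolded loc]
  have S: "cls X s \<in> ?S \<longleftrightarrow> s \<notin> mx x" for s using cls_carrier cls_point[OF x] by blast
  have "\<one>\<^bsub>?C\<^esub> \<notin> point_ideal X x" using M.S_one by blast
  note [simp] = cls_carrier this
  show ?thesis
  proof
    show "x \<in> X" by fact
    show "germ X x p \<in> carrier (local_ring_at X x)" for p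
      unfolding germ_def loc[symmetric] by (rule M.frac_class_closed) auto
    show "germ X x (p + q) = germ X x p \<oplus>\<^bsub>local_ring_at X x\<^esub> germ X x q" for p q
      unfolding germ_def by (subst add) (auto simp: cls_add)
    show m: "germ X x (p * q) = germ X x p \<otimes>\<^bsub>local_ring_at X x\<^esub> germ X x q" for p q
      unfolding germ_def by (subst mult) (auto simp: cls_mult)
    show "germ X x 1 = \<one>\<^bsub>local_ring_at X x\<^esub>"
      unfolding germ_def cls_one loc[symmetric] M.frac_class_one ..
    show "germ X x p = \<zero>\<^bsub>local_ring_at X x\<^esub>" if "p \<in> van X" for p
      unfolding germ_def cls_zero[OF that] loc[symmetric] M.frac_class_zero ..
    show "\<exists>p s. s \<notin> mx x \<and> a \<otimes>\<^bsub>local_ring_at X x\<^esub> germ X x s = germ X x p"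
      if "a \<in> carrier (local_ring_at X x)" for a
    proof -
      from that[folded loc] obtain c e
        where ce: "c \<in> carrier ?C" "e \<in> carrier ?C" "e \<in> ?S" "a = frac_class ?C ?S c e"
        by (rule M.frac_class_cases)
      obtain p where p: "c = cls X p" using carrier_cls[OF ce(1)] .
      obtain s where s: "e = cls X s" using carrier_cls ce(2) by blast
      have sm: "s \<notin> mx x" using S ce s by blast
      have "a \<otimes>\<^bsub>local_ring_at X x\<^esub> germ X x s = frac_class ?C ?S (c \<otimes>\<^bsub>?C\<^esub> cls X s) (e \<otimes>\<^bsub>?C\<^esub> \<one>\<^bsub>?C\<^esub>)"
        unfolding ce(4) germ_def by (rule mult) (use ce in auto)
      also have "\<dots> = germ X x p"
        unfolding germ_def p s by (rule M.frac_class_eqI) (use sm S in \<open>auto simp: M.S_mult cls_mult\<close>)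
      finally show ?thesis using sm by blast
    qed
    show "germ X x s \<in> Units (local_ring_at X x)" if s: "s \<notin> mx x" for s
    proof -
      have sS: "cls X s \<in> ?S" using s S by blast
      have "frac_class ?C ?S \<one>\<^bsub>?C\<^esub> (cls X s) \<otimes>\<^bsub>local_ring_at X x\<^esub> germ X x s
          = frac_class ?C ?S (\<one>\<^bsub>?C\<^esub> \<otimes>\<^bsub>?C\<^esub> cls X s) (cls X s \<otimes>\<^bsub>?C\<^esub> \<one>\<^bsub>?C\<^esub>)"
        unfolding germ_def by (rule mult) (use sS in auto)
      also have "\<dots> = \<one>\<^bsub>local_ring_at X x\<^esub>"
        unfolding loc[symmetric] M.frac_class_one by (rule M.frac_class_eqI) (use sS in auto)
      finally have 1: "frac_class ?C ?S \<one>\<^bsub>?C\<^esub> (cls X s) \<otimes>\<^bsub>local_ring_at X x\<^esub> germ X x s = \<one>\<^bsub>local_ring_at X x\<^esub>" .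
      have 2: "frac_class ?C ?S \<one>\<^bsub>?C\<^esub> (cls X s) \<in> carrier (local_ring_at X x)"
        unfolding loc[symmetric] by (rule M.frac_class_closed) (use sS in auto)
      have 3: "germ X x s \<in> carrier (local_ring_at X x)"
        unfolding germ_def loc[symmetric] by (rule M.frac_class_closed) auto
      show ?thesis using 1 2 3 A.m_comm[OF 2 3] unfolding Units_def by auto
    qed
    show "\<exists>s. s \<notin> mx x \<and> s * (p - q) \<in> van X" if "germ X x p = germ X x q" for p q
    proof -
      have "\<exists>u\<in>?S. u \<otimes>\<^bsub>?C\<^esub> (cls X p \<otimes>\<^bsub>?C\<^esub> \<one>\<^bsub>?C\<^esub>) = u \<otimes>\<^bsub>?C\<^esub> (cls X q \<otimes>\<^bsub>?C\<^esub> \<one>\<^bsub>?C\<^esub>)"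
        using that unfolding germ_def by (subst (asm) M.frac_class_eq_iff) auto
      then obtain u where u: "u \<in> ?S" "u \<otimes>\<^bsub>?C\<^esub> cls X p = u \<otimes>\<^bsub>?C\<^esub> cls X q" by auto
      obtain s where s: "u = cls X s" using carrier_cls u(1) by blast
      have "cls X (s * p) = cls X (s * q)" using u(2) by (simp add: s cls_mult)
      then have "s * p - s * q \<in> van X" by (rule cls_eqD)
      then show ?thesis using S u(1) s by (auto simp: right_diff_distrib)
    qed
  qed
qed

section \<open>Derivations of the ring of polynomial functions and their flows\<close>

subsection \<open>Partial derivatives\<close>

lemma polyfun_has_derivative_exists:
  fixes p :: "'n::finite polyfun"
  shows "\<exists>g. \<forall>y. (ev p has_derivative (\<lambda>h. \<Sum>i\<in>UNIV. ev (g i) y * h $ i)) (at y)"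
proof (induction p rule: polyfun_induct)
  case (const c)
  have "ev (cst c :: 'n polyfun) = (\<lambda>_. c)" by auto
  then show ?case by (intro exI[of _ "\<lambda>_. 0"]) simp
next
  case (coord i)
  have "ev (crd i) = (\<lambda>y :: real ^ 'n. y $ i)" by auto
  moreover have "((\<lambda>y :: real ^ 'n. y $ i) has_derivative (\<lambda>h. h $ i)) (at y)" for y
    by (rule bounded_linear_imp_has_derivative[OF bounded_linear_vec_nth])
  moreover have "(\<Sum>j\<in>UNIV. ev (if j = i then 1 else 0) y * h $ j) = h $ i" for y h :: "real ^ 'n"
  proof -
    have "(\<Sum>j\<in>UNIV. ev (if j = i then 1 else 0) y * h $ j) = (\<Sum>j\<in>UNIV. if j = i then h $ j else 0)"
      by (intro sum.cong) auto
    then show ?thesis by simp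
  qed
  ultimately show ?case by (intro exI[of _ "\<lambda>j. if j = i then 1 else 0"]) simp
next
  case (add p q)
  then obtain g h where gh: "\<forall>y. (ev p has_derivative (\<lambda>v. \<Sum>i\<in>UNIV. ev (g i) y * v $ i)) (at y)"
    "\<forall>y. (ev q has_derivative (\<lambda>v. \<Sum>i\<in>UNIV. ev (h i) y * v $ i)) (at y)" by blast
  have "ev (p + q) = (\<lambda>y. ev p y + ev q y)" by auto
  moreover have "((\<lambda>y. ev p y + ev q y) has_derivative (\<lambda>v. (\<Sum>i\<in>UNIV. ev (g i) y * v $ i) + (\<Sum>i\<in>UNIV. ev (h i) y * v $ i))) (at y)" for y
    using gh by (intro has_derivative_add) auto
  ultimately show ?case
    by (intro exI[of _ "\<lambda>i. g i + h i"]) (simp add: sum.distrib distrib_right)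
next
  case (mult p q)
  then obtain g h where gh: "\<forall>y. (ev p has_derivative (\<lambda>v. \<Sum>i\<in>UNIV. ev (g i) y * v $ i)) (at y)"
    "\<forall>y. (ev q has_derivative (\<lambda>v. \<Sum>i\<in>UNIV. ev (h i) y * v $ i)) (at y)" by blast
  have "ev (p * q) = (\<lambda>y. ev p y * ev q y)" by auto
  moreover have "((\<lambda>y. ev p y * ev q y) has_derivative (\<lambda>v. ev p y * (\<Sum>i\<in>UNIV. ev (h i) y * v $ i) + (\<Sum>i\<in>UNIV. ev (g i) y * v $ i) * ev q y)) (at y)" for y
    using gh by (intro has_derivative_mult) auto
  ultimately show ?case
    by (intro exI[of _ "\<lambda>i. p * h i + q * g i"])
      (simp add: sum.distrib sum_distrib_left sum_distrib_right algebra_simps)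
qed

text \<open>Partial derivatives are chosen as elements of \<open>polyfun\<close>, since they must be
  available for further algebra; \<open>pd_eqI\<close> shows that the choice is unique.\<close>

definition pd :: "'n \<Rightarrow> ('n::finite) polyfun \<Rightarrow> 'n polyfun" where
  "pd i p = (SOME g. \<forall>y. (ev p has_derivative (\<lambda>h. \<Sum>i\<in>UNIV. ev (g i) y * h $ i)) (at y)) i"

lemma ev_has_derivative: "(ev p has_derivative (\<lambda>h. \<Sum>i\<in>UNIV. ev (pd i p) y * h $ i)) (at y)"
  unfolding pd_def using someI_ex[OF polyfun_has_derivative_exists[of p]] by blast

lemma pd_eqI:
  fixes p :: "'n::finite polyfun"
  assumes "\<And>y. (ev p has_derivative (\<lambda>h. \<Sum>i\<in>UNIV. ev (g i) y * h $ i)) (at y)"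
  shows "pd i p = g i"
proof (rule polyfun_eqI)
  fix y
  have "(\<lambda>h. \<Sum>i\<in>UNIV. ev (pd i p) y * h $ i) = (\<lambda>h. \<Sum>i\<in>UNIV. ev (g i) y * h $ i)"
    by (rule has_derivative_unique[OF ev_has_derivative assms])
  then have "(\<Sum>j\<in>UNIV. ev (pd j p) y * axis i 1 $ j) = (\<Sum>j\<in>UNIV. ev (g j) y * axis i 1 $ j)" by (rule fun_cong)
  then show "ev (pd i p) y = ev (g i) y" by (simp add: axis_def if_distrib[of "\<lambda>z. _ * z"] cong: if_cong)
qed

lemma pd_cst: "pd i (cst c :: 'n::finite polyfun) = 0"
proof -
  have "ev (cst c :: 'n polyfun) = (\<lambda>_. c)" by auto
  then show ?thesis by (intro pd_eqI[of _ "\<lambda>_. 0"]) simp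
qed

lemma pd_crd: "pd i (crd j :: 'n::finite polyfun) = (if i = j then 1 else 0)"
proof (rule pd_eqI[of _ "\<lambda>i. if i = j then 1 else 0"])
  fix y :: "real ^ 'n"
  have "(\<Sum>i\<in>UNIV. ev (if i = j then 1 else 0) y * h $ i) = h $ j" for h :: "real ^ 'n"
  proof -
    have "(\<Sum>i\<in>UNIV. ev (if i = j then 1 else 0) y * h $ i) = (\<Sum>i\<in>UNIV. if i = j then h $ i else 0)"
      by (intro sum.cong) auto
    then show ?thesis by simp
  qed
  moreover have "ev (crd j) = (\<lambda>y :: real ^ 'n. y $ j)" by auto
  ultimately show "(ev (crd j) has_derivative (\<lambda>h. \<Sum>i\<in>UNIV. ev (if i = j then 1 else 0) y * h $ i)) (at y)"
    using bounded_linear_imp_has_derivative[OF bounded_linear_vec_nth] by simp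
qed

lemma pd_add: "pd i (p + q) = pd i p + pd i q"
proof (rule pd_eqI[of _ "\<lambda>i. pd i p + pd i q"])
  fix y
  have "ev (p + q) = (\<lambda>y. ev p y + ev q y)" by auto
  moreover have "((\<lambda>y. ev p y + ev q y) has_derivative (\<lambda>v. (\<Sum>i\<in>UNIV. ev (pd i p) y * v $ i) + (\<Sum>i\<in>UNIV. ev (pd i q) y * v $ i))) (at y)"
    by (intro has_derivative_add ev_has_derivative)
  ultimately show "(ev (p + q) has_derivative (\<lambda>h. \<Sum>i\<in>UNIV. ev (pd i p + pd i q) y * h $ i)) (at y)"
    by (simp add: sum.distrib distrib_right)
qed

lemma pd_mult: "pd i (p * q) = p * pd i q + q * pd i p"
proof (rule pd_eqI[of _ "\<lambda>i. p * pd i q + q * pd i p"])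
  fix y
  have "ev (p * q) = (\<lambda>y. ev p y * ev q y)" by auto
  moreover have "((\<lambda>y. ev p y * ev q y) has_derivative (\<lambda>v. ev p y * (\<Sum>i\<in>UNIV. ev (pd i q) y * v $ i) + (\<Sum>i\<in>UNIV. ev (pd i p) y * v $ i) * ev q y)) (at y)"
    by (intro has_derivative_mult ev_has_derivative)
  ultimately show "(ev (p * q) has_derivative (\<lambda>h. \<Sum>i\<in>UNIV. ev (p * pd i q + q * pd i p) y * h $ i)) (at y)"
    by (simp add: sum.distrib sum_distrib_left sum_distrib_right algebra_simps)
qed

lemma taylor1:
  fixes p :: "'n::finite polyfun"
  shows "\<exists>h\<in>ipow (mx x) 2. p = cst (ev p x) + (\<Sum>i\<in>UNIV. cst (ev (pd i p) x) * (crd i - cst (x $ i))) + h"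
proof (induction p rule: polyfun_induct)
  case (const c)
  then show ?case
    using rmod.subspace_0[OF ideal_ipow[of "mx x" 2]] by (intro bexI[of _ 0]) (auto simp: pd_cst cst_simps)
next
  case (coord j)
  have "(\<Sum>i\<in>UNIV. cst (ev (pd i (crd j)) x) * (crd i - cst (x $ i))) = (\<Sum>i\<in>UNIV. if i = j then crd i - cst (x $ i) else 0)"
    by (intro sum.cong) (auto simp: pd_crd cst_simps)
  then show ?case
    using rmod.subspace_0[OF ideal_ipow[of "mx x" 2]] by (intro bexI[of _ 0]) auto
next
  case (add p q)
  then obtain h k where hk: "h \<in> ipow (mx x) 2" "k \<in> ipow (mx x) 2"
    "p = cst (ev p x) + (\<Sum>i\<in>UNIV. cst (ev (pd i p) x) * (crd i - cst (x $ i))) + h"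
    "q = cst (ev q x) + (\<Sum>i\<in>UNIV. cst (ev (pd i q) x) * (crd i - cst (x $ i))) + k" by blast
  show ?case
  proof (intro bexI)
    show "h + k \<in> ipow (mx x) 2" using hk by (intro rmod.subspace_add ideal_ipow)
    have "p + q = (cst (ev p x) + (\<Sum>i\<in>UNIV. cst (ev (pd i p) x) * (crd i - cst (x $ i))) + h)
       + (cst (ev q x) + (\<Sum>i\<in>UNIV. cst (ev (pd i q) x) * (crd i - cst (x $ i))) + k)"
      using hk(3,4) by simp
    also have "\<dots> = cst (ev (p + q) x) + (\<Sum>i\<in>UNIV. cst (ev (pd i (p + q)) x) * (crd i - cst (x $ i))) + (h + k)"
      by (simp add: pd_add cst_simps distrib_right sum.distrib)
    finally show "p + q = cst (ev (p + q) x) + (\<Sum>i\<in>UNIV. cst (ev (pd i (p + q)) x) * (crd i - cst (x $ i))) + (h + k)" .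
  qed
next
  case (mult p q)
  define L where "L r = (\<Sum>i\<in>UNIV. cst (ev (pd i r) x) * (crd i - cst (x $ i)))" for r :: "'n polyfun"
  obtain h k where hk: "h \<in> ipow (mx x) 2" "k \<in> ipow (mx x) 2"
    "p = cst (ev p x) + L p + h" "q = cst (ev q x) + L q + k" using mult unfolding L_def by blast
  have Lmx: "L r \<in> mx x" for r by (simp add: L_def mx_iff)
  have "L p * L q \<in> ipow (mx x) (Suc 1)"
    using Lmx ipow_1[OF ideal_van[of "{x}"]] by (intro ipow_SucI) auto
  then have LL: "L p * L q \<in> ipow (mx x) 2" by (simp add: numeral_2_eq_2)
  have Lpq: "L (p * q) = cst (ev p x) * L q + cst (ev q x) * L p"
    unfolding L_def by (simp add: pd_mult cst_simps distrib_right sum.distrib sum_distrib_left mult.assoc)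
  let ?r = "L p * L q + (h * q + (cst (ev p x) + L p) * k)"
  show ?case
  proof (intro bexI)
    show "?r \<in> ipow (mx x) 2"
      by (intro rmod.subspace_add[OF ideal_ipow] LL ideal_mult_right[OF ideal_ipow hk(1)] ideal_mult_left[OF ideal_ipow hk(2)])
    have "p * q = (cst (ev p x) + L p + h) * q" using hk(3) by simp
    also have "\<dots> = (cst (ev p x) + L p) * (cst (ev q x) + L q + k) + h * q"
      using hk(4) by (simp add: distrib_right)
    also have "\<dots> = cst (ev (p * q) x) + L (p * q) + ?r"
      unfolding Lpq by (simp add: cst_simps algebra_simps)
    finally show "p * q = cst (ev (p * q) x) + (\<Sum>i\<in>UNIV. cst (ev (pd i (p * q)) x) * (crd i - cst (x $ i))) + ?r"
      unfolding L_def .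
  qed
qed

notation fps_nth (infixl "$$" 75)

subsection \<open>Taylor series along a derivation\<close>

locale derivation =
  fixes W :: "'n::finite polyfun \<Rightarrow> 'n polyfun"
  assumes W_add: "W (p + q) = W p + W q"
    and W_mult: "W (p * q) = p * W q + q * W p"
    and W_cst: "W (cst c) = 0"
begin

lemma W_coords: "W p = (\<Sum>i\<in>UNIV. pd i p * W (crd i))"
proof (induction p rule: polyfun_induct)
  case (coord j)
  have "(\<Sum>i\<in>UNIV. pd i (crd j) * W (crd i)) = (\<Sum>i\<in>UNIV. if i = j then W (crd i) else 0)"
    by (intro sum.cong) (auto simp: pd_crd)
  then show ?case by simp
next
  case (add p q)
  then show ?case by (simp add: W_add pd_add distrib_right sum.distrib)
next
  case (mult p q)
  then show ?case by (simp add: W_mult pd_mult distrib_right sum.distrib sum_distrib_left mult.assoc)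
qed (simp add: W_cst pd_cst)

text \<open>The Taylor series at \<open>t = 0\<close> of \<open>p\<close> along the integral curve of \<open>W\<close> through \<open>x\<close>.\<close>

definition tay :: "real ^ 'n \<Rightarrow> 'n polyfun \<Rightarrow> real fps" where
  "tay x p = Abs_fps (\<lambda>n. ev ((W ^^ n) p) x / fact n)"

lemma tay_0: "tay x p $$ 0 = ev p x"
  by (simp add: tay_def)

lemma tay_Suc: "of_nat (Suc n) * tay x p $$ Suc n = tay x (W p) $$ n"
proof -
  have "(W ^^ Suc n) p = (W ^^ n) (W p)" by (simp add: funpow_swap1)
  then show ?thesis by (simp add: tay_def fact_num_eq_if del: funpow.simps of_nat_Suc)
qed

lemma tay_1: "tay x p $$ Suc 0 = ev (W p) x"
  using tay_Suc[of 0 x p] by (simp add: tay_0)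

lemma deriv_tay: "fps_deriv (tay x p) = tay x (W p)"
  using tay_Suc by (intro fps_ext) (simp add: fps_deriv_nth)

lemma tay_cst: "tay x (cst c) = fps_const c"
proof -
  have "tay x 0 = 0"
  proof (rule fps_ext)
    have "(W ^^ n) 0 = 0" for n using W_cst[of 0] by (induction n) (auto simp: cst_simps)
    then show "tay x 0 $$ n = 0 $$ n" for n by (simp add: tay_def)
  qed
  then have "fps_deriv (tay x (cst c)) = 0" by (simp add: deriv_tay W_cst)
  then have "tay x (cst c) = fps_const (tay x (cst c) $$ 0)" by (simp add: fps_deriv_eq_0_iff)
  then show ?thesis by (simp add: tay_0)
qed

lemma tay_zero: "tay x 0 = 0"
  using tay_cst[of x 0] by (simp add: cst_simps)

lemma tay_add: "tay x (p + q) = tay x p + tay x q"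
proof (rule fps_ext)
  have "(W ^^ n) (p + q) = (W ^^ n) p + (W ^^ n) q" for n by (induction n) (auto simp: W_add)
  then show "tay x (p + q) $$ n = (tay x p + tay x q) $$ n" for n by (simp add: tay_def add_divide_distrib)
qed

text \<open>The Leibniz rules for \<open>W\<close> and for the derivative of series give both sides
  the same recursion on coefficients.\<close>

lemma tay_mult: "tay x (p * q) = tay x p * tay x q"
proof (rule fps_ext)
  fix n
  show "tay x (p * q) $$ n = (tay x p * tay x q) $$ n"
  proof (induction n arbitrary: p q)
    case 0
    then show ?case by (simp add: tay_0)
  next
    case (Suc n)
    have "of_nat (Suc n) * tay x (p * q) $$ Suc n = tay x (p * W q + q * W p) $$ n"
      by (simp only: tay_Suc W_mult)
    also have "\<dots> = (tay x p * tay x (W q) + tay x q * tay x (W p)) $$ n"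
      by (simp only: tay_add fps_add_nth Suc.IH)
    also have "\<dots> = fps_deriv (tay x p * tay x q) $$ n"
      by (simp add: deriv_tay[symmetric] mult.commute)
    also have "\<dots> = of_nat (Suc n) * (tay x p * tay x q) $$ Suc n" by (simp only: fps_deriv_nth Suc_eq_plus1)
    finally show ?case by (simp del: of_nat_Suc)
  qed
qed

lemma tay_diff: "tay x (p - q) = tay x p - tay x q"
  using tay_add[of x "p - q" q] by simp

lemma tay_eq_0:
  assumes "W p = 0" "ev p x = 0"
  shows "tay x p = 0"
proof -
  have "fps_deriv (tay x p) = 0" by (simp add: deriv_tay assms tay_zero)
  then have "tay x p = fps_const (tay x p $$ 0)" by (simp add: fps_deriv_eq_0_iff)
  then show ?thesis using assms by (simp add: tay_0)
qed

lemma tay_ipow: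
  assumes "p \<in> ipow (mx x) m" "n < m"
  shows "tay x p $$ n = 0"
  using assms
proof (induction m arbitrary: p n)
  case (Suc m)
  have sub: "rmod.subspace {p. \<forall>n<k. tay x p $$ n = 0}" for k
    by (intro rmod.subspaceI) (auto simp: tay_zero tay_add tay_mult fps_mult_nth)
  have "ipow (mx x) (Suc m) \<subseteq> {p. \<forall>n<Suc m. tay x p $$ n = 0}"
  proof (rule ipow_Suc_least[OF sub])
    fix a b assume ab: "a \<in> mx x" "b \<in> ipow (mx x) m"
    have "tay x a $$ i * tay x b $$ (n - i) = 0" if "n < Suc m" "i \<le> n" for n i
      using ab that Suc.IH[OF ab(2), of "n - i"] by (cases i) (auto simp: tay_0 mx_iff)
    then have "(\<Sum>i = 0..n. tay x a $$ i * tay x b $$ (n - i)) = 0" if "n < Suc m" for n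
      using that by (intro sum.neutral) auto
    then show "a * b \<in> {p. \<forall>n<Suc m. tay x p $$ n = 0}" by (simp add: tay_mult fps_mult_nth)
  qed
  then show ?case using Suc.prems by blast
qed simp

end

subsection \<open>Convergence\<close>

text \<open>\<open>bnd e B p\<close>: \<open>p\<close> can be written with degree at most \<open>e\<close> and sum of absolute coefficients
  at most \<open>B\<close>.\<close>

inductive bnd :: "nat \<Rightarrow> real \<Rightarrow> ('n::finite) polyfun \<Rightarrow> bool" where
  bnd_cst: "\<bar>c\<bar> \<le> B \<Longrightarrow> bnd e B (cst c)"
| bnd_crd: "bnd e B p \<Longrightarrow> bnd (Suc e) B (crd i * p)"
| bnd_add: "bnd e B p \<Longrightarrow> bnd e B' q \<Longrightarrow> bnd e (B + B') (p + q)"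

lemma bnd_nonneg: "bnd e B p \<Longrightarrow> 0 \<le> B"
  by (induction rule: bnd.induct) auto

lemma bnd_mono: "bnd e B p \<Longrightarrow> e \<le> e' \<Longrightarrow> B \<le> B' \<Longrightarrow> bnd e' B' p"
proof (induction arbitrary: e' B' rule: bnd.induct)
  case (bnd_cst c B e)
  then show ?case by (intro bnd.bnd_cst) auto
next
  case (bnd_crd e B p i)
  obtain e'' where "e' = Suc e''" "e \<le> e''" using bnd_crd.prems Suc_le_D by blast
  then show ?case using bnd_crd by (auto intro: bnd.bnd_crd)
next
  case (bnd_add e B p B2 q)
  have "bnd e' (B' - B2) p" "bnd e' B2 q" using bnd_add by auto
  from bnd.bnd_add[OF this] show ?case by simp
qed

lemma bnd_scale: "bnd e B p \<Longrightarrow> bnd e (\<bar>c\<bar> * B) (cst c * p)"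
proof (induction rule: bnd.induct)
  case (bnd_cst d B e)
  then show ?case using mult_left_mono[OF bnd_cst, of "\<bar>c\<bar>"]
    by (auto simp: cst_simps[symmetric] abs_mult intro!: bnd.bnd_cst)
next
  case (bnd_crd e B p i)
  then show ?case using bnd.bnd_crd[of e "\<bar>c\<bar> * B" "cst c * p" i] by (simp add: mult.left_commute)
next
  case (bnd_add e B p B' q)
  then show ?case using bnd.bnd_add[of e "\<bar>c\<bar> * B" "cst c * p" "\<bar>c\<bar> * B'" "cst c * q"] by (simp add: distrib_left)
qed

lemma bnd_mult: "bnd e B p \<Longrightarrow> bnd e' B' q \<Longrightarrow> bnd (e + e') (B * B') (p * q)"
proof (induction rule: bnd.induct)
  case (bnd_cst c B e)
  have "bnd e' (\<bar>c\<bar> * B') (cst c * q)" by (rule bnd_scale) fact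
  then show ?case using bnd_cst bnd_nonneg[OF bnd_cst(2)] by (rule_tac bnd_mono) (auto intro: mult_right_mono)
next
  case (bnd_crd e B p i)
  then show ?case using bnd.bnd_crd[of "e + e'" "B * B'" "p * q" i] by (simp add: mult.assoc)
next
  case (bnd_add e B p B2 q2)
  then show ?case using bnd.bnd_add[of "e + e'" "B * B'" "p * q" "B2 * B'" "q2 * q"] by (simp add: distrib_right)
qed

lemma bnd_crd1: "bnd 1 1 (crd i)"
  using bnd_crd[OF bnd_cst[of 1 1 0], of i] by (simp add: cst_simps)

lemma bnd_exists: "\<exists>e B. bnd e B (p :: 'n::finite polyfun)"
proof (induction p rule: polyfun_induct)
  case (add p q)
  then obtain e B e' B' where "bnd e B p" "bnd e' B' q" by blast
  then have "bnd (max e e') B p" "bnd (max e e') B' q" using bnd_mono by (metis max.cobounded1 max.cobounded2 order_refl)+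
  then show ?case using bnd_add by blast
qed (use bnd_cst bnd_crd1 bnd_mult in blast)+

lemma bnd_eval:
  assumes "bnd e B p" "1 \<le> R" "\<And>i. \<bar>y $ i\<bar> \<le> R"
  shows "\<bar>ev p y\<bar> \<le> B * R ^ e"
  using assms(1)
proof (induction rule: bnd.induct)
  case (bnd_cst c B e)
  have "B * 1 \<le> B * R ^ e" using bnd_cst assms(2) by (intro mult_left_mono) (auto simp: one_le_power)
  then show ?case using bnd_cst by simp
next
  case (bnd_crd e B p i)
  have "\<bar>y $ i\<bar> * \<bar>ev p y\<bar> \<le> R * (B * R ^ e)" using bnd_crd assms by (intro mult_mono) auto
  then show ?case by (simp add: abs_mult mult_ac)
next
  case (bnd_add e B p B' q)
  then show ?case using abs_triangle_ineq[of "ev p y" "ev q y"] by (simp add: distrib_right)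
qed

context derivation begin

lemma bnd_W:
  assumes K: "\<And>i. bnd \<delta> K (W (crd i))" and "bnd e B p"
  shows "bnd (e + \<delta>) (real e * K * B) (W p)"
  using assms(2)
proof (induction rule: bnd.induct)
  case (bnd_cst c B e)
  have "0 \<le> B" "0 \<le> K" using bnd_cst bnd_nonneg[OF K] by auto
  then have "bnd (e + \<delta>) (real e * K * B) (cst 0)" by (intro bnd.bnd_cst) auto
  then show ?case by (simp add: W_cst cst_simps)
next
  case (bnd_crd e B p i)
  have "bnd (Suc (e + \<delta>)) (real e * K * B) (crd i * W p)" using bnd_crd by (intro bnd.bnd_crd)
  moreover have "bnd (Suc (e + \<delta>)) (B * K) (p * W (crd i))"
    by (rule bnd_mono[OF bnd_mult[OF bnd_crd(1) K]]) auto
  ultimately have "bnd (Suc (e + \<delta>)) (real e * K * B + B * K) (crd i * W p + p * W (crd i))" by (rule bnd.bnd_add)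
  then show ?case by (simp add: W_mult algebra_simps)
next
  case (bnd_add e B p B' q)
  then show ?case using bnd.bnd_add[of "e + \<delta>" "real e * K * B" "W p" "real e * K * B'" "W q"]
    by (simp add: W_add distrib_left)
qed

text \<open>Each application of \<open>W\<close> adds at most \<open>\<delta>\<close> to the degree
  and multiplies the coefficient sum by at most the degree times \<open>K\<close>. The degrees
  \<open>1 + m * \<delta>\<close> for \<open>m < n\<close> have product at most
  \<open>fact n * (\<delta> + 1) ^ n\<close>, and the factorial cancels in \<open>tay\<close>,
  leaving geometric growth.\<close>

lemma bnd_W_iter:
  assumes K: "\<And>i. bnd \<delta> K (W (crd i))"
  shows "bnd (1 + n * \<delta>) (fact n * (K * real (\<delta> + 1)) ^ n) ((W ^^ n) (crd i))"
proof (induction n)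
  case 0
  then show ?case using bnd_crd1 by simp
next
  case (Suc n)
  have K0: "0 \<le> K" using bnd_nonneg[OF K] .
  have "bnd ((1 + n * \<delta>) + \<delta>) (real (1 + n * \<delta>) * K * (fact n * (K * real (\<delta> + 1)) ^ n)) (W ((W ^^ n) (crd i)))"
    by (rule bnd_W[OF K Suc.IH])
  then show ?case
    unfolding funpow.simps(2) comp_apply
  proof (rule bnd_mono)
    define c where "c = K * (fact n * (K * real (\<delta> + 1)) ^ n)"
    have "real (1 + n * \<delta>) \<le> real (Suc n * (\<delta> + 1))" by (intro of_nat_mono) simp
    then have "real (1 + n * \<delta>) * c \<le> real (Suc n * (\<delta> + 1)) * c"
      using K0 by (intro mult_right_mono) (auto simp: c_def)
    also have "\<dots> = fact (Suc n) * (K * real (\<delta> + 1)) ^ Suc n"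
      unfolding c_def of_nat_mult fact_Suc power_Suc by (simp only: mult_ac)
    finally show "real (1 + n * \<delta>) * K * (fact n * (K * real (\<delta> + 1)) ^ n) \<le> fact (Suc n) * (K * real (\<delta> + 1)) ^ Suc n"
      by (simp add: c_def mult.assoc)
  qed (simp_all)
qed

lemma tay_crd_bound: "\<exists>C D. 0 \<le> C \<and> (\<forall>i n. \<bar>tay x (crd i) $$ n\<bar> \<le> D * C ^ n)"
proof -
  have "\<forall>i. \<exists>e B. bnd e B (W (crd i))" using bnd_exists by blast
  then obtain e B where eB: "\<And>i. bnd (e i) (B i) (W (crd i))" by metis
  define \<delta> where "\<delta> = (\<Sum>i\<in>UNIV. e i)"
  define K where "K = (\<Sum>i\<in>UNIV. B i)"
  have K: "bnd \<delta> K (W (crd i))" for i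
  proof (rule bnd_mono[OF eB])
    show "e i \<le> \<delta>" unfolding \<delta>_def by (rule member_le_sum) auto
    show "B i \<le> K" unfolding K_def using bnd_nonneg[OF eB] by (intro member_le_sum) auto
  qed
  define R where "R = 1 + norm x"
  have R: "1 \<le> R" "\<bar>x $ i\<bar> \<le> R" for i
    using component_le_norm_cart[of x i] by (auto simp: R_def)
  define C where "C = K * real (\<delta> + 1) * R ^ \<delta>"
  have "\<bar>tay x (crd i) $$ n\<bar> \<le> R * C ^ n" for i n
  proof -
    have "\<bar>ev ((W ^^ n) (crd i)) x\<bar> \<le> fact n * (K * real (\<delta> + 1)) ^ n * R ^ (1 + n * \<delta>)"
      by (rule bnd_eval[OF bnd_W_iter[OF K] R])
    also have "\<dots> = fact n * (R * C ^ n)"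
      by (simp add: C_def power_mult_distrib power_mult[symmetric] mult.commute[of n] mult_ac)
    finally show ?thesis by (simp add: tay_def divide_le_eq mult.commute)
  qed
  moreover have "0 \<le> C" using bnd_nonneg[OF K] R by (simp add: C_def)
  ultimately show ?thesis by blast
qed

definition flow :: "real ^ 'n \<Rightarrow> real \<Rightarrow> real ^ 'n" where
  "flow x t = (\<chi> i. \<Sum>n. tay x (crd i) $$ n * t ^ n)"

text \<open>Convergence is established for the coordinates, and multiplicativity of
  \<open>tay\<close> carries the expansion to all polynomial functions with one common
  radius.\<close>

lemma flow_sums: "\<exists>\<tau>>0. \<forall>p t. \<bar>t\<bar> < \<tau> \<longrightarrow> (\<lambda>n. tay x p $$ n * t ^ n) sums ev p (flow x t)"
proof -
  obtain C D where C: "0 \<le> C" "\<And>i n. \<bar>tay x (crd i) $$ n\<bar> \<le> D * C ^ n" using tay_crd_bound by blast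
  \<comment> \<open>The denominator \<open>C + 1\<close> covers the case \<open>C = 0\<close> and
    ensures \<open>C * \<bar>t\<bar> < 1\<close>.\<close>
  define \<tau> where "\<tau> = 1 / (C + 1)"
  have "0 < \<tau>" using C by (simp add: \<tau>_def)
  have "(\<lambda>n. tay x p $$ n * t ^ n) sums ev p (flow x t)" if "\<bar>t\<bar> < \<tau>" for p t
    using that
  proof (induction p arbitrary: t rule: polyfun_induct)
    case (const c)
    have "(\<lambda>n. if n = 0 then c else 0) sums c" by (rule sums_single)
    moreover have "(\<lambda>n. if n = 0 then c else 0) = (\<lambda>n. tay x (cst c) $$ n * t ^ n)" by (auto simp: tay_cst)
    ultimately show ?case by simp
  next
    case (coord i)
    have "C * \<bar>t\<bar> \<le> C * \<tau>" using C coord by (intro mult_left_mono) auto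
    also have "\<dots> < 1" using C by (simp add: \<tau>_def field_simps)
    finally have "C * \<bar>t\<bar> < 1" .
    then have "summable (\<lambda>n. D * (C * \<bar>t\<bar>) ^ n)" using C by (intro summable_mult summable_geometric) simp
    then have "summable (\<lambda>n. tay x (crd i) $$ n * t ^ n)"
    proof (rule summable_comparison_test'[of _ 0])
      fix n
      have "\<bar>tay x (crd i) $$ n\<bar> * \<bar>t\<bar> ^ n \<le> D * C ^ n * \<bar>t\<bar> ^ n" using C by (intro mult_right_mono) auto
      then show "norm (tay x (crd i) $$ n * t ^ n) \<le> D * (C * \<bar>t\<bar>) ^ n"
        by (simp add: abs_mult power_abs power_mult_distrib mult.assoc)
    qed
    then show ?case by (simp add: flow_def summable_sums)
  next
    case (add p q)
    then show ?case using sums_add[of "\<lambda>n. tay x p $$ n * t ^ n" _ "\<lambda>n. tay x q $$ n * t ^ n"]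
      by (simp add: tay_add distrib_right)
  next
    case (mult p q)
    \<comment> \<open>Convergence at the larger radius \<open>s\<close> gives absolute convergence
      at \<open>t\<close>, as the Cauchy product requires.\<close>
    obtain s where s: "\<bar>t\<bar> < s" "s < \<tau>" using mult.prems dense by blast
    have s': "\<bar>s\<bar> < \<tau>" "norm t < norm s" using s by auto
    have "summable (\<lambda>n. norm (tay x p $$ n * t ^ n))" "summable (\<lambda>n. norm (tay x q $$ n * t ^ n))"
      by (rule powser_insidea[OF sums_summable[OF mult.IH(1)[OF s'(1)]] s'(2)]
        powser_insidea[OF sums_summable[OF mult.IH(2)[OF s'(1)]] s'(2)])+
    from Cauchy_product_sums[OF this]
    have "(\<lambda>k. \<Sum>i\<le>k. tay x p $$ i * t ^ i * (tay x q $$ (k - i) * t ^ (k - i))) sums (ev p (flow x t) * ev q (flow x t))"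
      using sums_unique[OF mult.IH(1)[OF mult.prems]] sums_unique[OF mult.IH(2)[OF mult.prems]] by simp
    moreover have "(\<Sum>i\<le>k. tay x p $$ i * t ^ i * (tay x q $$ (k - i) * t ^ (k - i))) = tay x (p * q) $$ k * t ^ k" for k
    proof -
      have "(\<Sum>i\<le>k. tay x p $$ i * t ^ i * (tay x q $$ (k - i) * t ^ (k - i))) = (\<Sum>i\<le>k. tay x p $$ i * tay x q $$ (k - i) * t ^ k)"
        by (intro sum.cong) (auto simp: power_add[symmetric] mult_ac simp flip: power_add)
      then show ?thesis by (simp add: tay_mult fps_mult_nth sum_distrib_right atLeast0AtMost)
    qed
    ultimately show ?case by simp
  qed
  then show ?thesis using \<open>0 < \<tau>\<close> by blast
qed

lemma flow_order:
  assumes "\<And>n. n < m \<Longrightarrow> tay x p $$ n = 0"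
  shows "((\<lambda>t. ev p (flow x t) / t ^ m) \<longlongrightarrow> tay x p $$ m) (at 0)"
proof -
  obtain \<tau> where \<tau>: "0 < \<tau>" "\<And>t. \<bar>t\<bar> < \<tau> \<Longrightarrow> (\<lambda>n. tay x p $$ n * t ^ n) sums ev p (flow x t)"
    using flow_sums by blast
  \<comment> \<open>The quotient extended to \<open>t = 0\<close> by the constant term of the
    shifted series.\<close>
  define g where "g t = (if t = 0 then tay x p $$ m else ev p (flow x t) / t ^ m)" for t
  have "(\<lambda>n. tay x p $$ (n + m) * t ^ n) sums g t" if "norm t < \<tau>" for t
  proof (cases "t = 0")
    case True
    have "(\<lambda>n. tay x p $$ (n + m) * 0 ^ n) sums (tay x p $$ (0 + m))"
      by (rule powser_sums_zero)
    then show ?thesis by (simp add: True g_def)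
  next
    case False
    have "(\<lambda>n. tay x p $$ (n + m) * t ^ (n + m)) sums (ev p (flow x t) - (\<Sum>i<m. tay x p $$ i * t ^ i))"
      using \<tau>(2)[of t] that by (intro sums_split_initial_segment) simp
    then have "(\<lambda>n. tay x p $$ (n + m) * t ^ (n + m) / t ^ m) sums (ev p (flow x t) / t ^ m)"
      using assms by (intro sums_divide) simp
    moreover have "tay x p $$ (n + m) * t ^ (n + m) / t ^ m = tay x p $$ (n + m) * t ^ n" for n
      using False by (simp add: power_add)
    ultimately show ?thesis using False by (simp add: g_def)
  qed
  then have "(g \<longlongrightarrow> tay x p $$ (0 + m)) (at 0)" by (rule powser_limit_0[OF \<tau>(1), of "\<lambda>n. tay x p $$ (n + m)"])
  then have "(g \<longlongrightarrow> tay x p $$ m) (at 0)" by simp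
  then show ?thesis by (rule Lim_transform_eventually) (auto simp: eventually_at_filter g_def)
qed

end

section \<open>Adapted coordinates at a regular point\<close>

definition grad :: "('n::finite) polyfun \<Rightarrow> real ^ 'n \<Rightarrow> real ^ 'n" where
  "grad p x = (\<chi> i. ev (pd i p) x)"

lemma grad_add: "grad (p + q) x = grad p x + grad q x"
  by (simp add: grad_def pd_add vec_eq_iff)

lemma grad_mult: "grad (p * q) x = ev p x *\<^sub>R grad q x + ev q x *\<^sub>R grad p x"
  by (simp add: grad_def pd_mult vec_eq_iff)

lemma grad_cst: "grad (cst c) x = 0"
  by (simp add: grad_def pd_cst vec_eq_iff)

lemma grad_sum: "grad (sum f A) x = (\<Sum>i\<in>A. grad (f i) x)"
  by (induction A rule: infinite_finite_induct) (use grad_cst[of 0 x] in \<open>auto simp: grad_add cst_simps\<close>)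

lemma grad_zero_ipow:
  assumes "ev p x = 0" "grad p x = 0"
  shows "p \<in> ipow (mx x) 2"
proof -
  obtain h where h: "h \<in> ipow (mx x) 2"
    "p = cst (ev p x) + (\<Sum>i\<in>UNIV. cst (ev (pd i p) x) * (crd i - cst (x $ i))) + h"
    using taylor1 by blast
  have "ev (pd i p) x = 0" for i using assms(2) by (simp add: grad_def vec_eq_iff)
  then have "p = h" using h(2) assms(1) by (simp add: cst_simps)
  then show ?thesis using h(1) by simp
qed

lemma grad_shift: "grad (crd i - cst c) y = axis i 1"
proof -
  have "grad (crd i - cst c + cst c) y = grad (crd i - cst c) y" by (simp only: grad_add grad_cst add_0_right)
  moreover have "grad (crd i) y = axis i 1" by (simp add: grad_def pd_crd vec_eq_iff axis_def)
  ultimately show ?thesis by simp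
qed

definition linpoly :: "real ^ 'n \<Rightarrow> real ^ 'n \<Rightarrow> ('n::finite) polyfun" where
  "linpoly x c = (\<Sum>i\<in>UNIV. cst (c $ i) * (crd i - cst (x $ i)))"

lemma ev_linpoly: "ev (linpoly x c) y = (\<Sum>i\<in>UNIV. c $ i * (y $ i - x $ i))"
  by (simp add: linpoly_def)

lemma grad_linpoly: "grad (linpoly x c) y = c"
proof -
  have "grad (cst a * (crd i - cst b)) y = a *\<^sub>R axis i 1" for a b i
    by (simp add: grad_mult grad_cst grad_shift)
  then have "grad (linpoly x c) y = (\<Sum>i\<in>UNIV. c $ i *\<^sub>R axis i 1)" by (simp add: linpoly_def grad_sum)
  then show ?thesis using basis_expansion[of c] by (simp add: scalar_mult_eq_scaleR)
qed

text \<open>It suffices to generate the maximal ideal modulo its square. The set \<open>H\<close>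
  describes the square with coefficients in \<open>mx x\<close> on fixed generators, the form in
  which Nakayama's lemma is stated.\<close>

lemma local_nakayama_mx:
  fixes K :: "'n::finite polyfun set"
  assumes K: "rmod.subspace K" and "\<And>p. p \<in> mx x \<Longrightarrow> \<exists>k\<in>K. \<exists>h\<in>ipow (mx x) 2. p = k + h"
  shows "mx x \<subseteq> sat (mx x) K"
proof -
  obtain F where F: "finite F" "F \<subseteq> mx x" "mx x = rmod.span F" using ideal_finite_span[OF ideal_van] .
  have one: "1 \<notin> mx x" by (simp add: mx_iff)
  define H where "H = {\<Sum>g\<in>F. c g * g | c. \<forall>g\<in>F. c g \<in> mx x}"
  have "ipow (mx x) (Suc (Suc 0)) \<subseteq> H"
  proof (rule ipow_Suc_least)
    show "rmod.subspace H"
    proof (rule rmod.subspaceI)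
      show "0 \<in> H" unfolding H_def by (intro CollectI exI[of _ "\<lambda>_. 0"]) (simp add: mx_iff)
      fix p q assume "p \<in> H" "q \<in> H"
      then obtain c e where ce: "\<forall>g\<in>F. c g \<in> mx x" "p = (\<Sum>g\<in>F. c g * g)"
        "\<forall>g\<in>F. e g \<in> mx x" "q = (\<Sum>g\<in>F. e g * g)" unfolding H_def by blast
      have "p + q = (\<Sum>g\<in>F. (c g + e g) * g)" using ce by (simp add: distrib_right sum.distrib)
      moreover have "\<forall>g\<in>F. c g + e g \<in> mx x" using ce rmod.subspace_add[OF ideal_van] by blast
      ultimately show "p + q \<in> H" unfolding H_def by (intro CollectI exI[of _ "\<lambda>g. c g + e g"] conjI)
    next
      fix r p assume "p \<in> H"
      then obtain c where ce: "\<forall>g\<in>F. c g \<in> mx x" "p = (\<Sum>g\<in>F. c g * g)" unfolding H_def by blast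
      have "r * p = (\<Sum>g\<in>F. (r * c g) * g)" using ce by (simp add: sum_distrib_left mult.assoc)
      moreover have "\<forall>g\<in>F. r * c g \<in> mx x" using ce ideal_mult_left[OF ideal_van] by blast
      ultimately show "r * p \<in> H" unfolding H_def by (intro CollectI exI[of _ "\<lambda>g. r * c g"] conjI)
    qed
    fix a b assume a: "a \<in> mx x" and "b \<in> ipow (mx x) (Suc 0)"
    then have "b \<in> rmod.span F" using F ipow_1[OF ideal_van[of "{x}"]] by blast
    then obtain c where c: "b = (\<Sum>g\<in>F. c g * g)" using F(1) by (auto simp: rmod.span_finite)
    have "a * b = (\<Sum>g\<in>F. (a * c g) * g)" using c by (simp add: sum_distrib_left mult.assoc)
    moreover have "\<forall>g\<in>F. a * c g \<in> mx x" using ideal_mult_right[OF ideal_van a] by blast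
    ultimately show "a * b \<in> H" unfolding H_def by (intro CollectI exI[of _ "\<lambda>g. a * c g"] conjI)
  qed
  then have H: "ipow (mx x) 2 \<subseteq> H" by (simp add: numeral_2_eq_2)
  have "F \<subseteq> sat (mx x) K"
  proof (rule local_nakayama[OF prime_mx K F(1)])
    fix f assume "f \<in> F"
    then obtain k h where kh: "k \<in> K" "h \<in> H" "f = k + h" using assms(2)[of f] F(2) H by blast
    then obtain c where "\<forall>g\<in>F. c g \<in> mx x" "h = (\<Sum>g\<in>F. c g * g)" unfolding H_def by blast
    then show "\<exists>t z c. t \<notin> mx x \<and> z \<in> K \<and> (\<forall>g\<in>F. c g \<in> mx x) \<and> t * f = z + (\<Sum>g\<in>F. c g * g)"
      using kh one by (intro exI[of _ 1] exI[of _ k] exI[of _ c]) simp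
  qed
  then have "rmod.span F \<subseteq> sat (mx x) K" by (rule rmod.span_minimal[OF _ ideal_sat[OF prime_mx K]])
  then show ?thesis using F(3) by simp
qed

definition prime_chain_at :: "(real ^ 'n) set \<Rightarrow> real ^ 'n \<Rightarrow> nat \<Rightarrow> bool" where
  "prime_chain_at X x d \<longleftrightarrow> (\<exists>P :: nat \<Rightarrow> ('n::finite) polyfun set.
     (\<forall>i\<le>d. prime_id (P i) \<and> van X \<subseteq> P i \<and> P i \<subseteq> mx x) \<and> (\<forall>i<d. P i \<subset> P (Suc i)))"

lemma prime_chain_height:
  assumes "prime_chain_at X x (Suc n)" "finite U" "card U \<le> n" "U \<subseteq> mx x"
  shows "\<exists>Q. prime_id Q \<and> van X \<union> U \<subseteq> Q \<and> Q \<subset> mx x"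
proof -
  obtain P where P: "\<And>i. i \<le> Suc n \<Longrightarrow> prime_id (P i) \<and> van X \<subseteq> P i \<and> P i \<subseteq> mx x"
    "\<And>i. i < Suc n \<Longrightarrow> P i \<subset> P (Suc i)" using assms(1) unfolding prime_chain_at_def by blast
  show ?thesis
  proof (rule krull_height[of n P])
    show "prime_id (P i)" if "i \<le> n" for i using P(1)[of i] that by simp
    show "P i \<subset> P (Suc i)" if "i < n" for i using P(2)[of i] that by simp
    show "P n \<subset> mx x" using P(2)[of n] P(1)[of "Suc n"] by auto
    show "van X \<subseteq> P 0" using P(1)[of 0] by simp
  qed (rule prime_mx assms)+
qed

text \<open>Local coordinates \<open>b i\<close> at \<open>x\<close>: those with \<open>i \<notin> S\<close> vanish on \<open>X\<close>, the others parametrize it.\<close>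

locale coords =
  fixes X :: "(real ^ 'n::finite) set" and x :: "real ^ 'n" and b :: "'n \<Rightarrow> 'n polyfun" and S :: "'n set"
  assumes xX: "x \<in> X"
    and bx: "ev (b i) x = 0"
    and bV: "i \<notin> S \<Longrightarrow> b i \<in> van X"
    and indep: "det (\<chi> i. grad (b i) x) \<noteq> 0"

text \<open>A basis \<open>B0\<close> of the gradients at \<open>x\<close> of polynomials in
  \<open>van X\<close> is completed to a basis of the whole space. Vectors in \<open>B0\<close> are
  realized by equations of \<open>X\<close>, the others by linear forms indexed by \<open>S\<close>.
  The bound on \<open>S\<close> comes from the \<open>d\<close> local generators: their gradients
  together with \<open>B0\<close> span everything.\<close>

lemma coords_exist:
  assumes x: "x \<in> X" and reg: "regular_local_ring (local_ring_at X x) d"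
  shows "\<exists>b S. coords X x b S \<and> card S \<le> d"
proof -
  interpret L: localized_functions "local_ring_at X x" "germ X x" X x by (rule localized_functions_germ[OF x])
  obtain U where U: "finite U" "card U \<le> d" "U \<subseteq> mx x"
    "\<And>p. p \<in> mx x \<Longrightarrow> \<exists>s. s \<notin> mx x \<and> s * p \<in> rmod.span (U \<union> van X)"
    using L.regular_generators[OF reg] by blast
  define G where "G = (\<lambda>p. grad p x) ` van X"
  obtain B0 where B0: "B0 \<subseteq> G" "independent B0" "G \<subseteq> span B0" using maximal_independent_subset by blast
  obtain B1 where B1: "B0 \<subseteq> B1" "B1 \<subseteq> UNIV" "independent B1" "UNIV \<subseteq> span B1"
    by (rule maximal_independent_subset_extend[OF subset_UNIV B0(2)])
  have fB1: "finite B1" and cB1: "card B1 = CARD('a)"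
    using basis_card_eq_dim[OF B1(2,4,3)] independent_bound[OF B1(3)] by simp_all
  have "\<exists>e. bij_betw e (UNIV :: 'a set) B1" using fB1 cB1 by (subst bij_betw_iff_card) auto
  then obtain e where e: "bij_betw e (UNIV :: 'a set) B1" by blast
  define S where "S = {i. e i \<notin> B0}"
  define b where "b i = (if e i \<in> B0 then SOME p. p \<in> van X \<and> grad p x = e i else linpoly x (e i))" for i
  have bB0: "b i \<in> van X \<and> grad (b i) x = e i" if i: "e i \<in> B0" for i
  proof -
    have "\<exists>p. p \<in> van X \<and> grad p x = e i" using i B0(1) unfolding G_def by force
    from someI_ex[OF this] show ?thesis using i by (simp add: b_def)
  qed
  have gb: "grad (b i) x = e i" for i using bB0[of i] by (cases "e i \<in> B0") (auto simp: b_def grad_linpoly)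
  have "coords X x b S"
  proof
    show "x \<in> X" by fact
    show "ev (b i) x = 0" for i
      using bB0[of i] x by (cases "e i \<in> B0") (auto simp: van_def b_def ev_linpoly)
    show "b i \<in> van X" if "i \<notin> S" for i using that bB0 by (simp add: S_def)
    have "rows (\<chi> i. grad (b i) x) = range e"
      unfolding rows_def row_def by (auto simp: gb vec_lambda_eta)
    then have "rows (\<chi> i. grad (b i) x) = B1" using e by (simp add: bij_betw_def)
    then have "span (rows (\<chi> i. grad (b i) x)) = UNIV" using B1(4) by (simp add: top.extremum_unique)
    then have "\<exists>B. B ** (\<chi> i. grad (b i) x) = mat 1" by (rule matrix_left_invertible_span_rows[THEN iffD2])
    then have "invertible (\<chi> i. grad (b i) x)" by (rule invertible_left_inverse[THEN iffD2])
    then show "det (\<chi> i. grad (b i) x) \<noteq> 0" by (rule invertible_det_nz[THEN iffD1])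
  qed
  moreover have "card S \<le> d"
  proof -
    let ?B = "B0 \<union> (\<lambda>p. grad p x) ` U"
    have gspan: "ev q x = 0 \<and> grad q x \<in> span ?B" if "q \<in> rmod.span (U \<union> van X)" for q
    proof -
      have "rmod.span (U \<union> van X) \<subseteq> {q. ev q x = 0 \<and> grad q x \<in> span ?B}"
      proof (rule rmod.span_minimal)
        have "grad p x \<in> span ?B" if "p \<in> van X" for p
          using that B0(3) span_mono[of B0 ?B] by (auto simp: G_def)
        then show "U \<union> van X \<subseteq> {q. ev q x = 0 \<and> grad q x \<in> span ?B}"
          using U(3) x by (auto simp: mx_iff van_def intro: span_base)
        show "rmod.subspace {q. ev q x = 0 \<and> grad q x \<in> span ?B}"
          using grad_cst[of 0 x]
          by (intro rmod.subspaceI) (auto simp: cst_simps grad_add grad_mult intro: span_zero span_add span_scale)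
      qed
      then show ?thesis using that by blast
    qed
    have "axis j 1 \<in> span ?B" for j
    proof -
      have "crd j - cst (x $ j) \<in> mx x" by (simp add: mx_iff)
      then obtain s where s: "s \<notin> mx x" "s * (crd j - cst (x $ j)) \<in> rmod.span (U \<union> van X)" using U(4) by blast
      \<comment> \<open>Since \<open>crd j - cst (x $ j)\<close> vanishes at \<open>x\<close>, the
        gradient of the product is the nonzero number \<open>ev s x\<close> times the basis
        vector.\<close>
      have "grad (s * (crd j - cst (x $ j))) x \<in> span ?B" using gspan[OF s(2)] by blast
      then have "ev s x *\<^sub>R axis j 1 \<in> span ?B" by (simp add: grad_mult grad_shift)
      then have "inverse (ev s x) *\<^sub>R (ev s x *\<^sub>R axis j 1) \<in> span ?B" by (rule span_scale)
      then show ?thesis using s(1) by (simp add: mx_iff)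
    qed
    then have sp: "(\<Sum>i\<in>UNIV. c $ i *\<^sub>R axis i 1) \<in> span ?B" for c :: "real ^ 'a"
      by (intro span_sum span_scale)
    have "c \<in> span ?B" for c :: "real ^ 'a"
      using sp[of c] basis_expansion[of c] by (simp only: scalar_mult_eq_scaleR)
    then have "UNIV \<subseteq> span ?B" by blast
    moreover have fB: "finite ?B" using U(1) finite_subset[OF B1(1) fB1] by simp
    ultimately have "dim (UNIV :: (real ^ 'a) set) \<le> card ?B" by (rule dim_le_card)
    also have "\<dots> \<le> card B0 + card ((\<lambda>p. grad p x) ` U)" by (rule card_Un_le)
    also have "\<dots> \<le> card B0 + d" using card_image_le[OF U(1), of "\<lambda>p. grad p x"] U(2) by simp
    finally have "CARD('a) \<le> card B0 + d" by (simp add: dim_UNIV)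
    moreover have "card S = CARD('a) - card B0"
    proof -
      have "bij_betw e S (B1 - B0)" using e B1(1) unfolding S_def bij_betw_def inj_on_def by auto
      then have "card S = card (B1 - B0)" by (rule bij_betw_same_card)
      then show ?thesis using card_Diff_subset[OF finite_subset[OF B1(1) fB1] B1(1)] cB1 by simp
    qed
    ultimately show ?thesis by simp
  qed
  ultimately show ?thesis by blast
qed

context coords begin

lemma b_mx: "b i \<in> mx x"
  by (simp add: mx_iff bx)

lemma mx_decomp:
  assumes p: "p \<in> mx x"
  shows "\<exists>c h. h \<in> ipow (mx x) 2 \<and> p = (\<Sum>i\<in>UNIV. cst (c i) * b i) + h"
proof -
  define A where "A = transpose (\<chi> i. grad (b i) x)"
  have "invertible A" using indep by (simp add: A_def invertible_det_nz)
  then obtain A' where "A ** A' = mat 1" unfolding invertible_def by blast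
  then have "A *v (A' *v grad p x) = grad p x" by (simp add: matrix_vector_mul_assoc)
  then obtain c where c: "A *v c = grad p x" by blast
  have sum: "(\<Sum>i\<in>UNIV. c $ i *\<^sub>R grad (b i) x) = grad p x"
    unfolding c[symmetric] by (simp add: A_def matrix_vector_mult_def transpose_def vec_eq_iff mult.commute)
  let ?q = "\<Sum>i\<in>UNIV. cst (c $ i) * b i"
  have "grad ?q x = grad p x" unfolding sum[symmetric] by (simp add: grad_sum grad_mult grad_cst)
  then have "grad (p - ?q) x = 0" using grad_add[of "p - ?q" ?q x] by simp
  moreover have "ev (p - ?q) x = 0" using p by (simp add: mx_iff bx)
  ultimately have "p - ?q \<in> ipow (mx x) 2" by (intro grad_zero_ipow)
  then show ?thesis by (intro exI[of _ "\<lambda>i. c $ i"] exI[of _ "p - ?q"]) simp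
qed

text \<open>By \<open>mx_decomp\<close> the coordinates generate \<open>mx x\<close> modulo its
  square, hence locally.\<close>

lemma mx_subset_sat:
  assumes K: "rmod.subspace K" and "\<And>i. b i \<in> K"
  shows "mx x \<subseteq> sat (mx x) K"
proof (rule local_nakayama_mx[OF K])
  fix p assume "p \<in> mx x"
  then obtain c h where "h \<in> ipow (mx x) 2" "p = (\<Sum>i\<in>UNIV. cst (c i) * b i) + h" using mx_decomp by blast
  moreover have "(\<Sum>i\<in>UNIV. cst (c i) * b i) \<in> K" by (intro rmod.subspace_sum[OF K] ideal_mult_left[OF K] assms(2))
  ultimately show "\<exists>k\<in>K. \<exists>h\<in>ipow (mx x) 2. p = k + h" by blast
qed

text \<open>Otherwise the height theorem gives a prime strictly below \<open>mx x\<close> that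
  contains \<open>van X\<close> and the \<open>b i\<close> with \<open>i \<in> S\<close>, hence all
  coordinates, which generate \<open>mx x\<close> locally.\<close>

lemma chain_le_card:
  assumes "prime_chain_at X x d"
  shows "d \<le> card S"
proof (rule ccontr)
  assume "\<not> d \<le> card S"
  then obtain n where n: "d = Suc n" "card S \<le> n" using less_eq_Suc_le Suc_le_D by (metis not_le Suc_le_mono)
  have "card (b ` S) \<le> n" using card_image_le[of S b] n(2) by simp
  then have "\<exists>Q. prime_id Q \<and> van X \<union> b ` S \<subseteq> Q \<and> Q \<subset> mx x"
    using assms n(1) b_mx by (intro prime_chain_height[of X x n]) auto
  then obtain Q where Q: "prime_id Q" "van X \<union> b ` S \<subseteq> Q" "Q \<subset> mx x" by (elim exE conjE)
  have "b i \<in> Q" for i using bV[of i] Q(2) by blast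
  then have "mx x \<subseteq> sat (mx x) Q" by (rule mx_subset_sat[OF prime_id_subspace[OF Q(1)]])
  also have "\<dots> \<subseteq> Q" using Q by (intro sat_prime) auto
  finally show False using Q(3) by blast
qed

end

subsection \<open>Leading forms\<close>

text \<open>\<open>hom b S e g \<Phi>\<close>: \<open>g\<close> is the form \<open>\<Phi>\<close> of degree \<open>e\<close> in the coordinates \<open>b i\<close>, \<open>i \<in> S\<close>.\<close>

inductive hom :: "('n \<Rightarrow> ('n::finite) polyfun) \<Rightarrow> 'n set \<Rightarrow> nat \<Rightarrow> 'n polyfun \<Rightarrow> (real ^ 'n \<Rightarrow> real) \<Rightarrow> bool"
  for b S where
  hom_0: "hom b S e 0 (\<lambda>_. 0)"
| hom_cst: "hom b S 0 (cst c) (\<lambda>_. c)"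
| hom_mult: "hom b S e g \<Phi> \<Longrightarrow> i \<in> S \<Longrightarrow> hom b S (Suc e) (b i * g) (\<lambda>v. v $ i * \<Phi> v)"
| hom_add: "hom b S e g \<Phi> \<Longrightarrow> hom b S e g' \<Phi>' \<Longrightarrow> hom b S e (g + g') (\<lambda>v. \<Phi> v + \<Phi>' v)"

lemma hom_scale: "hom b S e g \<Phi> \<Longrightarrow> hom b S e (cst c * g) (\<lambda>v. c * \<Phi> v)"
proof (induction rule: hom.induct)
  case (hom_0 e)
  then show ?case using hom.hom_0[of b S e] by simp
next
  case (hom_cst d)
  then show ?case using hom.hom_cst[of b S "c * d"] by (simp add: cst_simps)
next
  case (hom_mult e g \<Phi> i)
  then show ?case using hom.hom_mult[of b S e "cst c * g" "\<lambda>v. c * \<Phi> v" i] by (simp add: mult.left_commute)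
next
  case (hom_add e g \<Phi> g' \<Phi>')
  then show ?case using hom.hom_add[of b S e "cst c * g" "\<lambda>v. c * \<Phi> v"] by (simp add: distrib_left)
qed

lemma hom_sum:
  "finite J \<Longrightarrow> (\<And>j. j \<in> J \<Longrightarrow> hom b S e (g j) (\<Phi> j)) \<Longrightarrow> hom b S e (\<Sum>j\<in>J. g j) (\<lambda>v. \<Sum>j\<in>J. \<Phi> j v)"
  by (induction J rule: finite_induct) (auto intro: hom_0 hom_add)

lemma hom_ev: "hom b S e g \<Phi> \<Longrightarrow> ev g y = \<Phi> (\<chi> i. ev (b i) y)"
  by (induction rule: hom.induct) auto

lemma hom_vanish: "hom b S e g \<Phi> \<Longrightarrow> e > 0 \<Longrightarrow> \<forall>i\<in>S. v $ i = 0 \<Longrightarrow> \<Phi> v = 0"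
  by (induction rule: hom.induct) auto

lemma hom_eq_0: "hom b S e g \<Phi> \<Longrightarrow> (\<And>v. \<Phi> v = 0) \<Longrightarrow> g = 0"
  by (intro polyfun_eqI) (simp add: hom_ev)

text \<open>Modulo \<open>Q\<close> the coordinates are proportional to \<open>v\<close> with the
  single parameter \<open>z\<close>, as on a line through the origin, so a form takes the value of
  its homogeneous restriction to this line.\<close>

lemma hom_reduce:
  assumes "hom b S e g \<Phi>" and Q: "rmod.subspace Q" and bQ: "\<And>i. i \<in> S \<Longrightarrow> b i - cst (v $ i) * z \<in> Q"
  shows "g - cst (\<Phi> v) * z ^ e \<in> Q"
  using assms(1)
proof (induction rule: hom.induct)
  case (hom_mult e g \<Phi> i)
  have "b i * g - cst (v $ i * \<Phi> v) * z ^ Suc e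
      = (b i - cst (v $ i) * z) * g + (cst (v $ i) * z) * (g - cst (\<Phi> v) * z ^ e)"
    by (simp add: cst_simps algebra_simps)
  also have "\<dots> \<in> Q"
    by (intro rmod.subspace_add[OF Q] ideal_mult_right[OF Q bQ] ideal_mult_left[OF Q hom_mult.IH] hom_mult.hyps)
  finally show ?case .
next
  case (hom_add e g \<Phi> g' \<Phi>')
  have "g + g' - cst (\<Phi> v + \<Phi>' v) * z ^ e = (g - cst (\<Phi> v) * z ^ e) + (g' - cst (\<Phi>' v) * z ^ e)"
    by (simp add: cst_simps algebra_simps)
  then show ?case using rmod.subspace_add[OF Q hom_add.IH] by (simp only:)
qed (use rmod.subspace_0[OF Q] in \<open>auto simp: cst_simps\<close>)

context coords begin

lemma hom_ipow: "hom b S e g \<Phi> \<Longrightarrow> g \<in> ipow (mx x) e"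
proof (induction rule: hom.induct)
  case (hom_0 e)
  show ?case by (rule rmod.subspace_0[OF ideal_ipow])
next
  case (hom_cst c)
  show ?case by simp
next
  case (hom_mult e g \<Phi> i)
  show ?case by (rule ipow_SucI[OF b_mx hom_mult.IH])
next
  case (hom_add e g \<Phi> g' \<Phi>')
  show ?case by (rule rmod.subspace_add[OF ideal_ipow hom_add.IH])
qed

definition Fs :: "'n polyfun set" where "Fs = rmod.span (b ` (- S))"

text \<open>The ideal of the known equations of \<open>X\<close> up to terms of order
  \<open>n\<close> at \<open>x\<close>.\<close>

definition Kn :: "nat \<Rightarrow> 'n polyfun set" where "Kn n = {f + h | f h. f \<in> Fs \<and> h \<in> ipow (mx x) n}"

lemma ideal_Kn: "rmod.subspace (Kn n)"
  unfolding Kn_def by (rule ideal_plus) (simp_all add: Fs_def ideal_ipow)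

lemma Fs_Kn: "f \<in> Fs \<Longrightarrow> f \<in> Kn n"
  unfolding Kn_def using rmod.subspace_0[OF ideal_ipow[of "mx x" n]]
  by (intro CollectI exI[of _ f] exI[of _ "0 :: 'n polyfun"]) simp

lemma ipow_Kn: "h \<in> ipow (mx x) n \<Longrightarrow> h \<in> Kn n"
proof -
  have "0 \<in> Fs" unfolding Fs_def by (rule rmod.span_zero)
  then show "h \<in> ipow (mx x) n \<Longrightarrow> h \<in> Kn n" unfolding Kn_def by (intro CollectI exI[of _ 0] exI[of _ h]) simp
qed

lemma Fs_van: "Fs \<subseteq> van X"
  unfolding Fs_def using bV by (intro rmod.span_minimal ideal_van) auto

lemma Kn_mult_mx:
  assumes "k \<in> Kn n" "a \<in> mx x"
  shows "a * k \<in> Kn (Suc n)"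
proof -
  obtain f h where fh: "f \<in> Fs" "h \<in> ipow (mx x) n" "k = f + h" using assms unfolding Kn_def by blast
  have "a * f \<in> Kn (Suc n)" using fh(1) by (intro Fs_Kn) (simp add: Fs_def rmod.span_scale)
  moreover have "a * h \<in> Kn (Suc n)" by (intro ipow_Kn ipow_SucI assms fh)
  ultimately have "a * f + a * h \<in> Kn (Suc n)" by (rule rmod.subspace_add[OF ideal_Kn])
  then show ?thesis using fh by (simp add: distrib_left)
qed

text \<open>In a product of elements of \<open>mx x\<close> the coordinates outside \<open>S\<close>
  are absorbed by \<open>Fs\<close>, and coefficients may be replaced by their values at
  \<open>x\<close> at the cost of one order.\<close>

lemma form_decomp: "h \<in> ipow (mx x) s \<Longrightarrow> \<exists>g \<Phi>. hom b S s g \<Phi> \<and> h - g \<in> Kn (Suc s)"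
proof (induction s arbitrary: h)
  case 0
  have "h - cst (ev h x) \<in> ipow (mx x) (Suc 0)" using ipow_1[OF ideal_van[of "{x}"]] by (simp add: mx_iff)
  then show ?case using ipow_Kn hom_cst by blast
next
  case (Suc s)
  define T where "T = {h. h \<in> ipow (mx x) (Suc s) \<and> (\<exists>g \<Phi>. hom b S (Suc s) g \<Phi> \<and> h - g \<in> Kn (Suc (Suc s)))}"
  have "ipow (mx x) (Suc s) \<subseteq> T"
  proof (rule ipow_Suc_least)
    show "rmod.subspace T"
    proof (rule rmod.subspaceI)
      have "0 - 0 \<in> Kn (Suc (Suc s))" using rmod.subspace_0[OF ideal_Kn] by simp
      then show "0 \<in> T" unfolding T_def using hom_0 rmod.subspace_0[OF ideal_ipow] by blast
      fix p q assume "p \<in> T" "q \<in> T"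
      then obtain g \<Phi> g' \<Phi>' where *: "hom b S (Suc s) g \<Phi>" "p - g \<in> Kn (Suc (Suc s))"
        "hom b S (Suc s) g' \<Phi>'" "q - g' \<in> Kn (Suc (Suc s))"
        "p \<in> ipow (mx x) (Suc s)" "q \<in> ipow (mx x) (Suc s)" unfolding T_def by blast
      have "(p + q) - (g + g') = (p - g) + (q - g')" by simp
      then have "(p + q) - (g + g') \<in> Kn (Suc (Suc s))" using rmod.subspace_add[OF ideal_Kn *(2,4)] by (simp only:)
      then show "p + q \<in> T"
        unfolding T_def using hom_add[OF *(1,3)] rmod.subspace_add[OF ideal_ipow *(5,6)] by blast
    next
      fix r p assume "p \<in> T"
      then obtain g \<Phi> where *: "hom b S (Suc s) g \<Phi>" "p - g \<in> Kn (Suc (Suc s))" "p \<in> ipow (mx x) (Suc s)"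
        unfolding T_def by blast
      have "r - cst (ev r x) \<in> mx x" by (simp add: mx_iff)
      then have "(r - cst (ev r x)) * g \<in> Kn (Suc (Suc s))" by (intro ipow_Kn ipow_SucI hom_ipow[OF *(1)])
      moreover have "r * (p - g) \<in> Kn (Suc (Suc s))" by (rule ideal_mult_left[OF ideal_Kn *(2)])
      moreover have "r * p - cst (ev r x) * g = r * (p - g) + (r - cst (ev r x)) * g" by (simp add: algebra_simps)
      ultimately have "r * p - cst (ev r x) * g \<in> Kn (Suc (Suc s))" using rmod.subspace_add[OF ideal_Kn] by simp
      then show "r * p \<in> T"
        unfolding T_def using hom_scale[OF *(1)] ideal_mult_left[OF ideal_ipow *(3)] by blast
    qed
    fix a c assume a: "a \<in> mx x" and c: "c \<in> ipow (mx x) s"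
    obtain g \<Phi> where g: "hom b S s g \<Phi>" "c - g \<in> Kn (Suc s)" using Suc.IH[OF c] by blast
    obtain w h where w: "h \<in> ipow (mx x) 2" "a = (\<Sum>i\<in>UNIV. cst (w i) * b i) + h" using mx_decomp[OF a] by blast
    have split: "(\<Sum>i\<in>UNIV. cst (w i) * b i) = (\<Sum>i\<in>S. cst (w i) * b i) + (\<Sum>i\<in>-S. cst (w i) * b i)"
      using sum.union_disjoint[of S "- S" "\<lambda>i. cst (w i) * b i"] by (simp add: Compl_partition)
    let ?u = "\<Sum>i\<in>S. cst (w i) * b i" and ?f = "\<Sum>i\<in>-S. cst (w i) * b i"
    let ?g = "\<Sum>i\<in>S. cst (w i) * (b i * g)"
    have hg: "hom b S (Suc s) ?g (\<lambda>v. \<Sum>i\<in>S. w i * (v $ i * \<Phi> v))"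
      by (intro hom_sum hom_scale hom_mult g(1)) auto
    have "?g = ?u * g" by (simp add: sum_distrib_right mult.assoc)
    moreover have "(u + f + h) * c - u * g = u * (c - g) + f * c + h * c" for u f by (simp add: algebra_simps)
    ultimately have "a * c - ?g = ?u * (c - g) + ?f * c + h * c" unfolding w(2) split by (simp only:)
    also have "\<dots> \<in> Kn (Suc (Suc s))"
    proof (intro rmod.subspace_add[OF ideal_Kn])
      have "?u \<in> mx x" by (simp add: mx_iff bx)
      then show "?u * (c - g) \<in> Kn (Suc (Suc s))" by (intro Kn_mult_mx g)
      have "?f \<in> Fs" unfolding Fs_def by (intro rmod.span_sum rmod.span_scale rmod.span_base) auto
      then have "c * ?f \<in> Fs" unfolding Fs_def by (intro rmod.span_scale)
      then show "?f * c \<in> Kn (Suc (Suc s))" by (intro Fs_Kn) (simp add: mult.commute)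
      have "h * c \<in> ipow (mx x) (2 + s)" by (rule ipow_mult[OF w(1) c])
      then show "h * c \<in> Kn (Suc (Suc s))" by (intro ipow_Kn) (simp del: ipow.simps)
    qed
    finally show "a * c \<in> T" unfolding T_def using hg ipow_SucI[OF a c] by blast
  qed
  then show ?case using Suc.prems unfolding T_def by blast
qed

end

locale adapted_coords = coords X x b S
  for X :: "(real ^ 'n::finite) set" and x b S +
  assumes chain: "prime_chain_at X x (card S)"
begin

text \<open>If \<open>\<Phi> v\<close> were nonzero, the equations of the line in direction
  \<open>v\<close>, which are \<open>card S - 1\<close> in number, would together with
  \<open>van X\<close> lie in a prime \<open>Q\<close> strictly below \<open>mx x\<close>. Modulo
  \<open>Q\<close> the form \<open>g\<close> becomes \<open>\<Phi> v\<close> times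
  \<open>z ^ s\<close>, whereas \<open>k\<close> disappears and \<open>h\<close> is locally a
  multiple of \<open>z ^ Suc s\<close>. So \<open>z\<close> lies in \<open>Q\<close>, and with it,
  locally, all of \<open>mx x\<close>.\<close>

lemma form_vanishes:
  assumes g: "hom b S s g \<Phi>" and s: "0 < s" and k: "k \<in> van X" and h: "h \<in> ipow (mx x) (Suc s)" and gkh: "g = k + h"
  shows "\<Phi> v = 0"
proof (rule ccontr)
  assume nz: "\<Phi> v \<noteq> 0"
  then obtain j where j: "j \<in> S" "v $ j \<noteq> 0" using hom_vanish[OF g s] by blast
  \<comment> \<open>This scaling makes \<open>b j - cst (v $ j) * z\<close> zero, so the index
    \<open>j\<close> contributes no equation and \<open>B\<close> stays within the bound of the
    height theorem.\<close>
  define z where "z = cst (1 / v $ j) * b j"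
  define B where "B = (\<lambda>i. b i - cst (v $ i) * z) ` (S - {j})"
  obtain n where n: "card S = Suc n" using j by (cases "card S") auto
  have "z \<in> mx x" by (simp add: z_def mx_iff bx)
  have "card B \<le> card (S - {j})" unfolding B_def by (rule card_image_le) simp
  then have "card B \<le> n" using n j by simp
  moreover have "B \<subseteq> mx x" by (auto simp: B_def mx_iff bx z_def)
  moreover have "finite B" by (simp add: B_def)
  ultimately obtain Q where Q: "prime_id Q" "van X \<union> B \<subseteq> Q" "Q \<subset> mx x"
    using prime_chain_height[of X x n B] chain n by auto
  note sQ = prime_id_subspace[OF Q(1)]
  have bQ: "b i - cst (v $ i) * z \<in> Q" if "i \<in> S" for i
  proof (cases "i = j")
    case True
    have "cst (v $ j) * z = b j"
      using j(2) by (simp add: z_def mult.assoc[symmetric] cst_simps(4)[symmetric]) (simp add: cst_simps)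
    then show ?thesis using True rmod.subspace_0[OF sQ] by simp
  qed (use that Q(2) B_def in auto)
  define Z where "Z n = rmod.span (insert (z ^ n) Q)" for n
  have sZ: "rmod.subspace (Z n)" for n by (simp add: Z_def)
  have QZ: "q \<in> Z n" if "q \<in> Q" for q n using that by (simp add: Z_def rmod.span_base)
  have zZ: "z ^ n \<in> Z n" for n by (simp add: Z_def rmod.span_base)
  have "b i \<in> Z 1" for i
  proof (cases "i \<in> S")
    case True
    have "(b i - cst (v $ i) * z) + cst (v $ i) * z ^ 1 \<in> Z 1"
      by (intro rmod.subspace_add[OF sZ] QZ bQ True ideal_mult_left[OF sZ] zZ)
    then show ?thesis by simp
  qed (use bV Q(2) QZ in blast)
  then have mZ: "mx x \<subseteq> sat (mx x) (Z 1)" by (rule mx_subset_sat[OF sZ])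
  have ipZ: "ipow (mx x) n \<subseteq> sat (mx x) (Z n)" for n
  proof (induction n)
    case 0
    have "1 \<in> Z 0" using zZ[of 0] by simp
    then have "Z 0 = UNIV" by (rule ideal_one[OF sZ])
    then show ?case using sat_superset[OF prime_mx] by auto
  next
    case (Suc n)
    show ?case
    proof (rule ipow_Suc_least[OF ideal_sat[OF prime_mx sZ]])
      fix a c assume a: "a \<in> mx x" and c: "c \<in> ipow (mx x) n"
      obtain t where t: "t \<notin> mx x" "t * a \<in> Z 1" using mZ a satE by blast
      obtain u where u: "u \<notin> mx x" "u * c \<in> Z n" using Suc.IH c satE by blast
      obtain d q where q: "q \<in> Q" "t * a = q + d * z ^ 1" using t(2) sQ unfolding Z_def by (rule span_insert_cases)
      obtain e r where r: "r \<in> Q" "u * c = r + e * z ^ n" using u(2) sQ unfolding Z_def by (rule span_insert_cases)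
      have "(t * u) * (a * c) = (t * a) * (u * c)" by (simp add: mult_ac)
      also have "\<dots> = q * (u * c) + (d * z) * r + (d * e) * z ^ Suc n"
        unfolding q(2) r(2) by (simp add: algebra_simps)
      also have "\<dots> \<in> Z (Suc n)"
        by (intro rmod.subspace_add[OF sZ] ideal_mult_left[OF sZ zZ] QZ ideal_mult_right[OF sQ q(1)] ideal_mult_left[OF sQ r(1)])
      finally have "(t * u) * (a * c) \<in> Z (Suc n)" .
      then show "a * c \<in> sat (mx x) (Z (Suc n))"
        by (rule satI[OF prime_id_mult_notin[OF prime_mx t(1) u(1)]])
    qed
  qed
  obtain t where t: "t \<notin> mx x" "t * h \<in> Z (Suc s)" using ipZ[of "Suc s"] h satE by blast
  obtain c q where q: "q \<in> Q" "t * h = q + c * z ^ Suc s" using t(2) sQ unfolding Z_def by (rule span_insert_cases)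
  have "g - cst (\<Phi> v) * z ^ s \<in> Q" by (rule hom_reduce[OF g sQ bQ])
  moreover have "k \<in> Q" using k Q(2) by blast
  ultimately have "(g - cst (\<Phi> v) * z ^ s) - k \<in> Q" by (rule rmod.subspace_diff[OF sQ])
  then have "t * ((g - cst (\<Phi> v) * z ^ s) - k) \<in> Q" by (rule ideal_mult_left[OF sQ])
  then have "q - t * ((g - cst (\<Phi> v) * z ^ s) - k) \<in> Q" by (rule rmod.subspace_diff[OF sQ q(1)])
  moreover have "q - t * ((g - cst (\<Phi> v) * z ^ s) - k) = (t * cst (\<Phi> v) - c * z) * z ^ s"
  proof -
    have "q = t * h - c * z ^ Suc s" using q(2) by simp
    then show ?thesis unfolding gkh by (simp add: algebra_simps)
  qed
  ultimately have "(t * cst (\<Phi> v) - c * z) * z ^ s \<in> Q" by simp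
  \<comment> \<open>At \<open>x\<close> the factor takes the value \<open>ev t x * \<Phi> v\<close>,
    which is nonzero, so it is a local unit and the power of \<open>z\<close> must lie in
    \<open>Q\<close>.\<close>
  moreover have "t * cst (\<Phi> v) - c * z \<notin> Q"
  proof
    assume "t * cst (\<Phi> v) - c * z \<in> Q"
    then have "t * cst (\<Phi> v) - c * z \<in> mx x" using Q(3) by blast
    then have "ev t x * \<Phi> v = 0" using \<open>z \<in> mx x\<close> by (simp add: mx_iff)
    then show False using nz t(1) by (simp add: mx_iff)
  qed
  ultimately have "z \<in> Q" using prime_id_multD[OF Q(1)] prime_id_powerD[OF Q(1)] by blast
  then have "insert (z ^ 1) Q = Q" by auto
  then have "Z 1 = Q" unfolding Z_def using sQ by (simp only: rmod.span_eq_iff)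
  then have "mx x \<subseteq> sat (mx x) Q" using mZ by simp
  also have "\<dots> \<subseteq> Q" using Q by (intro sat_prime) auto
  finally show False using Q(3) by blast
qed

text \<open>Order by order: a polynomial vanishing on \<open>X\<close> is an element of
  \<open>Fs\<close> plus a term of order \<open>n\<close>, and the leading form of that term is zero
  by \<open>form_vanishes\<close>.\<close>

lemma van_subset_Kn: "van X \<subseteq> Kn n"
proof (induction n)
  case 0
  then show ?case using ipow_Kn[of _ 0] by auto
next
  case (Suc n)
  show ?case
  proof
    fix p assume p: "p \<in> van X"
    show "p \<in> Kn (Suc n)"
    proof (cases n)
      \<comment> \<open>\<open>form_vanishes\<close> concerns positive degree; in order 0 the claim
        is that \<open>p\<close> vanishes at \<open>x\<close>.\<close>
      case 0
      have "p \<in> ipow (mx x) (Suc 0)" using p van_subset_mx[OF xX] ipow_1[OF ideal_van[of "{x}"]] by blast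
      then show ?thesis using 0 by (intro ipow_Kn) simp
    next
      case (Suc m)
      obtain f h where fh: "f \<in> Fs" "h \<in> ipow (mx x) n" "p = f + h" using Suc.IH p unfolding Kn_def by blast
      obtain g \<Phi> where g: "hom b S n g \<Phi>" "h - g \<in> Kn (Suc n)" using form_decomp[OF fh(2)] by blast
      obtain f' h' where fh': "f' \<in> Fs" "h' \<in> ipow (mx x) (Suc n)" "h - g = f' + h'" using g(2) unfolding Kn_def by blast
      have "g = (p - f - f') + (- h')" using fh(3) fh'(3) by (simp add: algebra_simps)
      moreover have "p - f - f' \<in> van X"
        using p fh(1) fh'(1) Fs_van by (intro rmod.subspace_diff[OF ideal_van]) auto
      moreover have "- h' \<in> ipow (mx x) (Suc n)" by (rule rmod.subspace_neg[OF ideal_ipow fh'(2)])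
      ultimately have "\<Phi> v = 0" for v using form_vanishes[OF g(1)] Suc by blast
      then have "g = 0" by (rule hom_eq_0[OF g(1)])
      then have "h \<in> Kn (Suc n)" using g(2) by simp
      then show ?thesis using fh Fs_Kn rmod.subspace_add[OF ideal_Kn] by simp
    qed
  qed
qed

end

lemma adapted_coords_exist:
  assumes x: "x \<in> X" and reg: "regular_local_ring (local_ring_at X x) d"
  shows "\<exists>b S. adapted_coords X x b S \<and> card S = d"
proof -
  interpret L: localized_functions "local_ring_at X x" "germ X x" X x by (rule localized_functions_germ[OF x])
  obtain b S where bS: "coords X x b S" "card S \<le> d" using coords_exist[OF assms] by blast
  have chain: "prime_chain_at X x d" unfolding prime_chain_at_def by (rule L.regular_chain[OF reg])
  have "card S = d" by (rule le_antisym[OF bS(2) coords.chain_le_card[OF bS(1) chain]])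
  then show ?thesis using bS(1) chain unfolding adapted_coords_def adapted_coords_axioms_def by blast
qed

section \<open>Arcs in \<open>X\<close>\<close>

lemma ev_of_int [simp]: "ev (of_int z) y = of_int z"
proof -
  have n: "ev (of_nat n) y = of_nat n" for n by (induction n) auto
  show ?thesis by (cases z rule: int_diff_cases) (simp add: n)
qed

context coords begin

definition gradp :: "'n polyfun \<Rightarrow> 'n polyfun ^ 'n" where
  "gradp p = (\<chi> k. pd k p)"

definition Dt :: "'n polyfun" where
  "Dt = det (\<chi> i. gradp (b i))"

text \<open>Cramer's rule: \<open>D j (b i) = 0\<close> for \<open>i \<noteq> j\<close> since two rows coincide.\<close>

definition D :: "'n \<Rightarrow> 'n polyfun \<Rightarrow> 'n polyfun" where
  "D j p = det (\<chi> i. if i = j then gradp p else gradp (b i))"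

lemma D_add: "D j (p + q) = D j p + D j q"
proof -
  have g: "gradp (p + q) = gradp p + gradp q" by (simp add: gradp_def pd_add vec_eq_iff)
  show ?thesis unfolding D_def g by (rule det_row_add)
qed

lemma D_mult: "D j (p * q) = p * D j q + q * D j p"
proof -
  have g: "gradp (p * q) = p *s gradp q + q *s gradp p" by (simp add: gradp_def pd_mult vec_eq_iff)
  show ?thesis unfolding D_def g det_row_add det_row_mul ..
qed

lemma D_cst: "D j (cst c) = 0"
proof -
  have g: "gradp (cst c) = 0" by (simp add: gradp_def pd_cst vec_eq_iff)
  show ?thesis unfolding D_def g by (rule det_row_0)
qed

lemma D_b: "D j (b i) = (if i = j then Dt else 0)"
proof (cases "i = j")
  case True
  then have e: "(\<lambda>k. if k = j then gradp (b i) else gradp (b k)) = (\<lambda>k. gradp (b k))" by auto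
  show ?thesis unfolding D_def e Dt_def using True by simp
next
  case False
  have "D j (b i) = 0" unfolding D_def
    by (rule det_identical_rows[OF False]) (use False in \<open>simp add: row_def\<close>)
  then show ?thesis using False by simp
qed

lemma ev_Dt: "ev Dt x \<noteq> 0"
proof -
  have "ev Dt x = det (\<chi> i. grad (b i) x)"
    by (simp add: Dt_def det_def gradp_def grad_def)
  then show ?thesis using indep by simp
qed

text \<open>The constant combination of the dual derivations in direction \<open>v\<close>.
  Multiplying by \<open>Dt\<close> instead of dividing keeps them polynomial; at \<open>x\<close>
  this contributes the nonzero factor \<open>ev Dt x\<close>.\<close>

definition W :: "real ^ 'n \<Rightarrow> 'n polyfun \<Rightarrow> 'n polyfun" where
  "W v p = (\<Sum>j\<in>S. cst (v $ j) * D j p)"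

lemma derivation_W: "derivation (W v)"
  by unfold_locales (simp_all add: W_def D_add D_mult D_cst algebra_simps sum.distrib sum_distrib_left)

sublocale Wd: derivation "W v" for v
  by (rule derivation_W)

lemma W_b: "W v (b i) = (if i \<in> S then cst (v $ i) * Dt else 0)"
proof -
  have "W v (b i) = (\<Sum>j\<in>S. if j = i then cst (v $ j) * Dt else 0)"
    unfolding W_def by (intro sum.cong) (auto simp: D_b)
  then show ?thesis by simp
qed

lemma W_line: "W (u + \<beta> *\<^sub>R v) p = W u p + cst \<beta> * W v p"
  by (simp add: W_def cst_simps distrib_right sum.distrib sum_distrib_left mult.assoc)

text \<open>The derivation is affine in \<open>\<beta>\<close>. The coefficient of order
  \<open>n + 1\<close> of \<open>p\<close> comes from those of order \<open>n\<close> of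
  \<open>W u p\<close> and of \<open>cst \<beta> * W v p\<close>, where \<open>W u p\<close> and
  \<open>W v p\<close> do not involve \<open>\<beta>\<close>; hence the induction is for all
  \<open>p\<close> at once.\<close>

lemma tay_line_poly: "\<exists>\<pi>. \<forall>\<beta>. Wd.tay (u + \<beta> *\<^sub>R v) x p $$ n = poly \<pi> \<beta>"
proof (induction n arbitrary: p)
  case 0
  show ?case by (intro exI[of _ "[:ev p x:]"]) (simp add: Wd.tay_0)
next
  case (Suc n)
  obtain \<pi> where \<pi>: "\<forall>\<beta>. Wd.tay (u + \<beta> *\<^sub>R v) x (W u p) $$ n = poly \<pi> \<beta>" using Suc.IH by blast
  obtain \<rho> where \<rho>: "\<forall>\<beta>. Wd.tay (u + \<beta> *\<^sub>R v) x (W v p) $$ n = poly \<rho> \<beta>" using Suc.IH by blast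
  have "Wd.tay (u + \<beta> *\<^sub>R v) x p $$ Suc n = poly (Polynomial.smult (1 / of_nat (Suc n)) (\<pi> + [:0, 1:] * \<rho>)) \<beta>" for \<beta>
  proof -
    have "of_nat (Suc n) * Wd.tay (u + \<beta> *\<^sub>R v) x p $$ Suc n = Wd.tay (u + \<beta> *\<^sub>R v) x (W u p + cst \<beta> * W v p) $$ n"
      unfolding Wd.tay_Suc W_line ..
    also have "\<dots> = poly \<pi> \<beta> + \<beta> * poly \<rho> \<beta>"
      using \<pi> \<rho> by (simp add: Wd.tay_add Wd.tay_mult Wd.tay_cst)
    finally show ?thesis by (simp add: field_simps del: of_nat_Suc)
  qed
  then show ?case by blast
qed

lemma tay_Fs: "f \<in> Fs \<Longrightarrow> Wd.tay v x f = 0"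
proof -
  have "Fs \<subseteq> {f. Wd.tay v x f = 0}" unfolding Fs_def
  proof (rule rmod.span_minimal)
    show "b ` (- S) \<subseteq> {f. Wd.tay v x f = 0}" by (auto intro!: Wd.tay_eq_0 simp: W_b bx)
    show "rmod.subspace {f. Wd.tay v x f = 0}"
      by (intro rmod.subspaceI) (auto simp: Wd.tay_zero Wd.tay_add Wd.tay_mult)
  qed
  then show "f \<in> Fs \<Longrightarrow> Wd.tay v x f = 0" by blast
qed

lemma tay_Kn: "p \<in> Kn m \<Longrightarrow> n < m \<Longrightarrow> Wd.tay v x p $$ n = 0"
  unfolding Kn_def by (auto simp: Wd.tay_add tay_Fs Wd.tay_ipow)

text \<open>For \<open>i \<in> S\<close> the series of \<open>b i\<close> starts with
  \<open>v $ i * ev Dt x\<close> in order 1, and lowest coefficients multiply.\<close>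

lemma hom_tay: "hom b S e g \<Phi> \<Longrightarrow> Wd.tay v x g $$ e = ev Dt x ^ e * \<Phi> v"
proof (induction rule: hom.induct)
  case (hom_mult e g \<Phi> i)
  have g0: "Wd.tay v x g $$ n = 0" if "n < e" for n by (rule Wd.tay_ipow[OF hom_ipow[OF hom_mult.hyps(1)] that])
  have "Wd.tay v x (b i * g) $$ Suc e = (\<Sum>n=0..Suc e. Wd.tay v x (b i) $$ n * Wd.tay v x g $$ (Suc e - n))"
    by (simp add: Wd.tay_mult fps_mult_nth)
  also have "\<dots> = (\<Sum>n\<in>{1}. Wd.tay v x (b i) $$ n * Wd.tay v x g $$ (Suc e - n))"
  proof (rule sum.mono_neutral_right)
    show "\<forall>n\<in>{0..Suc e} - {1}. Wd.tay v x (b i) $$ n * Wd.tay v x g $$ (Suc e - n) = 0"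
    proof
      fix n assume n: "n \<in> {0..Suc e} - {1}"
      show "Wd.tay v x (b i) $$ n * Wd.tay v x g $$ (Suc e - n) = 0"
      proof (cases "n = 0")
        case False
        then have "Suc e - n < e" using n by auto
        then show ?thesis using g0 by simp
      qed (simp add: Wd.tay_0 bx)
    qed
  qed auto
  also have "\<dots> = (v $ i * ev Dt x) * (ev Dt x ^ e * \<Phi> v)"
    using hom_mult by (simp add: Wd.tay_1 W_b)
  finally show ?case by simp
qed (simp_all add: Wd.tay_zero Wd.tay_cst Wd.tay_add distrib_left)

text \<open>The induction of \<open>van_subset_Kn\<close> with a different reason for the leading
  form to vanish: by \<open>hom_tay\<close> its value in each direction is a Taylor coefficient of
  \<open>\<eta>\<close> up to a nonzero factor.\<close>

lemma tay_zero_Kn: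
  assumes "\<And>v. Wd.tay v x \<eta> = 0"
  shows "\<eta> \<in> Kn n"
proof (induction n)
  case 0
  then show ?case using ipow_Kn[of \<eta> 0] by simp
next
  case (Suc n)
  then obtain f h where fh: "f \<in> Fs" "h \<in> ipow (mx x) n" "\<eta> = f + h" unfolding Kn_def by blast
  obtain g \<Phi> where g: "hom b S n g \<Phi>" "h - g \<in> Kn (Suc n)" using form_decomp[OF fh(2)] by blast
  have "\<Phi> v = 0" for v
  proof -
    have "g = \<eta> - f - (h - g)" using fh(3) by simp
    then have "Wd.tay v x g $$ n = Wd.tay v x \<eta> $$ n - Wd.tay v x f $$ n - Wd.tay v x (h - g) $$ n"
      by (metis Wd.tay_diff fps_sub_nth)
    then have "Wd.tay v x g $$ n = 0" using assms tay_Fs[OF fh(1)] tay_Kn[OF g(2), of n v] by simp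
    then show ?thesis using hom_tay[OF g(1)] ev_Dt by simp
  qed
  then have "g = 0" by (rule hom_eq_0[OF g(1)])
  then have "h \<in> Kn (Suc n)" using g(2) by simp
  then show ?case using fh Fs_Kn rmod.subspace_add[OF ideal_Kn] by simp
qed

text \<open>By \<open>tay_zero_Kn\<close> the function lies in \<open>van X\<close> up to every
  power of \<open>mx x\<close>; Krull's intersection theorem turns this into a local
  equation.\<close>

lemma tay_zero_germ:
  assumes "\<And>v. Wd.tay v x \<eta> = 0"
  shows "\<exists>t. t \<notin> mx x \<and> t * \<eta> \<in> van X"
proof -
  have "\<eta> \<in> sat (mx x) (van X)"
  proof (rule krull_intersection[OF prime_mx ideal_van])
    show "\<exists>k\<in>van X. \<exists>h\<in>ipow (mx x) n. \<eta> = k + h" for n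
      using tay_zero_Kn[OF assms, of n] Fs_van unfolding Kn_def by blast
  qed
  then show ?thesis by (auto simp: sat_def)
qed

definition vel :: "real ^ 'n \<Rightarrow> real ^ 'n" where
  "vel v = (\<chi> i. ev (W v (crd i)) x)"

lemma vel_line: "vel (u + \<beta> *\<^sub>R v) = vel u + \<beta> *\<^sub>R vel v"
  by (simp add: vel_def W_line vec_eq_iff)

lemma grad_vel: "grad (b i) x \<bullet> vel v = (if i \<in> S then v $ i * ev Dt x else 0)"
proof -
  have "grad (b i) x \<bullet> vel v = ev (W v (b i)) x"
    by (subst Wd.W_coords) (simp add: grad_def vel_def inner_vec_def)
  then show ?thesis by (simp add: W_b)
qed

abbreviation arc :: "real ^ 'n \<Rightarrow> real \<Rightarrow> real ^ 'n" where
  "arc v t \<equiv> Wd.flow v x t"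

lemma arc_tendsto: "(arc v \<longlongrightarrow> x) (at 0)"
proof (rule vec_tendstoI)
  fix i
  show "((\<lambda>t. arc v t $ i) \<longlongrightarrow> x $ i) (at 0)"
    using Wd.flow_order[of 0 v x "crd i"] by (simp add: Wd.tay_0)
qed

lemma arc_vel: "((\<lambda>t. (1 / t) *\<^sub>R (arc v t - x)) \<longlongrightarrow> vel v) (at 0)"
proof (rule vec_tendstoI)
  fix i
  have "Wd.tay v x (crd i - cst (x $ i)) $$ Suc 0 = ev (W v (crd i)) x"
    by (simp add: Wd.tay_diff Wd.tay_1 Wd.tay_cst)
  moreover have "((\<lambda>t. ev (crd i - cst (x $ i)) (arc v t) / t ^ Suc 0) \<longlongrightarrow> Wd.tay v x (crd i - cst (x $ i)) $$ Suc 0) (at 0)"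
    by (rule Wd.flow_order) (simp add: Wd.tay_0)
  ultimately show "((\<lambda>t. ((1 / t) *\<^sub>R (arc v t - x)) $ i) \<longlongrightarrow> vel v $ i) (at 0)"
    by (simp add: vel_def)
qed

end

context adapted_coords begin

lemma tay_van: "p \<in> van X \<Longrightarrow> Wd.tay v x p = 0"
  using van_subset_Kn tay_Kn by (intro fps_ext) (metis fps_zero_nth lessI subsetD)

lemma arc_van: "\<exists>\<tau>>0. \<forall>t. \<bar>t\<bar> < \<tau> \<longrightarrow> (\<forall>p\<in>van X. ev p (arc v t) = 0)"
proof -
  obtain \<tau> where \<tau>: "0 < \<tau>" "\<And>p t. \<bar>t\<bar> < \<tau> \<Longrightarrow> (\<lambda>n. Wd.tay v x p $$ n * t ^ n) sums ev p (arc v t)"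
    using Wd.flow_sums[of v x] by blast
  have "ev p (arc v t) = 0" if "\<bar>t\<bar> < \<tau>" "p \<in> van X" for t p
  proof -
    have "(\<lambda>n. 0) sums ev p (arc v t)" using \<tau>(2)[OF that(1), of p] by (simp add: tay_van[OF that(2)])
    then show ?thesis using sums_zero sums_unique2 by blast
  qed
  then show ?thesis using \<tau>(1) by blast
qed

end

lemma real_algebraic_set_van: "real_algebraic_set Z \<Longrightarrow> (\<forall>p\<in>van Z. ev p y = 0) \<Longrightarrow> y \<in> Z"
proof -
  assume "real_algebraic_set Z"
  then obtain F where F: "\<forall>p\<in>F. real_polynomial_function p" "Z = {y. \<forall>p\<in>F. p y = 0}"
    unfolding real_algebraic_set_def by blast
  have *: "Polyfun p \<in> van Z \<and> ev (Polyfun p) = p" if "p \<in> F" for p using F that by (auto simp: van_def ev_Polyfun)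
  assume "\<forall>p\<in>van Z. ev p y = 0"
  then have "p y = 0" if "p \<in> F" for p using *[OF that] by metis
  then show "y \<in> Z" using F(2) by blast
qed

text \<open>Over the reals finitely many equations are equivalent to the vanishing of the sum of
  their squares.\<close>

lemma real_algebraic_set_single:
  assumes "real_algebraic_set Z"
  shows "\<exists>\<eta>. Z = {y. ev \<eta> y = 0}"
proof -
  obtain F where F: "finite F" "F \<subseteq> van Z" "van Z = rmod.span F" using hilbert_basis[OF ideal_van] .
  define \<eta> where "\<eta> = (\<Sum>f\<in>F. f * f)"
  have "Z = {y. ev \<eta> y = 0}"
  proof
    show "Z \<subseteq> {y. ev \<eta> y = 0}" using F(2) by (auto simp: \<eta>_def van_def intro!: sum.neutral)
    show "{y. ev \<eta> y = 0} \<subseteq> Z"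
    proof clarify
      fix y assume "ev \<eta> y = 0"
      then have "(\<Sum>f\<in>F. ev f y * ev f y) = 0" by (simp add: \<eta>_def)
      then have F0: "F \<subseteq> {p. ev p y = 0}" using F(1) by (subst (asm) sum_nonneg_eq_0_iff) auto
      have "rmod.subspace {p. ev p y = 0}" by (intro rmod.subspaceI) auto
      then have "van Z \<subseteq> {p. ev p y = 0}" unfolding F(3) by (rule rmod.span_minimal[OF F0])
      then show "y \<in> Z" by (intro real_algebraic_set_van[OF assms]) blast
    qed
  qed
  then show ?thesis by blast
qed

context adapted_coords begin

lemma arc_in_X:
  assumes "real_algebraic_set X"
  shows "eventually (\<lambda>t. arc v t \<in> X) (at 0)"
proof -
  obtain \<tau> where "0 < \<tau>" "\<forall>t. \<bar>t\<bar> < \<tau> \<longrightarrow> (\<forall>p\<in>van X. ev p (arc v t) = 0)" using arc_van by blast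
  then show ?thesis
    unfolding eventually_at using real_algebraic_set_van[OF assms]
    by (intro exI[of _ \<tau>]) (auto simp: dist_real_def)
qed

text \<open>If the equation \<open>\<eta>\<close> of the complement vanished along all arcs, then
  \<open>t * \<eta>\<close> would vanish on \<open>X\<close> for some \<open>t\<close> with nonzero
  value at \<open>x\<close>. So \<open>t\<close> would vanish on \<open>U\<close> and, by density,
  at \<open>x\<close>.\<close>

lemma zariski_direction:
  assumes "zariski_open X U" "zariski_dense X U"
  shows "\<exists>v \<eta>. (\<forall>y\<in>X. ev \<eta> y \<noteq> 0 \<longrightarrow> y \<in> U) \<and> Wd.tay v x \<eta> \<noteq> 0"
proof -
  obtain Z where Z: "real_algebraic_set Z" "U = X - Z" using assms(1) by (auto simp: zariski_open_def)
  obtain \<eta> where \<eta>: "Z = {y. ev \<eta> y = 0}" using real_algebraic_set_single[OF Z(1)] by blast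
  have "\<exists>v. Wd.tay v x \<eta> \<noteq> 0"
  proof (rule ccontr)
    assume "\<nexists>v. Wd.tay v x \<eta> \<noteq> 0"
    then obtain t where t: "t \<notin> mx x" "t * \<eta> \<in> van X" using tay_zero_germ by blast
    have "U \<subseteq> {y. ev t y = 0}" using t(2) Z(2) \<eta> by (auto simp: van_def)
    moreover have "real_algebraic_set {y. ev t y = 0}"
      unfolding real_algebraic_set_def by (intro exI[of _ "{ev t}"]) (auto intro: real_polynomial_ev)
    ultimately have "X \<subseteq> {y. ev t y = 0}" using assms(2) unfolding zariski_dense_def by blast
    then show False using xX t(1) by (auto simp: mx_iff)
  qed
  then show ?thesis using Z(2) \<eta> by auto
qed

end

section \<open>Functions of class \<open>C\<^sup>k\<close>\<close>

subsection \<open>Homogeneous rational functions\<close>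

lemma isCont_ev: "isCont (ev p) y"
  using ev_has_derivative has_derivative_continuous by blast

lemma ev_lipschitz: "\<exists>C\<ge>0. \<forall>y. norm (y - x) \<le> 1 \<longrightarrow> \<bar>ev p y - ev p x\<bar> \<le> C * norm (y - x)"
proof (induction p rule: polyfun_induct)
  case (const c)
  show ?case by (intro exI[of _ 0]) auto
next
  case (coord i)
  show ?case using component_le_norm_cart[of "y - x" i for y] by (intro exI[of _ 1]) auto
next
  case (add p q)
  then obtain C D where CD: "C \<ge> 0" "\<forall>y. norm (y - x) \<le> 1 \<longrightarrow> \<bar>ev p y - ev p x\<bar> \<le> C * norm (y - x)"
    "D \<ge> 0" "\<forall>y. norm (y - x) \<le> 1 \<longrightarrow> \<bar>ev q y - ev q x\<bar> \<le> D * norm (y - x)" by blast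
  have "\<bar>ev (p + q) y - ev (p + q) x\<bar> \<le> (C + D) * norm (y - x)" if "norm (y - x) \<le> 1" for y
  proof -
    have "\<bar>ev p y - ev p x\<bar> \<le> C * norm (y - x)" "\<bar>ev q y - ev q x\<bar> \<le> D * norm (y - x)" using CD that by auto
    then show ?thesis by (simp add: distrib_right)
  qed
  then show ?case using CD by (intro exI[of _ "C + D"]) auto
next
  case (mult p q)
  then obtain C D where CD: "C \<ge> 0" "\<forall>y. norm (y - x) \<le> 1 \<longrightarrow> \<bar>ev p y - ev p x\<bar> \<le> C * norm (y - x)"
    "D \<ge> 0" "\<forall>y. norm (y - x) \<le> 1 \<longrightarrow> \<bar>ev q y - ev q x\<bar> \<le> D * norm (y - x)" by blast
  have "\<bar>ev (p * q) y - ev (p * q) x\<bar> \<le> (C * (\<bar>ev q x\<bar> + D) + \<bar>ev p x\<bar> * D) * norm (y - x)"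
    if y: "norm (y - x) \<le> 1" for y
  proof -
    have p: "\<bar>ev p y - ev p x\<bar> \<le> C * norm (y - x)" and q: "\<bar>ev q y - ev q x\<bar> \<le> D * norm (y - x)" using CD y by auto
    have "D * norm (y - x) \<le> D" using mult_left_mono[OF y CD(3)] by simp
    then have q1: "\<bar>ev q y\<bar> \<le> \<bar>ev q x\<bar> + D" using q by linarith
    have "ev (p * q) y - ev (p * q) x = (ev p y - ev p x) * ev q y + ev p x * (ev q y - ev q x)"
      by (simp add: algebra_simps)
    then have "\<bar>ev (p * q) y - ev (p * q) x\<bar> \<le> \<bar>ev p y - ev p x\<bar> * \<bar>ev q y\<bar> + \<bar>ev p x\<bar> * \<bar>ev q y - ev q x\<bar>"
      by (metis abs_mult abs_triangle_ineq)
    also have "\<dots> \<le> (C * norm (y - x)) * (\<bar>ev q x\<bar> + D) + \<bar>ev p x\<bar> * (D * norm (y - x))"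
      using p q q1 CD by (intro add_mono mult_mono) auto
    finally show ?thesis by (simp add: algebra_simps)
  qed
  then show ?case using CD by (intro exI[of _ "C * (\<bar>ev q x\<bar> + D) + \<bar>ev p x\<bar> * D"]) auto
qed

lemma ipow_bound:
  assumes "p \<in> ipow (mx x) m"
  shows "\<exists>C\<ge>0. \<forall>y. norm (y - x) \<le> 1 \<longrightarrow> \<bar>ev p y\<bar> \<le> C * norm (y - x) ^ m"
  using assms
proof (induction m arbitrary: p)
  case 0
  obtain C where C: "C \<ge> 0" "\<forall>y. norm (y - x) \<le> 1 \<longrightarrow> \<bar>ev p y - ev p x\<bar> \<le> C * norm (y - x)"
    using ev_lipschitz by blast
  have "\<bar>ev p y\<bar> \<le> \<bar>ev p x\<bar> + C" if "norm (y - x) \<le> 1" for y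
    using C that mult_left_mono[OF that C(1)] by fastforce
  then show ?case using C by (intro exI[of _ "\<bar>ev p x\<bar> + C"]) auto
next
  case (Suc m)
  define T where "T = {p. \<exists>C\<ge>0. \<forall>y. norm (y - x) \<le> 1 \<longrightarrow> \<bar>ev p y\<bar> \<le> C * norm (y - x) ^ Suc m}"
  have "ipow (mx x) (Suc m) \<subseteq> T"
  proof (rule ipow_Suc_least)
    show "rmod.subspace T"
    proof (rule rmod.subspaceI)
      show "0 \<in> T" unfolding T_def by (intro CollectI exI[of _ 0]) auto
      fix p q assume "p \<in> T" "q \<in> T"
      then obtain C D where CD: "C \<ge> 0" "\<forall>y. norm (y - x) \<le> 1 \<longrightarrow> \<bar>ev p y\<bar> \<le> C * norm (y - x) ^ Suc m"
        "D \<ge> 0" "\<forall>y. norm (y - x) \<le> 1 \<longrightarrow> \<bar>ev q y\<bar> \<le> D * norm (y - x) ^ Suc m" unfolding T_def by blast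
      have "\<bar>ev (p + q) y\<bar> \<le> (C + D) * norm (y - x) ^ Suc m" if "norm (y - x) \<le> 1" for y
      proof -
        have "\<bar>ev p y\<bar> \<le> C * norm (y - x) ^ Suc m" "\<bar>ev q y\<bar> \<le> D * norm (y - x) ^ Suc m" using CD that by blast+
        then show ?thesis unfolding distrib_right ev_simps by linarith
      qed
      then show "p + q \<in> T" unfolding T_def using CD by (intro CollectI exI[of _ "C + D"]) auto
    next
      fix r p assume "p \<in> T"
      then obtain C where C: "C \<ge> 0" "\<forall>y. norm (y - x) \<le> 1 \<longrightarrow> \<bar>ev p y\<bar> \<le> C * norm (y - x) ^ Suc m"
        unfolding T_def by blast
      obtain B where B: "B \<ge> 0" "\<forall>y. norm (y - x) \<le> 1 \<longrightarrow> \<bar>ev r y\<bar> \<le> B * norm (y - x) ^ 0"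
        using Suc.IH
      proof -
        obtain D where D: "D \<ge> 0" "\<forall>y. norm (y - x) \<le> 1 \<longrightarrow> \<bar>ev r y - ev r x\<bar> \<le> D * norm (y - x)"
          using ev_lipschitz by blast
        have "\<bar>ev r y\<bar> \<le> \<bar>ev r x\<bar> + D" if "norm (y - x) \<le> 1" for y
          using D that mult_left_mono[OF that D(1)] by fastforce
        then show thesis using D that[of "\<bar>ev r x\<bar> + D"] by auto
      qed
      have "\<bar>ev (r * p) y\<bar> \<le> (B * C) * norm (y - x) ^ Suc m" if "norm (y - x) \<le> 1" for y
      proof -
        have "\<bar>ev r y\<bar> * \<bar>ev p y\<bar> \<le> B * (C * norm (y - x) ^ Suc m)"
          using B C that by (intro mult_mono) auto
        then show ?thesis by (simp add: abs_mult mult.assoc)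
      qed
      then show "r * p \<in> T" unfolding T_def using B C by (intro CollectI exI[of _ "B * C"]) auto
    qed
    fix a c assume a: "a \<in> mx x" and c: "c \<in> ipow (mx x) m"
    obtain C where C: "C \<ge> 0" "\<forall>y. norm (y - x) \<le> 1 \<longrightarrow> \<bar>ev c y\<bar> \<le> C * norm (y - x) ^ m" using Suc.IH[OF c] by blast
    obtain D where D: "D \<ge> 0" "\<forall>y. norm (y - x) \<le> 1 \<longrightarrow> \<bar>ev a y - ev a x\<bar> \<le> D * norm (y - x)" using ev_lipschitz by blast
    have "\<bar>ev (a * c) y\<bar> \<le> (D * C) * norm (y - x) ^ Suc m" if "norm (y - x) \<le> 1" for y
    proof -
      have "\<bar>ev a y\<bar> * \<bar>ev c y\<bar> \<le> (D * norm (y - x)) * (C * norm (y - x) ^ m)"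
        using C D that a by (intro mult_mono) (auto simp: mx_iff)
      then show ?thesis by (simp add: abs_mult mult_ac)
    qed
    then show "a * c \<in> T" unfolding T_def using C D by (intro CollectI exI[of _ "D * C"]) auto
  qed
  then show ?case using Suc.prems unfolding T_def by blast
qed

lemma pd_ipow: "p \<in> ipow (mx x) (Suc m) \<Longrightarrow> pd i p \<in> ipow (mx x) m"
proof (induction m arbitrary: p)
  case (Suc m)
  define T where "T = {p \<in> ipow (mx x) (Suc (Suc m)). pd i p \<in> ipow (mx x) (Suc m)}"
  have "ipow (mx x) (Suc (Suc m)) \<subseteq> T"
  proof (rule ipow_Suc_least)
    show "rmod.subspace T"
    proof (rule rmod.subspaceI)
      have "pd i 0 = 0" using pd_cst[of i 0] by (simp add: cst_simps)
      then show "0 \<in> T" unfolding T_def using rmod.subspace_0[OF ideal_ipow[of "mx x"]] by (simp del: ipow.simps)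
      show "p + q \<in> T" if "p \<in> T" "q \<in> T" for p q
        using that rmod.subspace_add[OF ideal_ipow[of "mx x"]] unfolding T_def by (simp add: pd_add del: ipow.simps)
      fix r p assume p: "p \<in> T"
      have "p * pd i r \<in> ipow (mx x) (Suc m)"
        using p ipow_Suc_subset[of "mx x" "Suc m"] unfolding T_def by (intro ideal_mult_right[OF ideal_ipow]) blast
      moreover have "r * pd i p \<in> ipow (mx x) (Suc m)"
        using p unfolding T_def by (intro ideal_mult_left[OF ideal_ipow]) blast
      ultimately have "pd i (r * p) \<in> ipow (mx x) (Suc m)"
        unfolding pd_mult by (intro rmod.subspace_add[OF ideal_ipow])
      moreover have "r * p \<in> ipow (mx x) (Suc (Suc m))"
        using p unfolding T_def by (intro ideal_mult_left[OF ideal_ipow]) blast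
      ultimately show "r * p \<in> T" unfolding T_def by blast
    qed
    fix a c assume ac: "a \<in> mx x" "c \<in> ipow (mx x) (Suc m)"
    have "a * pd i c \<in> ipow (mx x) (Suc m)" by (rule ipow_SucI[OF ac(1) Suc.IH[OF ac(2)]])
    then have "pd i (a * c) \<in> ipow (mx x) (Suc m)"
      unfolding pd_mult by (rule rmod.subspace_add[OF ideal_ipow _ ideal_mult_right[OF ideal_ipow ac(2)]])
    then show "a * c \<in> T" unfolding T_def using ipow_SucI[OF ac] by blast
  qed
  then show ?case using Suc.prems unfolding T_def by blast
qed simp

definition rho :: "real ^ 'n \<Rightarrow> ('n::finite) polyfun" where
  "rho x = (\<Sum>i\<in>UNIV. (crd i - cst (x $ i)) * (crd i - cst (x $ i)))"

lemma ev_rho: "ev (rho x) y = norm (y - x) ^ 2"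
  by (simp add: rho_def power2_norm_eq_inner inner_vec_def)

lemma rho_ipow: "rho x \<in> ipow (mx x) 2"
proof -
  have "crd i - cst (x $ i) \<in> mx x" for i by (simp add: mx_iff)
  then have "(crd i - cst (x $ i)) ^ 2 \<in> ipow (mx x) 2" for i by (rule ipow_power)
  then show ?thesis unfolding rho_def by (intro rmod.subspace_sum[OF ideal_ipow]) (simp add: power2_eq_square)
qed

text \<open>At \<open>y = x\<close> the quotient is \<open>0\<close> by the convention \<open>a / 0 = 0\<close>, which is its limit there.\<close>

lemma ratio_bound:
  assumes P: "P \<in> ipow (mx x) (2 * n + m)" and m: "0 < m"
  shows "\<exists>C\<ge>0. \<forall>y. norm (y - x) \<le> 1 \<longrightarrow> \<bar>ev P y / ev (rho x) y ^ n\<bar> \<le> C * norm (y - x) ^ m"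
proof -
  obtain C where C: "C \<ge> 0" "\<forall>y. norm (y - x) \<le> 1 \<longrightarrow> \<bar>ev P y\<bar> \<le> C * norm (y - x) ^ (2 * n + m)"
    using ipow_bound[OF P] by blast
  have "\<bar>ev P y / ev (rho x) y ^ n\<bar> \<le> C * norm (y - x) ^ m" if y: "norm (y - x) \<le> 1" for y
  proof (cases "y = x")
    case True
    have "ev P x = 0" using C(2)[rule_format, of x] m by (simp add: power_0_left)
    then show ?thesis using True m C(1) by simp
  next
    case False
    then have pos: "0 < norm (y - x) ^ (2 * n)" by simp
    have "\<bar>ev P y / ev (rho x) y ^ n\<bar> = \<bar>ev P y\<bar> / norm (y - x) ^ (2 * n)"
      by (simp add: ev_rho power_mult[symmetric] abs_divide)
    also have "\<dots> \<le> C * norm (y - x) ^ m"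
      using C(2) y pos by (simp add: pos_divide_le_eq power_add mult_ac)
    finally show ?thesis .
  qed
  then show ?thesis using C(1) by blast
qed

definition dv :: "real ^ 'n \<Rightarrow> ('n::finite) polyfun \<Rightarrow> 'n polyfun" where
  "dv v p = (\<Sum>i\<in>UNIV. cst (v $ i) * pd i p)"

lemma ev_has_derivative_dv: "(ev p has_derivative (\<lambda>v. ev (dv v p) y)) (at y)"
  using ev_has_derivative[of p y] by (simp add: dv_def mult.commute)

lemma dv_ipow: "p \<in> ipow (mx x) (Suc m) \<Longrightarrow> dv v p \<in> ipow (mx x) m"
  unfolding dv_def by (intro rmod.subspace_sum[OF ideal_ipow] ideal_mult_left[OF ideal_ipow] pd_ipow)

text \<open>Away from \<open>x\<close> this is the quotient rule. At \<open>x\<close> a surplus of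
  two orders in the numerator makes the quotient quadratically small, so the derivative there is
  zero.\<close>

lemma ratio_has_derivative:
  assumes P: "P \<in> ipow (mx x) (2 * n + (m + 2))"
  shows "((\<lambda>y. ev P y / ev (rho x) y ^ n) has_derivative
    (\<lambda>v. ev (rho x * dv v P - cst (of_nat n) * P * dv v (rho x)) y / ev (rho x) y ^ Suc n)) (at y)"
proof (cases "y = x")
  case False
  then have r: "ev (rho x) y \<noteq> 0" by (simp add: ev_rho)
  have "((\<lambda>y. ev (rho x) y ^ n) has_derivative (\<lambda>v. of_nat n * ev (dv v (rho x)) y * ev (rho x) y ^ (n - 1))) (at y)"
    by (rule has_derivative_power[OF ev_has_derivative_dv])
  then have "((\<lambda>y. ev P y / ev (rho x) y ^ n) has_derivative
      (\<lambda>v. (ev (dv v P) y * ev (rho x) y ^ n - ev P y * (of_nat n * ev (dv v (rho x)) y * ev (rho x) y ^ (n - 1)))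
        / (ev (rho x) y ^ n * ev (rho x) y ^ n))) (at y)"
    using r by (intro has_derivative_divide' ev_has_derivative_dv) auto
  moreover have "(ev (dv v P) y * ev (rho x) y ^ n - ev P y * (of_nat n * ev (dv v (rho x)) y * ev (rho x) y ^ (n - 1)))
        / (ev (rho x) y ^ n * ev (rho x) y ^ n)
      = ev (rho x * dv v P - cst (of_nat n) * P * dv v (rho x)) y / ev (rho x) y ^ Suc n" for v
    \<comment> \<open>For \<open>n = 0\<close> the exponent \<open>n - 1\<close> is truncated, but
      its term carries the factor \<open>n\<close>.\<close>
    using r by (cases n) (simp_all add: field_simps)
  ultimately show ?thesis by simp
next
  case True
  obtain C where C: "C \<ge> 0" "\<forall>y. norm (y - x) \<le> 1 \<longrightarrow> \<bar>ev P y / ev (rho x) y ^ n\<bar> \<le> C * norm (y - x) ^ (m + 2)"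
    using ratio_bound[OF P] by auto
  have P0: "ev P x = 0"
  proof -
    have "P \<in> ipow (mx x) (Suc 0)" using ipow_antimono[of "Suc 0" "2 * n + (m + 2)" "mx x"] P by auto
    then show ?thesis using ipow_1[OF ideal_van[of "{x}"]] by (auto simp: mx_iff)
  qed
  have "((\<lambda>y. ev P y / ev (rho x) y ^ n) has_derivative (\<lambda>v. 0)) (at x)"
    unfolding has_derivative_at2
  proof (intro conjI bounded_linear_zero)
    have "((\<lambda>y. C * norm (y - x)) \<longlongrightarrow> C * norm (x - x)) (at x)" by (intro tendsto_intros)
    then have lim: "((\<lambda>y. C * norm (y - x)) \<longlongrightarrow> 0) (at x)" by simp
    show "((\<lambda>y. (1 / norm (y - x)) *\<^sub>R (ev P y / ev (rho x) y ^ n - (ev P x / ev (rho x) x ^ n + 0))) \<longlongrightarrow> 0) (at x)"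
    proof (rule Lim_null_comparison[OF _ lim])
      show "\<forall>\<^sub>F y in at x. norm ((1 / norm (y - x)) *\<^sub>R (ev P y / ev (rho x) y ^ n - (ev P x / ev (rho x) x ^ n + 0))) \<le> C * norm (y - x)"
        unfolding eventually_at
      proof (intro exI[of _ 1] conjI ballI impI)
        fix y assume "y \<noteq> x \<and> dist y x < 1"
        then have y: "0 < norm (y - x)" "norm (y - x) \<le> 1" by (auto simp: dist_norm)
        have "\<bar>ev P y / ev (rho x) y ^ n\<bar> \<le> C * norm (y - x) ^ (m + 2)" using C y by blast
        also have "\<dots> \<le> C * norm (y - x) ^ 2" using y C(1) by (intro mult_left_mono power_decreasing) auto
        finally have "\<bar>ev P y / ev (rho x) y ^ n\<bar> \<le> C * norm (y - x) ^ 2" .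
        moreover have "a / r \<le> C * r" if "a \<le> C * r ^ 2" "0 < r" for a r :: real
          using that by (simp add: pos_divide_le_eq power2_eq_square mult.assoc)
        ultimately have "\<bar>ev P y / ev (rho x) y ^ n\<bar> / norm (y - x) \<le> C * norm (y - x)" using y(1) by blast
        moreover have "norm ((1 / norm (y - x)) *\<^sub>R (ev P y / ev (rho x) y ^ n - (ev P x / ev (rho x) x ^ n + 0)))
            = \<bar>ev P y / ev (rho x) y ^ n\<bar> / norm (y - x)"
          by (simp add: P0 abs_mult mult.commute)
        ultimately show "norm ((1 / norm (y - x)) *\<^sub>R (ev P y / ev (rho x) y ^ n - (ev P x / ev (rho x) x ^ n + 0))) \<le> C * norm (y - x)"
          by (simp only:)
      qed simp
    qed
  qed
  \<comment> \<open>At \<open>x\<close> the denominator is zero, so the stated derivative also has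
    the value 0 by the convention for division.\<close>
  then show ?thesis using True by (simp add: ev_rho)
qed

text \<open>A directional derivative is again such a quotient. Its numerator gains one order and its
  denominator two, so the surplus drops from \<open>k + 2\<close> to \<open>k + 1\<close>; in the
  end a surplus of 1 gives continuity.\<close>

lemma Ck_on_ratio:
  fixes P :: "'n::finite polyfun"
  assumes "P \<in> ipow (mx x) (2 * n + (k + 1))"
  shows "Ck_on k (\<lambda>y. ev P y / ev (rho x) y ^ n) UNIV"
  using assms
proof (induction k arbitrary: P n)
  case 0
  have "isCont (\<lambda>y. ev P y / ev (rho x) y ^ n) y" for y
  proof (cases "y = x")
    case False
    then show ?thesis by (intro continuous_intros isCont_ev) (simp add: ev_rho)
  next
    case True
    obtain C where C: "C \<ge> 0" "\<forall>y. norm (y - x) \<le> 1 \<longrightarrow> \<bar>ev P y / ev (rho x) y ^ n\<bar> \<le> C * norm (y - x) ^ 1"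
      using ratio_bound[of P x n 1] 0 by auto
    have f0: "ev P x / ev (rho x) x ^ n = 0" using C(2)[rule_format, of x] by simp
    have "((\<lambda>y. C * norm (y - x)) \<longlongrightarrow> C * norm (x - x)) (at x)" by (intro tendsto_intros)
    then have lim: "((\<lambda>y. C * norm (y - x)) \<longlongrightarrow> 0) (at x)" by simp
    have "((\<lambda>y. ev P y / ev (rho x) y ^ n) \<longlongrightarrow> 0) (at x)"
    proof (rule Lim_null_comparison[OF _ lim])
      show "\<forall>\<^sub>F y in at x. norm (ev P y / ev (rho x) y ^ n) \<le> C * norm (y - x)"
        unfolding eventually_at using C by (intro exI[of _ 1]) (auto simp: dist_norm)
    qed
    then show ?thesis unfolding True isCont_def f0 .
  qed
  then show ?case by (simp add: continuous_at_imp_continuous_on)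
next
  case (Suc k)
  let ?N = "\<lambda>v. rho x * dv v P - cst (of_nat n) * P * dv v (rho x)"
  have P: "P \<in> ipow (mx x) (2 * n + (k + 2))" using Suc.prems by (simp del: ipow.simps)
  have P': "P \<in> ipow (mx x) (Suc (2 * n + (k + 1)))" using Suc.prems by (simp del: ipow.simps)
  have der: "((\<lambda>y. ev P y / ev (rho x) y ^ n) has_derivative (\<lambda>v. ev (?N v) y / ev (rho x) y ^ Suc n)) (at y)" for y
    by (rule ratio_has_derivative[OF P])
  have "Ck_on k (\<lambda>y. frechet_derivative (\<lambda>y. ev P y / ev (rho x) y ^ n) (at y) v) UNIV" for v
  proof -
    have "frechet_derivative (\<lambda>y. ev P y / ev (rho x) y ^ n) (at y) v = ev (?N v) y / ev (rho x) y ^ Suc n" for y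
      by (rule fun_cong[OF frechet_derivative_at[OF der, symmetric]])
    moreover have "?N v \<in> ipow (mx x) (2 * Suc n + (k + 1))"
    proof (rule rmod.subspace_diff[OF ideal_ipow])
      have "rho x * dv v P \<in> ipow (mx x) (2 + (2 * n + (k + 1)))"
        by (rule ipow_mult[OF rho_ipow dv_ipow[OF P']])
      then show "rho x * dv v P \<in> ipow (mx x) (2 * Suc n + (k + 1))" by (simp del: ipow.simps)
      have "rho x \<in> ipow (mx x) (Suc 1)" using rho_ipow[of x] by (simp add: numeral_2_eq_2 del: ipow.simps)
      then have "P * dv v (rho x) \<in> ipow (mx x) ((2 * n + (k + 2)) + 1)"
        by (intro ipow_mult[OF P] dv_ipow)
      then have "cst (of_nat n) * (P * dv v (rho x)) \<in> ipow (mx x) ((2 * n + (k + 2)) + 1)"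
        by (rule ideal_mult_left[OF ideal_ipow])
      then show "cst (of_nat n) * P * dv v (rho x) \<in> ipow (mx x) (2 * Suc n + (k + 1))"
        by (simp add: mult.assoc del: ipow.simps)
    qed
    ultimately show ?thesis using Suc.IH[of "?N v" "Suc n"] by (simp del: power_Suc)
  qed
  moreover have "(\<lambda>y. ev P y / ev (rho x) y ^ n) differentiable (at y)" for y
    using der unfolding differentiable_def by blast
  ultimately show ?case by simp
qed

subsection \<open>Inverses\<close>

lemma Ck_on_inverse:
  fixes U :: "'a::euclidean_space set"
  assumes U: "open U" and "Ck_on k g U" and nz: "\<And>x. x \<in> U \<Longrightarrow> g x \<noteq> 0"
  shows "Ck_on k (\<lambda>x. inverse (g x)) U"
  using assms(2)
proof (induction k)
  case 0
  then show ?case using nz by (auto intro!: continuous_intros)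
next
  case (Suc k)
  have inv: "Ck_on k (\<lambda>x. inverse (g x)) U" by (rule Suc.IH[OF Ck_on_Suc_le[OF Suc.prems]])
  have der: "((\<lambda>x. inverse (g x)) has_derivative (\<lambda>v. - (inverse (g x) * frechet_derivative g (at x) v * inverse (g x)))) (at x)"
    if "x \<in> U" for x
    using Suc.prems nz[OF that] that by (intro Deriv.has_derivative_inverse) (auto simp: frechet_derivative_works)
  have "Ck_on k (\<lambda>x. frechet_derivative (\<lambda>x. inverse (g x)) (at x) v) U" for v
  proof (rule Ck_on_cong[OF U])
    have "Ck_on k (\<lambda>x. (- 1) * (frechet_derivative g (at x) v * (inverse (g x) * inverse (g x)))) U"
      using Suc.prems by (intro Ck_on_mult[OF U] Ck_on_const inv) simp
    then show "Ck_on k (\<lambda>x. (- 1) * (frechet_derivative g (at x) v * (inverse (g x) * inverse (g x)))) U" .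
    fix x assume "x \<in> U"
    have "frechet_derivative (\<lambda>x. inverse (g x)) (at x) v = - (inverse (g x) * frechet_derivative g (at x) v * inverse (g x))"
      by (rule fun_cong[OF frechet_derivative_at[OF der[OF \<open>x \<in> U\<close>], symmetric]])
    then show "(- 1) * (frechet_derivative g (at x) v * (inverse (g x) * inverse (g x))) = frechet_derivative (\<lambda>x. inverse (g x)) (at x) v"
      by simp
  qed
  then show ?case using der unfolding Ck_on.simps differentiable_def by blast
qed

subsection \<open>Taylor expansion\<close>

lemma ev_segment:
  fixes p :: "'n::finite polyfun"
  shows "\<exists>q. \<forall>s y. ev p (x + s *\<^sub>R (y - x)) = ev (poly q (cst s)) y"
proof (induction p rule: polyfun_induct)
  case (const c)
  show ?case by (intro exI[of _ "[:cst c:]"]) simp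
next
  case (coord i)
  show ?case by (intro exI[of _ "[:cst (x $ i), crd i - cst (x $ i):]"]) simp
next
  case (add p q)
  then obtain a c where "\<forall>s y. ev p (x + s *\<^sub>R (y - x)) = ev (poly a (cst s)) y"
    "\<forall>s y. ev q (x + s *\<^sub>R (y - x)) = ev (poly c (cst s)) y" by blast
  then show ?case by (intro exI[of _ "a + c"]) simp
next
  case (mult p q)
  then obtain a c where "\<forall>s y. ev p (x + s *\<^sub>R (y - x)) = ev (poly a (cst s)) y"
    "\<forall>s y. ev q (x + s *\<^sub>R (y - x)) = ev (poly c (cst s)) y" by blast
  then show ?case by (intro exI[of _ "a * c"]) simp
qed

lemma cst_power: "cst s ^ n = cst (s ^ n)"
  by (intro polyfun_eqI) simp

text \<open>The induction hypothesis is applied to the partial derivatives, and their approximating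
  polynomials are integrated along the segments from \<open>x\<close>. The mean value theorem on a
  segment bounds the error and supplies the additional factor \<open>norm (y - x)\<close>.\<close>

lemma Ck_taylor:
  fixes f :: "real ^ 'n::finite \<Rightarrow> real"
  assumes U: "open U" and x: "x \<in> U" and "Ck_on k f U"
  shows "\<exists>T. \<forall>\<epsilon>>0. \<exists>\<delta>>0. \<forall>y. norm (y - x) < \<delta> \<longrightarrow> \<bar>f y - ev T y\<bar> \<le> \<epsilon> * norm (y - x) ^ k"
  using assms(3)
proof (induction k arbitrary: f)
  case 0
  then have "continuous (at x) f" using U x by (simp add: continuous_on_eq_continuous_at)
  then have "\<forall>\<epsilon>>0. \<exists>\<delta>>0. \<forall>y. dist y x < \<delta> \<longrightarrow> dist (f y) (f x) < \<epsilon>" unfolding continuous_at_eps_delta by (simp add: dist_norm)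
  then show ?case
    by (intro exI[of _ "cst (f x)"]) (simp add: dist_norm, meson less_imp_le)
next
  case (Suc k)
  have fd: "(f has_derivative frechet_derivative f (at y)) (at y)" if "y \<in> U" for y
    using Suc.prems that by (auto simp: frechet_derivative_works)
  have "\<forall>i. \<exists>T. \<forall>\<epsilon>>0. \<exists>\<delta>>0. \<forall>y. norm (y - x) < \<delta> \<longrightarrow>
      \<bar>frechet_derivative f (at y) (axis i 1) - ev T y\<bar> \<le> \<epsilon> * norm (y - x) ^ k"
    using Suc.prems by (intro allI Suc.IH) simp
  from choice[OF this] obtain T :: "'n \<Rightarrow> 'n polyfun" where
    T: "\<forall>i. \<forall>\<epsilon>>0. \<exists>\<delta>>0. \<forall>y. norm (y - x) < \<delta> \<longrightarrow>
      \<bar>frechet_derivative f (at y) (axis i 1) - ev (T i) y\<bar> \<le> \<epsilon> * norm (y - x) ^ k" by (rule exE)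
  have "\<forall>i. \<exists>q. \<forall>s y. ev (T i) (x + s *\<^sub>R (y - x)) = ev (poly q (cst s)) y" by (intro allI ev_segment)
  from choice[OF this] obtain q where
    q: "\<forall>i. \<forall>s y. ev (T i) (x + s *\<^sub>R (y - x)) = ev (poly (q i) (cst s)) y" by (rule exE)
  \<comment> \<open>The primitive in \<open>s\<close> of \<open>T i\<close> along the segment from
    \<open>x\<close> to \<open>y\<close>, with value 0 at \<open>s = 0\<close>; at
    \<open>s = 1\<close> it is a polynomial function of \<open>y\<close>.\<close>
  define A where "A i s y = (\<Sum>j\<le>Polynomial.degree (q i). ev (Polynomial.coeff (q i) j) y * s ^ Suc j / real (Suc j))" for i s y
  have dA: "((\<lambda>s. A i s y) has_real_derivative ev (T i) (x + s *\<^sub>R (y - x))) (at s)" for i s y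
  proof -
    have "((\<lambda>s. A i s y) has_real_derivative (\<Sum>j\<le>Polynomial.degree (q i). ev (Polynomial.coeff (q i) j) y * (real (Suc j) * s ^ j) / real (Suc j))) (at s)"
      unfolding A_def by (auto intro!: derivative_eq_intros sum.cong simp del: of_nat_Suc power_Suc)
    moreover have "(\<Sum>j\<le>Polynomial.degree (q i). ev (Polynomial.coeff (q i) j) y * (real (Suc j) * s ^ j) / real (Suc j)) = ev (poly (q i) (cst s)) y"
      by (simp add: poly_altdef cst_power del: of_nat_Suc)
    ultimately show ?thesis using q by simp
  qed
  define TT where "TT = cst (f x) + (\<Sum>i\<in>UNIV. (crd i - cst (x $ i)) * (\<Sum>j\<le>Polynomial.degree (q i). Polynomial.coeff (q i) j * cst (1 / real (Suc j))))"
  have TT: "ev TT y = f x + (\<Sum>i\<in>UNIV. (y $ i - x $ i) * A i 1 y)" for y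
    unfolding TT_def A_def by simp
  have "\<exists>\<delta>>0. \<forall>y. norm (y - x) < \<delta> \<longrightarrow> \<bar>f y - ev TT y\<bar> \<le> \<epsilon> * norm (y - x) ^ Suc k" if \<epsilon>: "\<epsilon> > 0" for \<epsilon>
  proof -
    \<comment> \<open>The error is a sum with one term for each coordinate.\<close>
    define \<epsilon>' where "\<epsilon>' = \<epsilon> / real CARD('n)"
    have \<epsilon>': "\<epsilon>' > 0" using \<epsilon> by (simp add: \<epsilon>'_def)
    have "\<forall>i. \<exists>\<delta>>0. \<forall>y. norm (y - x) < \<delta> \<longrightarrow>
      \<bar>frechet_derivative f (at y) (axis i 1) - ev (T i) y\<bar> \<le> \<epsilon>' * norm (y - x) ^ k" using T \<epsilon>' by simp
    from choice[OF this] obtain d where d: "\<forall>i. d i > 0 \<and> (\<forall>y. norm (y - x) < d i \<longrightarrow>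
      \<bar>frechet_derivative f (at y) (axis i 1) - ev (T i) y\<bar> \<le> \<epsilon>' * norm (y - x) ^ k)" by (rule exE)
    obtain r where r: "r > 0" "ball x r \<subseteq> U" using U x openE by blast
    define \<delta> where "\<delta> = min r (Min (range d))"
    have "\<delta> > 0" using r d by (simp add: \<delta>_def)
    have \<delta>d: "\<delta> \<le> d i" for i unfolding \<delta>_def by (rule min.coboundedI2) simp
    have "\<bar>f y - ev TT y\<bar> \<le> \<epsilon> * norm (y - x) ^ Suc k" if y: "norm (y - x) < \<delta>" for y
    proof -
      define \<phi> where "\<phi> s = f (x + s *\<^sub>R (y - x)) - (\<Sum>i\<in>UNIV. (y $ i - x $ i) * A i s y)" for s
      define \<psi> where "\<psi> s = (\<Sum>i\<in>UNIV. (y $ i - x $ i) *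
        (frechet_derivative f (at (x + s *\<^sub>R (y - x))) (axis i 1) - ev (T i) (x + s *\<^sub>R (y - x))))" for s
      have seg: "norm ((x + s *\<^sub>R (y - x)) - x) \<le> norm (y - x)" if "0 \<le> s" "s \<le> 1" for s
        using that by (simp add: mult_left_le_one_le)
      have D: "(\<phi> has_real_derivative \<psi> s) (at s)" if s: "0 \<le> s" "s \<le> 1" for s
      proof -
        let ?p = "x + s *\<^sub>R (y - x)"
        have pU: "?p \<in> U" using seg[OF s] y r by (auto simp: \<delta>_def dist_norm norm_minus_commute)
        have "((\<lambda>s. x + s *\<^sub>R (y - x)) has_derivative (\<lambda>h. h *\<^sub>R (y - x))) (at s)"
          by (auto intro!: derivative_eq_intros)
        from diff_chain_at[OF this fd[OF pU]]
        have "((\<lambda>s. f (x + s *\<^sub>R (y - x))) has_derivative (\<lambda>h. frechet_derivative f (at ?p) (h *\<^sub>R (y - x)))) (at s)"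
          by (simp add: o_def)
        moreover have lin: "linear (frechet_derivative f (at ?p))" using fd[OF pU] by (rule has_derivative_linear)
        then have "frechet_derivative f (at ?p) (h *\<^sub>R (y - x)) = h * frechet_derivative f (at ?p) (y - x)" for h
          by (simp add: linear_cmul)
        ultimately have "((\<lambda>s. f (x + s *\<^sub>R (y - x))) has_real_derivative frechet_derivative f (at ?p) (y - x)) (at s)"
          by (simp add: has_field_derivative_def mult.commute[of _ "frechet_derivative f (at ?p) (y - x)"])
        moreover have "((\<lambda>s. \<Sum>i\<in>UNIV. (y $ i - x $ i) * A i s y) has_real_derivative (\<Sum>i\<in>UNIV. (y $ i - x $ i) * ev (T i) ?p)) (at s)"
          by (intro DERIV_sum DERIV_cmult dA)
        ultimately have "(\<phi> has_real_derivative (frechet_derivative f (at ?p) (y - x) - (\<Sum>i\<in>UNIV. (y $ i - x $ i) * ev (T i) ?p))) (at s)"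
          unfolding \<phi>_def by (rule DERIV_diff)
        moreover have "frechet_derivative f (at ?p) (y - x) = (\<Sum>i\<in>UNIV. (y $ i - x $ i) * frechet_derivative f (at ?p) (axis i 1))"
        proof -
          have "frechet_derivative f (at ?p) (y - x) = frechet_derivative f (at ?p) (\<Sum>i\<in>UNIV. (y - x) $ i *\<^sub>R axis i 1)"
            by (simp only: basis_expansion[of "y - x", unfolded scalar_mult_eq_scaleR])
          then show ?thesis using lin by (simp add: linear_sum linear_cmul)
        qed
        ultimately show ?thesis by (simp add: \<psi>_def right_diff_distrib sum_subtractf)
      qed
      obtain z where z: "0 < z" "z < 1" "\<phi> 1 - \<phi> 0 = (1 - 0) * \<psi> z"
        using MVT2[of 0 1 \<phi> \<psi>] D by auto
      let ?p = "x + z *\<^sub>R (y - x)"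
      have p: "norm (?p - x) \<le> norm (y - x)" using seg z by simp
      have "\<bar>(y $ i - x $ i) * (frechet_derivative f (at ?p) (axis i 1) - ev (T i) ?p)\<bar> \<le> norm (y - x) * (\<epsilon>' * norm (y - x) ^ k)" for i
      proof -
        have "\<bar>frechet_derivative f (at ?p) (axis i 1) - ev (T i) ?p\<bar> \<le> \<epsilon>' * norm (?p - x) ^ k"
          using d p y \<delta>d[of i] by (meson less_le_trans order_le_less_trans)
        also have "\<dots> \<le> \<epsilon>' * norm (y - x) ^ k" using p \<epsilon>' by (intro mult_left_mono power_mono) auto
        finally show ?thesis unfolding abs_mult using component_le_norm_cart[of "y - x" i] by (intro mult_mono) auto
      qed
      then have "\<bar>\<psi> z\<bar> \<le> (\<Sum>i\<in>(UNIV :: 'n set). norm (y - x) * (\<epsilon>' * norm (y - x) ^ k))"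
        unfolding \<psi>_def by (intro order_trans[OF sum_abs] sum_mono)
      also have "\<dots> = \<epsilon> * norm (y - x) ^ Suc k" by (simp add: \<epsilon>'_def)
      finally have "\<bar>\<psi> z\<bar> \<le> \<epsilon> * norm (y - x) ^ Suc k" .
      moreover have "\<phi> 1 - \<phi> 0 = f y - ev TT y" unfolding TT \<phi>_def by (simp add: A_def)
      ultimately show ?thesis using z(3) by simp
    qed
    then show ?thesis using \<open>\<delta> > 0\<close> by blast
  qed
  then show ?case by blast
qed

section \<open>Regulous functions along arcs\<close>

lemma Ck_on_continuous: "Ck_on k f U \<Longrightarrow> continuous_on U f"
proof (induction k arbitrary: f)
  case (Suc k)
  then show ?case using Ck_on_Suc_le by blast
qed simp

context adapted_coords begin

lemma arc_Ck_tendsto: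
  assumes X: "real_algebraic_set X" and f: "Ck_function k X f"
  shows "((\<lambda>t. f (arc v t)) \<longlongrightarrow> f x) (at 0)"
proof -
  obtain U g where g: "open U" "x \<in> U" "Ck_on k g U" "\<forall>y\<in>X \<inter> U. f y = g y"
    using f xX unfolding Ck_function_def by blast
  have "isCont g x" using Ck_on_continuous[OF g(3)] g(1,2) by (simp add: continuous_on_eq_continuous_at)
  then have "((\<lambda>t. g (arc v t)) \<longlongrightarrow> g x) (at 0)" using arc_tendsto by (rule isCont_tendsto_compose)
  moreover have "\<forall>\<^sub>F t in at 0. g (arc v t) = f (arc v t)"
    using arc_in_X[OF X, of v] topological_tendstoD[OF arc_tendsto g(1,2), of v]
    by eventually_elim (use g(4) in auto)
  ultimately have "((\<lambda>t. f (arc v t)) \<longlongrightarrow> g x) (at 0)" by (rule Lim_transform_eventually)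
  then show ?thesis using g(2,4) xX by simp
qed

lemma arc_Ck_taylor:
  assumes X: "real_algebraic_set X" and f: "Ck_function k X f" and fx: "f x = 0" and k: "0 < k"
  shows "\<exists>T. ev T x = 0 \<and> (\<forall>v. ((\<lambda>t. (f (arc v t) - ev T (arc v t)) / t ^ k) \<longlongrightarrow> 0) (at 0))"
proof -
  obtain U g where g: "open U" "x \<in> U" "Ck_on k g U" "\<forall>y\<in>X \<inter> U. f y = g y"
    using f xX unfolding Ck_function_def by blast
  obtain T where T': "\<forall>\<epsilon>>0. \<exists>\<delta>>0. \<forall>y. norm (y - x) < \<delta> \<longrightarrow> \<bar>g y - ev T y\<bar> \<le> \<epsilon> * norm (y - x) ^ k"
    using Ck_taylor[OF g(1-3)] by (elim exE)
  note T = T'[rule_format]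
  have "ev T x = 0"
  proof -
    obtain \<delta> where "\<delta> > 0" "\<forall>y. norm (y - x) < \<delta> \<longrightarrow> \<bar>g y - ev T y\<bar> \<le> 1 * norm (y - x) ^ k" using T[of 1] by auto
    then have "\<bar>g x - ev T x\<bar> \<le> 1 * norm (x - x) ^ k" by (metis diff_self norm_zero)
    then show ?thesis using k fx g(2,4) xX by (simp add: power_0_left)
  qed
  moreover have "((\<lambda>t. (f (arc v t) - ev T (arc v t)) / t ^ k) \<longlongrightarrow> 0) (at 0)" for v
  proof (rule tendstoI)
    fix e :: real assume e: "e > 0"
    \<comment> \<open>The arc stays within \<open>C * \<bar>t\<bar>\<close> of \<open>x\<close> for
      small \<open>t\<close>, so a remainder that is small against the distance is small against
      \<open>t\<close>.\<close>
    define C where "C = norm (vel v) + 1"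
    have C: "C > 0" by (simp add: C_def add_nonneg_pos)
    obtain \<delta> where \<delta>: "\<delta> > 0" "\<forall>y. norm (y - x) < \<delta> \<longrightarrow> \<bar>g y - ev T y\<bar> \<le> (e / (2 * C ^ k)) * norm (y - x) ^ k"
      using T[of "e / (2 * C ^ k)"] e C by auto
    have "((\<lambda>t. norm ((1 / t) *\<^sub>R (arc v t - x))) \<longlongrightarrow> norm (vel v)) (at 0)" by (intro tendsto_norm arc_vel)
    then have "\<forall>\<^sub>F t in at 0. norm ((1 / t) *\<^sub>R (arc v t - x)) < C"
      by (rule order_tendstoD) (simp add: C_def)
    moreover have "\<forall>\<^sub>F t in at 0. dist (arc v t) x < \<delta>" by (rule tendstoD[OF arc_tendsto \<delta>(1)])
    moreover have "\<forall>\<^sub>F t in at 0. t \<noteq> (0 :: real)" by (simp add: eventually_at_filter)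
    ultimately show "\<forall>\<^sub>F t in at 0. dist ((f (arc v t) - ev T (arc v t)) / t ^ k) 0 < e"
      using arc_in_X[OF X, of v] topological_tendstoD[OF arc_tendsto g(1,2), of v]
    proof eventually_elim
      case (elim t)
      have "norm (arc v t - x) / \<bar>t\<bar> < C" using elim(1) by simp
      then have n: "norm (arc v t - x) \<le> C * \<bar>t\<bar>" 
        using elim(3) pos_divide_less_eq[of "\<bar>t\<bar>" "norm (arc v t - x)" C] by simp
      have fg: "f (arc v t) = g (arc v t)" using g(4) elim(4,5) by blast
      have "norm (arc v t - x) < \<delta>" using elim(2) by (simp add: dist_norm)
      then have "\<bar>f (arc v t) - ev T (arc v t)\<bar> \<le> (e / (2 * C ^ k)) * norm (arc v t - x) ^ k"
        unfolding fg by (rule \<delta>(2)[rule_format])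
      also have "\<dots> \<le> (e / (2 * C ^ k)) * (C * \<bar>t\<bar>) ^ k" 
        using e C by (intro mult_left_mono power_mono n norm_ge_zero) simp
      also have "\<dots> = (e / 2) * \<bar>t\<bar> ^ k"
      proof -
        have "(e / (2 * c)) * (c * q) = (e / 2) * q" if "c \<noteq> 0" for c q using that by simp
        moreover have "C ^ k \<noteq> 0" using C by simp
        ultimately show ?thesis unfolding power_mult_distrib by blast
      qed
      finally have le: "\<bar>f (arc v t) - ev T (arc v t)\<bar> \<le> (e / 2) * \<bar>t\<bar> ^ k" .
      have "0 < \<bar>t\<bar> ^ k" using elim(3) by simp
      then have "\<bar>f (arc v t) - ev T (arc v t)\<bar> / \<bar>t\<bar> ^ k \<le> e / 2" using le by (rule pos_divide_le_eq[THEN iffD2])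
      also have "e / 2 < e" using e by simp
      finally show ?case unfolding dist_real_def diff_zero abs_divide power_abs .
    qed
  qed
  ultimately show ?thesis by (intro exI[of _ T] conjI allI)
qed

text \<open>The converse of \<open>flow_order\<close>: a limit of the quotient forces the lower
  coefficients to vanish, since each of them is itself the limit of a quotient that tends to
  0.\<close>

lemma tay_eq_limit:
  assumes "((\<lambda>t. ev p (arc v t) / t ^ m) \<longlongrightarrow> L) (at 0)"
  shows "n < m \<Longrightarrow> Wd.tay v x p $$ n = 0" and "Wd.tay v x p $$ m = L"
proof -
  have low: "Wd.tay v x p $$ n = 0" if "n < m" for n
    using that
  proof (induction n rule: less_induct)
    case (less n)
    have "((\<lambda>t. ev p (arc v t) / t ^ m * t ^ (m - n)) \<longlongrightarrow> L * 0 ^ (m - n)) (at 0)"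
      by (intro tendsto_intros assms)
    then have "((\<lambda>t. ev p (arc v t) / t ^ m * t ^ (m - n)) \<longlongrightarrow> 0) (at 0)" using less.prems by (simp add: power_0_left)
    moreover have "\<forall>\<^sub>F t in at 0. ev p (arc v t) / t ^ m * t ^ (m - n) = ev p (arc v t) / t ^ n"
      using less.prems by (auto simp: eventually_at_filter power_diff)
    ultimately have *: "((\<lambda>t. ev p (arc v t) / t ^ n) \<longlongrightarrow> 0) (at 0)" by (rule Lim_transform_eventually)
    have "((\<lambda>t. ev p (arc v t) / t ^ n) \<longlongrightarrow> Wd.tay v x p $$ n) (at 0)"
    proof (rule Wd.flow_order)
      fix l assume "l < n"
      then show "Wd.tay v x p $$ l = 0" using less.IH[of l] less.prems by simp
    qed
    from LIM_unique[OF this *] show ?case .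
  qed
  show "n < m \<Longrightarrow> Wd.tay v x p $$ n = 0" by (rule low)
  have "((\<lambda>t. ev p (arc v t) / t ^ m) \<longlongrightarrow> Wd.tay v x p $$ m) (at 0)" by (rule Wd.flow_order) (rule low)
  from LIM_unique[OF this assms] show "Wd.tay v x p $$ m = L" .
qed

lemma tay_subdegree_limit:
  assumes "Wd.tay v x q \<noteq> 0"
  shows "((\<lambda>t. ev q (arc v t) / t ^ subdegree (Wd.tay v x q)) \<longlongrightarrow> Wd.tay v x q $$ subdegree (Wd.tay v x q)) (at 0)"
  by (rule Wd.flow_order) (rule nth_less_subdegree_zero)

lemma arc_nonzero:
  assumes "Wd.tay v x q \<noteq> 0"
  shows "\<forall>\<^sub>F t in at 0. ev q (arc v t) \<noteq> 0"
proof -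
  have "Wd.tay v x q $$ subdegree (Wd.tay v x q) \<noteq> 0" by (rule nth_subdegree_nonzero[OF assms])
  from tendsto_imp_eventually_ne[OF tay_subdegree_limit[OF assms] this]
  have "\<forall>\<^sub>F t in at 0. ev q (arc v t) / t ^ subdegree (Wd.tay v x q) \<noteq> 0" .
  then show ?thesis
  proof eventually_elim
    case (elim t)
    then show ?case by (rule contrapos_nn) (simp only: div_0)
  qed
qed

lemma arc_zero:
  assumes "Wd.tay v x q = 0"
  shows "\<forall>\<^sub>F t in at 0. ev q (arc v t) = 0"
proof -
  obtain \<tau> where \<tau>: "0 < \<tau>" "\<forall>p t. \<bar>t\<bar> < \<tau> \<longrightarrow> (\<lambda>n. Wd.tay v x p $$ n * t ^ n) sums ev p (arc v t)"
    using Wd.flow_sums[of v x] by (elim exE conjE)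
  have "ev q (arc v t) = 0" if t: "\<bar>t\<bar> < \<tau>" for t
  proof -
    have "(\<lambda>n. 0) sums ev q (arc v t)" using \<tau>(2)[rule_format, OF t, of q] by (simp add: assms)
    from sums_unique2[OF this sums_zero] show ?thesis .
  qed
  then show ?thesis unfolding eventually_at using \<tau>(1) by (intro exI[of _ \<tau>]) (auto simp: dist_real_def)
qed

text \<open>Along the arc \<open>f\<close> is a quotient of power series with a denominator that is
  not identically zero. Tending to 0 means positive order, and orders are integers; continuity alone
  would allow growth like a square root of \<open>\<bar>t\<bar>\<close>.\<close>

lemma arc_rational_order:
  assumes X: "real_algebraic_set X" and f: "((\<lambda>t. f (arc v t)) \<longlongrightarrow> 0) (at 0)"
    and U: "regular_function U f" "\<And>y. y \<in> X \<Longrightarrow> ev \<eta> y \<noteq> 0 \<Longrightarrow> y \<in> U" and \<eta>: "Wd.tay v x \<eta> \<noteq> 0"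
  shows "\<exists>L. ((\<lambda>t. f (arc v t) / t) \<longlongrightarrow> L) (at 0)"
proof -
  obtain p' q' where "real_polynomial_function p'" "real_polynomial_function q'"
    "\<forall>y\<in>U. q' y \<noteq> 0 \<and> f y = p' y / q' y" using U(1) unfolding regular_function_def by blast
  then have "\<forall>y\<in>U. ev (Polyfun q') y \<noteq> 0 \<and> f y = ev (Polyfun p') y / ev (Polyfun q') y" by (simp add: ev_Polyfun)
  then obtain p q where pq: "\<forall>y\<in>U. ev q y \<noteq> 0 \<and> f y = ev p y / ev q y" by blast
  have arcU: "\<forall>\<^sub>F t in at 0. arc v t \<in> U"
    using arc_in_X[OF X, of v] arc_nonzero[OF \<eta>] by eventually_elim (rule U(2))
  have q0: "Wd.tay v x q \<noteq> 0"
  proof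
    assume "Wd.tay v x q = 0"
    from arc_zero[OF this] arcU have "\<forall>\<^sub>F t in at (0 :: real). False" by eventually_elim (use pq in blast)
    then show False by simp
  qed
  define m where "m = subdegree (Wd.tay v x q)"
  define c where "c = Wd.tay v x q $$ m"
  have c0: "c \<noteq> 0" using q0 by (simp add: c_def m_def)
  have ql: "((\<lambda>t. ev q (arc v t) / t ^ m) \<longlongrightarrow> c) (at 0)" unfolding m_def c_def by (rule tay_subdegree_limit[OF q0])
  have "((\<lambda>t. f (arc v t) * (ev q (arc v t) / t ^ m)) \<longlongrightarrow> 0 * c) (at 0)" by (intro tendsto_mult f ql)
  moreover have "\<forall>\<^sub>F t in at 0. f (arc v t) * (ev q (arc v t) / t ^ m) = ev p (arc v t) / t ^ m"
    using arcU by eventually_elim (use pq in simp)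
  ultimately have "((\<lambda>t. ev p (arc v t) / t ^ m) \<longlongrightarrow> 0 * c) (at 0)" by (rule Lim_transform_eventually)
  then have "((\<lambda>t. ev p (arc v t) / t ^ m) \<longlongrightarrow> 0) (at 0)" by simp
  note low = tay_eq_limit[OF this]
  have "((\<lambda>t. ev p (arc v t) / t ^ Suc m) \<longlongrightarrow> Wd.tay v x p $$ Suc m) (at 0)"
    by (rule Wd.flow_order) (use low in \<open>auto simp: less_Suc_eq\<close>)
  then have "((\<lambda>t. (ev p (arc v t) / t ^ Suc m) / (ev q (arc v t) / t ^ m)) \<longlongrightarrow> Wd.tay v x p $$ Suc m / c) (at 0)"
    by (rule tendsto_divide[OF _ ql c0])
  moreover have "\<forall>\<^sub>F t in at 0. t \<noteq> (0 :: real)" by (simp add: eventually_at_filter)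
  with arcU have "\<forall>\<^sub>F t in at 0. (ev p (arc v t) / t ^ Suc m) / (ev q (arc v t) / t ^ m) = f (arc v t) / t"
    by eventually_elim (use pq in \<open>simp add: field_simps\<close>)
  ultimately have "((\<lambda>t. f (arc v t) / t) \<longlongrightarrow> Wd.tay v x p $$ Suc m / c) (at 0)" by (rule Lim_transform_eventually)
  then show ?thesis by (rule exI)
qed

text \<open>The \<open>(k + 1)\<close>-st order coefficient of a sum of products of \<open>k\<close>-regulous functions vanishing
  at \<open>x\<close> depends polynomially on the direction.\<close>

definition poly_leading :: "nat \<Rightarrow> (real ^ 'n \<Rightarrow> real) set \<Rightarrow> real ^ 'n \<Rightarrow> real ^ 'n \<Rightarrow> bool" where
  "poly_leading k A v0 v1 \<longleftrightarrow> (\<forall>h. (\<forall>a\<in>A. Ck_function k X (h a) \<and> h a x = 0) \<longrightarrow>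
     (\<exists>\<pi> E. finite E \<and> (\<forall>\<beta> L. \<beta> \<notin> E \<longrightarrow>
       ((\<lambda>t. (\<Sum>a\<in>A. h a (arc (v0 + \<beta> *\<^sub>R v1) t) * a (arc (v0 + \<beta> *\<^sub>R v1) t)) / t ^ Suc k) \<longlongrightarrow> L) (at 0) \<longrightarrow>
       L = poly \<pi> \<beta>)))"

text \<open>Both factors of each product are polynomials up to o(t^k) and are O(t), so replacing
  them by these polynomials changes the product by o(t^(k+1)). The claim is thereby reduced to
  \<open>tay_line_poly\<close>.\<close>

lemma poly_leading_pos:
  assumes X: "real_algebraic_set X" and k: "0 < k" and A: "finite A" "\<And>a. a \<in> A \<Longrightarrow> Ck_function k X a \<and> a x = 0"
  shows "poly_leading k A v0 v1"
  unfolding poly_leading_def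
proof (intro allI impI)
  fix h assume h: "\<forall>a\<in>A. Ck_function k X (h a) \<and> h a x = 0"
  define good where "good f T \<longleftrightarrow> ev T x = 0 \<and> (\<forall>v. ((\<lambda>t. (f (arc v t) - ev T (arc v t)) / t ^ k) \<longlongrightarrow> 0) (at 0))" for f T
  have "\<forall>a\<in>A. \<exists>T. good a T" unfolding good_def using A(2) by (intro ballI arc_Ck_taylor[OF X _ _ k]) simp_all
  from bchoice[OF this] obtain T where T: "\<forall>a\<in>A. good a (T a)" by (rule exE)
  have "\<forall>a\<in>A. \<exists>T. good (h a) T" unfolding good_def using h by (intro ballI arc_Ck_taylor[OF X _ _ k]) simp_all
  from bchoice[OF this] obtain H where H: "\<forall>a\<in>A. good (h a) (H a)" by (rule exE)
  define G where "G = (\<Sum>a\<in>A. H a * T a)"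
  have quot: "((\<lambda>t. ev T (arc v t) / t) \<longlongrightarrow> Wd.tay v x T $$ 1) (at 0)" if "ev T x = 0" for T v
    using Wd.flow_order[of 1 v x T] that by (simp add: Wd.tay_0)
  have diff: "((\<lambda>t. (h a (arc v t) * a (arc v t) - ev (H a * T a) (arc v t)) / t ^ Suc k) \<longlongrightarrow> 0) (at 0)"
    if a: "a \<in> A" for a v
  proof -
    have ga: "good a (T a)" and gh: "good (h a) (H a)" using T H a by auto
    let ?R = "\<lambda>t. (a (arc v t) - ev (T a) (arc v t)) / t ^ k" and ?Q = "\<lambda>t. (h a (arc v t) - ev (H a) (arc v t)) / t ^ k"
    have R: "(?R \<longlongrightarrow> 0) (at 0)" by (rule ga[unfolded good_def, THEN conjunct2, THEN spec])
    have Q: "(?Q \<longlongrightarrow> 0) (at 0)" by (rule gh[unfolded good_def, THEN conjunct2, THEN spec])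
    have Ta: "((\<lambda>t. ev (T a) (arc v t) / t) \<longlongrightarrow> Wd.tay v x (T a) $$ 1) (at 0)"
      and Ha: "((\<lambda>t. ev (H a) (arc v t) / t) \<longlongrightarrow> Wd.tay v x (H a) $$ 1) (at 0)"
      by (rule quot[OF ga[unfolded good_def, THEN conjunct1]], rule quot[OF gh[unfolded good_def, THEN conjunct1]])
    \<comment> \<open>The difference \<open>h a * a - H a * T a\<close> is split as
      \<open>(h a - H a) * a + H a * (a - T a)\<close>. In each summand the difference is divided by
      \<open>t ^ k\<close> and the other factor by \<open>t\<close>.\<close>
    have lim: "((\<lambda>t. ?Q t * (?R t * t ^ (k - 1) + ev (T a) (arc v t) / t) + (ev (H a) (arc v t) / t) * ?R t) \<longlongrightarrow>
      0 * (0 * 0 ^ (k - 1) + Wd.tay v x (T a) $$ 1) + Wd.tay v x (H a) $$ 1 * 0) (at 0)"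
      by (rule tendsto_add[OF tendsto_mult[OF Q tendsto_add[OF tendsto_mult[OF R tendsto_power[OF tendsto_ident_at]] Ta]]
            tendsto_mult[OF Ha R]])
    have "\<forall>\<^sub>F t in at 0. t \<noteq> (0 :: real)" by (simp add: eventually_at_filter)
    then have "\<forall>\<^sub>F t in at 0. ?Q t * (?R t * t ^ (k - 1) + ev (T a) (arc v t) / t) + (ev (H a) (arc v t) / t) * ?R t
        = (h a (arc v t) * a (arc v t) - ev (H a * T a) (arc v t)) / t ^ Suc k"
    proof eventually_elim
      case (elim t)
      obtain l where l: "k = Suc l" using k gr0_implies_Suc by blast
      have "(r / t ^ k) * t ^ (k - 1) = r / t" for r :: real using elim by (simp add: l)
      then have e: "?R t * t ^ (k - 1) + ev (T a) (arc v t) / t = a (arc v t) / t"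
        using elim by (simp add: add_divide_distrib[symmetric])
      have alg: "(p - P) / s * (q / t) + P / t * ((q - Q) / s) = (p * q - P * Q) / (t * s)"
        if "s \<noteq> 0" for p P q Q s :: real
        using elim that by (simp add: field_simps)
      show ?case unfolding e power_Suc ev_simps by (rule alg) (use elim in simp)
    qed
    from Lim_transform_eventually[OF lim this] show ?thesis by simp
  qed
  obtain \<pi> where \<pi>: "\<forall>\<beta>. Wd.tay (v0 + \<beta> *\<^sub>R v1) x G $$ Suc k = poly \<pi> \<beta>"
    using tay_line_poly[of v0 v1 G "Suc k"] by (rule exE)
  have "L = poly \<pi> \<beta>"
    if L: "((\<lambda>t. (\<Sum>a\<in>A. h a (arc (v0 + \<beta> *\<^sub>R v1) t) * a (arc (v0 + \<beta> *\<^sub>R v1) t)) / t ^ Suc k) \<longlongrightarrow> L) (at 0)" for \<beta> L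
  proof -
    let ?v = "v0 + \<beta> *\<^sub>R v1"
    have "((\<lambda>t. \<Sum>a\<in>A. (h a (arc ?v t) * a (arc ?v t) - ev (H a * T a) (arc ?v t)) / t ^ Suc k) \<longlongrightarrow> (\<Sum>a\<in>A. 0)) (at 0)"
      by (intro tendsto_sum diff)
    with L have "((\<lambda>t. (\<Sum>a\<in>A. h a (arc ?v t) * a (arc ?v t)) / t ^ Suc k
        - (\<Sum>a\<in>A. (h a (arc ?v t) * a (arc ?v t) - ev (H a * T a) (arc ?v t)) / t ^ Suc k)) \<longlongrightarrow> L - (\<Sum>a\<in>A. 0)) (at 0)"
      by (rule tendsto_diff)
    moreover have "(\<Sum>a\<in>A. h a (arc ?v t) * a (arc ?v t)) / t ^ Suc k
        - (\<Sum>a\<in>A. (h a (arc ?v t) * a (arc ?v t) - ev (H a * T a) (arc ?v t)) / t ^ Suc k) = ev G (arc ?v t) / t ^ Suc k" for t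
      by (simp add: G_def sum_divide_distrib[symmetric] diff_divide_distrib[symmetric] sum_subtractf del: power_Suc)
    ultimately have "((\<lambda>t. ev G (arc ?v t) / t ^ Suc k) \<longlongrightarrow> L) (at 0)" by simp
    then have "Wd.tay ?v x G $$ Suc k = L" by (rule tay_eq_limit(2))
    then show ?thesis using \<pi> by simp
  qed
  then show "\<exists>\<pi> E. finite E \<and> (\<forall>\<beta> L. \<beta> \<notin> E \<longrightarrow>
       ((\<lambda>t. (\<Sum>a\<in>A. h a (arc (v0 + \<beta> *\<^sub>R v1) t) * a (arc (v0 + \<beta> *\<^sub>R v1) t)) / t ^ Suc k) \<longlongrightarrow> L) (at 0) \<longrightarrow>
       L = poly \<pi> \<beta>)"
    by (intro exI[of _ \<pi>] exI[of _ "{}"] conjI allI impI finite.emptyI)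
qed

text \<open>Each generator is O(t) along the arc and its cofactor tends to 0, so the coefficient of
  order 1 is zero. The exceptional \<open>\<beta>\<close> are roots of a nonzero polynomial giving
  one Taylor coefficient of \<open>\<eta>\<close> on the line.\<close>

lemma poly_leading_zero:
  assumes X: "real_algebraic_set X" and A: "finite A" "\<And>a. a \<in> A \<Longrightarrow> Ck_function 0 X a \<and> a x = 0"
    and U: "\<And>a. a \<in> A \<Longrightarrow> regular_function U a" "\<And>y. y \<in> X \<Longrightarrow> ev \<eta> y \<noteq> 0 \<Longrightarrow> y \<in> U"
    and \<eta>: "Wd.tay v0 x \<eta> \<noteq> 0"
  shows "poly_leading 0 A v0 v1"
  unfolding poly_leading_def
proof (intro allI impI)
  fix h assume h: "\<forall>a\<in>A. Ck_function 0 X (h a) \<and> h a x = 0"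
  obtain n where n: "Wd.tay v0 x \<eta> $$ n \<noteq> 0" using \<eta> by (auto simp: fps_nonzero_nth)
  obtain \<pi> where \<pi>: "\<forall>\<beta>. Wd.tay (v0 + \<beta> *\<^sub>R v1) x \<eta> $$ n = poly \<pi> \<beta>"
    using tay_line_poly[of v0 v1 \<eta> n] by (rule exE)
  have "poly \<pi> 0 \<noteq> 0" using n \<pi>[rule_format, of 0] by simp
  then have "\<pi> \<noteq> 0" by auto
  then have fin: "finite {\<beta>. poly \<pi> \<beta> = 0}" by (rule poly_roots_finite)
  have "L = 0" if \<beta>: "poly \<pi> \<beta> \<noteq> 0"
    and L: "((\<lambda>t. (\<Sum>a\<in>A. h a (arc (v0 + \<beta> *\<^sub>R v1) t) * a (arc (v0 + \<beta> *\<^sub>R v1) t)) / t ^ Suc 0) \<longlongrightarrow> L) (at 0)" for \<beta> L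
  proof -
    let ?v = "v0 + \<beta> *\<^sub>R v1"
    have "Wd.tay ?v x \<eta> $$ n \<noteq> 0" using \<pi>[rule_format, of \<beta>] \<beta> by simp
    then have \<eta>': "Wd.tay ?v x \<eta> \<noteq> 0" by auto
    have "((\<lambda>t. h a (arc ?v t) * (a (arc ?v t) / t)) \<longlongrightarrow> 0) (at 0)" if a: "a \<in> A" for a
    proof -
      have "((\<lambda>t. a (arc ?v t)) \<longlongrightarrow> 0) (at 0)" using arc_Ck_tendsto[OF X, of 0 a ?v] A(2)[OF a] by simp
      from arc_rational_order[OF X this U(1)[OF a] U(2) \<eta>']
      obtain l where l: "((\<lambda>t. a (arc ?v t) / t) \<longlongrightarrow> l) (at 0)" by (rule exE)
      have "((\<lambda>t. h a (arc ?v t)) \<longlongrightarrow> 0) (at 0)" using arc_Ck_tendsto[OF X, of 0 "h a" ?v] h a by simp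
      from tendsto_mult[OF this l] show ?thesis by simp
    qed
    then have "((\<lambda>t. \<Sum>a\<in>A. h a (arc ?v t) * (a (arc ?v t) / t)) \<longlongrightarrow> (\<Sum>a\<in>A. 0)) (at 0)" by (intro tendsto_sum)
    then have "((\<lambda>t. (\<Sum>a\<in>A. h a (arc ?v t) * a (arc ?v t)) / t ^ Suc 0) \<longlongrightarrow> 0) (at 0)"
      by (simp add: sum_divide_distrib)
    from LIM_unique[OF L this] show ?thesis .
  qed
  then have *: "L = poly 0 \<beta>" if "\<beta> \<notin> {\<beta>. poly \<pi> \<beta> = 0}"
    and "((\<lambda>t. (\<Sum>a\<in>A. h a (arc (v0 + \<beta> *\<^sub>R v1) t) * a (arc (v0 + \<beta> *\<^sub>R v1) t)) / t ^ Suc 0) \<longlongrightarrow> L) (at 0)" for \<beta> L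
    using that by simp
  show "\<exists>\<pi> E. finite E \<and> (\<forall>\<beta> L. \<beta> \<notin> E \<longrightarrow>
       ((\<lambda>t. (\<Sum>a\<in>A. h a (arc (v0 + \<beta> *\<^sub>R v1) t) * a (arc (v0 + \<beta> *\<^sub>R v1) t)) / t ^ Suc 0) \<longlongrightarrow> L) (at 0) \<longrightarrow>
       L = poly \<pi> \<beta>)"
    by (intro exI[of _ 0] exI[of _ "{\<beta>. poly \<pi> \<beta> = 0}"] conjI allI impI fin) (rule *)
qed

end

section \<open>Common domains, a direction for the generators, and the test functions\<close>

lemma zariski_self: "zariski_open X X" "zariski_dense X X"
proof -
  show "zariski_open X X"
    unfolding zariski_open_def real_algebraic_set_def
    by (rule exI[of _ "{}"]) (auto intro!: exI[of _ "{\<lambda>x. 1}"])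
  show "zariski_dense X X" by (auto simp: zariski_dense_def)
qed

lemma rational_common_domain:
  assumes "finite A" "\<And>a. a \<in> A \<Longrightarrow> rational_function X a"
  shows "\<exists>U. zariski_open X U \<and> zariski_dense X U \<and> (\<forall>a\<in>A. regular_function U a)"
  using assms
proof (induction A rule: finite_induct)
  case empty
  then show ?case using zariski_self by blast
next
  case (insert a A)
  then obtain U where U: "zariski_open X U" "zariski_dense X U" "\<forall>a\<in>A. regular_function U a" by auto
  obtain V where V: "zariski_open X V" "zariski_dense X V" "regular_function V a"
    using insert.prems[of a] unfolding rational_function_def by auto
  have mono: "regular_function (U \<inter> V) f" if "regular_function U f \<or> regular_function V f" for f
    using that unfolding regular_function_def by blast
  show ?case
    using zariski_open_dense_Int[OF U(1,2) V(1,2)] U(3) V(3) mono by (intro exI[of _ "U \<inter> V"]) auto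
qed

context adapted_coords begin

text \<open>For \<open>k = 0\<close> the direction must enter the common domain of the generators.
  If that direction has no component in \<open>S\<close>, its derivation is zero and the Taylor
  series of \<open>\<eta>\<close> is constant; then \<open>\<eta>\<close> is nonzero at
  \<open>x\<close> and every direction is suitable.\<close>

lemma good_direction:
  assumes X: "real_algebraic_set X" and S: "S \<noteq> {}" and A: "finite A" "\<And>a. a \<in> A \<Longrightarrow> regulous k X a \<and> a x = 0"
  shows "\<exists>v0 j. j \<in> S \<and> v0 $ j \<noteq> 0 \<and> (\<forall>v1. poly_leading k A v0 v1)"
proof (cases "k = 0")
  case False
  obtain j where j: "j \<in> S" using S by blast
  have "poly_leading k A (axis j 1) v1" for v1
    by (rule poly_leading_pos[OF X _ A(1)]) (use A(2) False in \<open>auto simp: regulous_def\<close>)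
  then show ?thesis using j by (intro exI[of _ "axis j 1"] exI[of _ j]) (simp add: axis_def)
next
  case True
  obtain U where U: "zariski_open X U" "zariski_dense X U" "\<forall>a\<in>A. regular_function U a"
    using rational_common_domain[OF A(1), of X] A(2) unfolding regulous_def by blast
  obtain v \<eta> where v: "\<forall>y\<in>X. ev \<eta> y \<noteq> 0 \<longrightarrow> y \<in> U" "Wd.tay v x \<eta> \<noteq> 0" using zariski_direction[OF U(1,2)] by blast
  have lead: "poly_leading k A w v1" if "Wd.tay w x \<eta> \<noteq> 0" for w v1
    unfolding True using U(3) v(1) that
    by (intro poly_leading_zero[OF X A(1), of U \<eta>]) (use A(2) True in \<open>auto simp: regulous_def\<close>)
  show ?thesis
  proof (cases "\<exists>j\<in>S. v $ j \<noteq> 0")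
    case True
    then show ?thesis using lead[OF v(2)] by blast
  next
    case False
    have W0: "W v p = 0" for p using False unfolding W_def by (intro sum.neutral) (auto simp: cst_simps)
    have "Wd.tay v x (\<eta> - cst (ev \<eta> x)) = 0" by (rule Wd.tay_eq_0) (simp_all add: W0)
    then have "ev \<eta> x \<noteq> 0" using v(2) by (auto simp: Wd.tay_diff Wd.tay_cst)
    then have nz: "Wd.tay w x \<eta> \<noteq> 0" for w using Wd.tay_0[of w x \<eta>] by auto
    obtain j where j: "j \<in> S" using S by blast
    show ?thesis using lead[OF nz] j by (intro exI[of _ "axis j 1"] exI[of _ j]) (simp add: axis_def)
  qed
qed

text \<open>An arc with nonzero velocity reaches \<open>x\<close> through other points of
  \<open>X\<close>, so a polynomial vanishing on those points vanishes at \<open>x\<close> by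
  continuity.\<close>

lemma punctured_dense:
  assumes X: "real_algebraic_set X" and S: "S \<noteq> {}"
  shows "zariski_dense X (X - {x})"
  unfolding zariski_dense_def
proof (intro conjI allI impI)
  fix Z assume Z: "real_algebraic_set Z \<and> X - {x} \<subseteq> Z"
  have "x \<in> Z"
  proof (rule real_algebraic_set_van)
    show "real_algebraic_set Z" using Z by simp
    show "\<forall>p\<in>van Z. ev p x = 0"
    proof
      fix p assume p: "p \<in> van Z"
      obtain j where j: "j \<in> S" using S by blast
      let ?v = "axis j 1 :: real ^ 'n"
      have "grad (b j) x \<bullet> vel ?v \<noteq> 0" using j ev_Dt by (simp add: grad_vel axis_def)
      then have "vel ?v \<noteq> 0" by auto
      from tendsto_imp_eventually_ne[OF arc_vel this]
      have "\<forall>\<^sub>F t in at 0. arc ?v t \<noteq> x" by (rule eventually_mono) auto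
      with arc_in_X[OF X, of ?v] have "\<forall>\<^sub>F t in at 0. ev p (arc ?v t) = 0"
        by eventually_elim (use Z p in \<open>auto simp: van_def\<close>)
      then have *: "((\<lambda>t. ev p (arc ?v t)) \<longlongrightarrow> 0) (at 0)" by (rule tendsto_eventually)
      have "((\<lambda>t. ev p (arc ?v t)) \<longlongrightarrow> ev p x) (at 0)"
        using Wd.flow_order[of 0 ?v x p] by (simp add: Wd.tay_0)
      from LIM_unique[OF this *] show "ev p x = 0" .
    qed
  qed
  then show "X \<subseteq> Z" using Z by auto
qed auto

lemma regulous_ratio:
  assumes X: "real_algebraic_set X" and S: "S \<noteq> {}" and P: "P \<in> ipow (mx x) (2 * n + (k + 1))"
  shows "regulous k X (\<lambda>y\<in>X. ev P y / ev (rho x) y ^ n)"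
  unfolding regulous_def
proof
  show "Ck_function k X (\<lambda>y\<in>X. ev P y / ev (rho x) y ^ n)"
    unfolding Ck_function_def
    by (intro ballI exI[of _ UNIV] exI[of _ "\<lambda>y. ev P y / ev (rho x) y ^ n"]) (simp add: Ck_on_ratio[OF P])
  have "regular_function (X - {x}) (\<lambda>y\<in>X. ev P y / ev (rho x) y ^ n)"
    unfolding regular_function_def
    using real_polynomial_ev[of P] real_polynomial_ev[of "rho x ^ n"]
    by (intro exI[of _ "ev P"] exI[of _ "ev (rho x ^ n)"]) (auto simp: ev_rho)
  moreover have "zariski_open X (X - {x})"
  proof -
    have "real_algebraic_set {x}"
      unfolding real_algebraic_set_def
      by (intro exI[of _ "{ev (rho x)}"] conjI) (auto simp: real_polynomial_ev ev_rho)
    then show ?thesis unfolding zariski_open_def by (intro exI[of _ "{x}"] conjI refl)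
  qed
  ultimately show "rational_function X (\<lambda>y\<in>X. ev P y / ev (rho x) y ^ n)"
    unfolding rational_function_def using punctured_dense[OF X S] by (intro exI[of _ "X - {x}"] conjI)
qed

text \<open>The quotient is homogeneous of degree \<open>k + 1\<close> in \<open>y - x\<close>, so
  after division by \<open>t ^ Suc k\<close> it is evaluated at
  \<open>(1 / t) *\<^sub>R (arc v t - x)\<close>, which tends to the velocity.\<close>

lemma arc_ratio_limit:
  assumes "vel v \<noteq> 0"
  shows "((\<lambda>t. ev (linpoly x c ^ (k + 1 + 2 * j)) (arc v t) / ev (rho x) (arc v t) ^ j / t ^ Suc k) \<longlongrightarrow>
    (c \<bullet> vel v) ^ (k + 1 + 2 * j) / (norm (vel v) ^ 2) ^ j) (at 0)"
proof -
  let ?u = "\<lambda>t. (1 / t) *\<^sub>R (arc v t - x)"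
  have "((\<lambda>t. (c \<bullet> ?u t) ^ (k + 1 + 2 * j) / (norm (?u t) ^ 2) ^ j) \<longlongrightarrow>
      (c \<bullet> vel v) ^ (k + 1 + 2 * j) / (norm (vel v) ^ 2) ^ j) (at 0)"
    using assms by (intro tendsto_intros arc_vel) auto
  moreover have "\<forall>\<^sub>F t in at 0. (c \<bullet> ?u t) ^ (k + 1 + 2 * j) / (norm (?u t) ^ 2) ^ j
      = ev (linpoly x c ^ (k + 1 + 2 * j)) (arc v t) / ev (rho x) (arc v t) ^ j / t ^ Suc k"
  proof -
    have "\<forall>\<^sub>F t in at 0. t \<noteq> (0 :: real)" by (simp add: eventually_at_filter)
    then show ?thesis
    proof eventually_elim
      case (elim t)
      define a where "a = c \<bullet> (arc v t - x)"
      define r where "r = norm (arc v t - x) ^ 2"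
      have e1: "ev (linpoly x c) (arc v t) = a" by (simp add: ev_linpoly a_def inner_vec_def)
      have e2: "c \<bullet> ?u t = a / t" by (simp add: a_def)
      have e3: "norm (?u t) ^ 2 = r / t ^ 2" by (simp add: r_def power_mult_distrib power_divide)
      have e4: "(a / t) ^ (k + 1 + 2 * j) / (r / t ^ 2) ^ j = a ^ (k + 1 + 2 * j) / r ^ j / t ^ Suc k"
      proof -
        have "(a / t) ^ (k + 1 + 2 * j) / (r / t ^ 2) ^ j = a ^ (k + 1 + 2 * j) / (t ^ Suc k * t ^ (2 * j)) * (t ^ (2 * j) / r ^ j)"
          by (simp add: power_divide power_add power_mult)
        also have "\<dots> = a ^ (k + 1 + 2 * j) / r ^ j / t ^ Suc k" using elim by simp
        finally show ?thesis .
      qed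
      show ?case unfolding e2 e3 ev_power e1 ev_rho r_def[symmetric] by (rule e4)
    qed
  qed
  ultimately show ?thesis by (rule Lim_transform_eventually)
qed

end

section \<open>Ideals of regulous functions\<close>

lemma linear_dependence:
  fixes c :: "'j \<Rightarrow> 'a \<Rightarrow> real"
  assumes "finite A" "finite J" "card A < card J"
  shows "\<exists>\<alpha>. (\<exists>j\<in>J. \<alpha> j \<noteq> 0) \<and> (\<forall>a\<in>A. (\<Sum>j\<in>J. \<alpha> j * c j a) = 0)"
  using assms
proof (induction A arbitrary: J c rule: finite_induct)
  case empty
  then have "J \<noteq> {}" by auto
  then show ?case by (intro exI[of _ "\<lambda>_. 1"]) auto
next
  case (insert a A)
  show ?case
  proof (cases "\<forall>j\<in>J. c j a = 0")
    case True
    have "card A < card J" using insert by simp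
    then obtain \<alpha> where "\<exists>j\<in>J. \<alpha> j \<noteq> 0" "\<forall>a\<in>A. (\<Sum>j\<in>J. \<alpha> j * c j a) = 0"
      using insert.IH[of J c] insert.prems by blast
    then show ?thesis using True by (intro exI[of _ \<alpha>]) auto
  next
    case False
    then obtain i where i: "i \<in> J" "c i a \<noteq> 0" by blast
    define J' where "J' = J - {i}"
    have J': "finite J'" "i \<notin> J'" "J = insert i J'" using i insert.prems by (auto simp: J'_def)
    have "card A < card J'" using insert J' by simp
    then obtain \<alpha> where \<alpha>: "\<exists>j\<in>J'. \<alpha> j \<noteq> 0" "\<forall>d\<in>A. (\<Sum>j\<in>J'. \<alpha> j * (c j d - c j a / c i a * c i d)) = 0"
      using insert.IH[of J' "\<lambda>j d. c j d - c j a / c i a * c i d"] J'(1) by blast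
    define \<gamma> where "\<gamma> = - (\<Sum>j\<in>J'. \<alpha> j * (c j a / c i a))"
    define \<alpha>' where "\<alpha>' j = (if j = i then \<gamma> else \<alpha> j)" for j
    have s: "(\<Sum>j\<in>J. \<alpha>' j * c j d) = (\<Sum>j\<in>J'. \<alpha> j * (c j d - c j a / c i a * c i d))" for d
    proof -
      have "(\<Sum>j\<in>J. \<alpha>' j * c j d) = \<gamma> * c i d + (\<Sum>j\<in>J'. \<alpha>' j * c j d)" using J' by (simp add: \<alpha>'_def)
      also have "(\<Sum>j\<in>J'. \<alpha>' j * c j d) = (\<Sum>j\<in>J'. \<alpha> j * c j d)" using J'(2) by (intro sum.cong) (auto simp: \<alpha>'_def)
      also have "\<gamma> * c i d + (\<Sum>j\<in>J'. \<alpha> j * c j d) = (\<Sum>j\<in>J'. \<alpha> j * (c j d - c j a / c i a * c i d))"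
        by (simp add: \<gamma>_def right_diff_distrib sum_subtractf sum_distrib_right mult.assoc)
      finally show ?thesis .
    qed
    have "\<exists>j\<in>J. \<alpha>' j \<noteq> 0" using \<alpha>(1) J' by (auto simp: \<alpha>'_def)
    moreover have "\<forall>d\<in>insert a A. (\<Sum>j\<in>J. \<alpha>' j * c j d) = 0" unfolding s using \<alpha>(2) i(2) by auto
    ultimately show ?thesis by blast
  qed
qed

text \<open>Multiplying by \<open>\<nu>\<^bsup>r + 1\<^esup>\<close> and comparing degrees forces \<open>\<pi> = 0\<close>.\<close>

lemma reciprocal_not_poly:
  fixes \<nu> \<pi> :: "real poly"
  assumes deg: "Polynomial.degree \<nu> = 2" and E: "finite E" and pos: "\<And>\<beta>. poly \<nu> \<beta> \<noteq> 0"
    and eq: "\<And>\<beta>. \<beta> \<notin> E \<Longrightarrow> (\<Sum>j=1..Suc r. \<alpha> j * (1 / poly \<nu> \<beta>) ^ j) = poly \<pi> \<beta>"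
  shows "\<forall>j\<in>{1..Suc r}. \<alpha> j = 0"
proof -
  \<comment> \<open>Composed with \<open>\<nu>\<close>, this is the given sum times
    \<open>\<nu> ^ Suc r\<close>. The sum starts at \<open>j = 1\<close>, so \<open>F\<close> has
    degree at most \<open>r\<close> and the composition stays below the degree of
    \<open>\<nu> ^ Suc r\<close>.\<close>
  define F where "F = (\<Sum>j=1..Suc r. Polynomial.monom (\<alpha> j) (Suc r - j))"
  have "poly (pcompose F \<nu>) \<beta> = poly (\<pi> * \<nu> ^ Suc r) \<beta>" if "\<beta> \<notin> E" for \<beta>
  proof -
    have "poly (pcompose F \<nu>) \<beta> = (\<Sum>j=1..Suc r. \<alpha> j * poly \<nu> \<beta> ^ (Suc r - j))"
      by (simp add: poly_pcompose F_def poly_sum poly_monom)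
    also have "\<dots> = (\<Sum>j=1..Suc r. \<alpha> j * (1 / poly \<nu> \<beta>) ^ j) * poly \<nu> \<beta> ^ Suc r"
      unfolding sum_distrib_right
      by (intro sum.cong) (use pos[of \<beta>] in \<open>auto simp: power_diff power_one_over divide_inverse power_inverse\<close>)
    also have "\<dots> = poly (\<pi> * \<nu> ^ Suc r) \<beta>" using eq[OF that] by simp
    finally show ?thesis .
  qed
  then have "- E \<subseteq> {\<beta>. poly (pcompose F \<nu> - \<pi> * \<nu> ^ Suc r) \<beta> = 0}" by auto
  moreover have "infinite (- E)" using E by (simp add: Compl_eq_Diff_UNIV infinite_UNIV_char_0 Diff_infinite_finite)
  ultimately have "pcompose F \<nu> - \<pi> * \<nu> ^ Suc r = 0" using poly_roots_finite finite_subset by blast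
  then have comp: "pcompose F \<nu> = \<pi> * \<nu> ^ Suc r" by simp
  have "Polynomial.degree F \<le> r"
    unfolding F_def by (intro degree_sum_le) (auto intro: order_trans[OF degree_monom_le])
  then have dF: "Polynomial.degree (pcompose F \<nu>) \<le> r * 2" by (simp add: degree_pcompose deg)
  have nu0: "\<nu> \<noteq> 0" using deg by auto
  have "\<pi> = 0"
  proof (rule ccontr)
    assume "\<pi> \<noteq> 0"
    then have "Polynomial.degree (\<pi> * \<nu> ^ Suc r) = Polynomial.degree \<pi> + Suc r * 2"
      using nu0 by (simp add: degree_mult_eq degree_power_eq deg del: power_Suc)
    then show False using dF comp by simp
  qed
  then have "pcompose F \<nu> = 0" using comp by simp
  then have "F = 0" using deg by (intro pcompose_eq_0[of F \<nu>]) auto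
  have "\<alpha> j = 0" if j: "j \<in> {1..Suc r}" for j
  proof -
    have "Polynomial.coeff F (Suc r - j) = (\<Sum>i=1..Suc r. if i = j then \<alpha> i else 0)"
      unfolding F_def coeff_sum by (intro sum.cong) (use j in auto)
    then show ?thesis using j \<open>F = 0\<close> by (simp del: sum.cl_ivl_Suc)
  qed
  then show ?thesis by blast
qed

section \<open>Operations and generated ideals in the ring of regulous functions\<close>

lemma regulous_inverse:
  assumes f: "regulous k X f" and nz: "\<And>x. x \<in> X \<Longrightarrow> f x \<noteq> 0"
  shows "regulous k X (\<lambda>x\<in>X. inverse (f x))"
  unfolding regulous_def
proof
  show "Ck_function k X (\<lambda>x\<in>X. inverse (f x))"
    unfolding Ck_function_def
  proof
    fix x assume x: "x \<in> X"
    obtain U g where g: "open U" "x \<in> U" "Ck_on k g U" "\<forall>y\<in>X \<inter> U. f y = g y"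
      using f x unfolding regulous_def Ck_function_def by blast
    have gx: "g x \<noteq> 0" using g(2,4) nz[OF x] x by force
    define V where "V = U \<inter> g -` (- {0})"
    have V: "open V" unfolding V_def
      by (intro continuous_open_preimage Ck_on_continuous[OF g(3)] g(1)) auto
    have "Ck_on k (\<lambda>y. inverse (g y)) V"
      by (rule Ck_on_inverse[OF V Ck_on_subset[OF g(3)]]) (auto simp: V_def)
    then show "\<exists>U h. open U \<and> x \<in> U \<and> Ck_on k h U \<and> (\<forall>y\<in>X \<inter> U. (\<lambda>x\<in>X. inverse (f x)) y = h y)"
      using V g x gx by (intro exI[of _ V] exI[of _ "\<lambda>y. inverse (g y)"]) (auto simp: V_def)
  qed
  obtain U where U: "zariski_open X U" "zariski_dense X U" "regular_function U f"
    using f unfolding regulous_def rational_function_def by blast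
  obtain p q where pq: "real_polynomial_function p" "real_polynomial_function q"
    "\<forall>x\<in>U. q x \<noteq> 0 \<and> f x = p x / q x" using U(3) unfolding regular_function_def by blast
  have "\<forall>y\<in>U. p y \<noteq> 0 \<and> (\<lambda>x\<in>X. inverse (f x)) y = q y / p y"
  proof
    fix y assume y: "y \<in> U"
    then have "y \<in> X" using U(2) by (auto simp: zariski_dense_def)
    moreover have "f y = p y / q y" using pq(3) y by simp
    moreover have "f y \<noteq> 0" by (rule nz) fact
    ultimately show "p y \<noteq> 0 \<and> (\<lambda>x\<in>X. inverse (f x)) y = q y / p y" by auto
  qed
  then have "regular_function U (\<lambda>x\<in>X. inverse (f x))"
    unfolding regular_function_def by (intro exI[of _ q] exI[of _ p] conjI pq(1,2))
  then show "rational_function X (\<lambda>x\<in>X. inverse (f x))" unfolding rational_function_def using U(1,2)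
    by (intro exI[of _ U] conjI)
qed

lemma regulous_sum:
  assumes "finite J" "\<And>j. j \<in> J \<Longrightarrow> regulous k X (f j)"
  shows "regulous k X (\<lambda>y\<in>X. \<Sum>j\<in>J. \<alpha> j * f j y)"
  using assms
proof (induction J rule: finite_induct)
  case empty
  then show ?case using regulous_const[of k X 0] by (simp only: sum.empty)
next
  case (insert j J)
  have "regulous k X (\<lambda>y\<in>X. (\<lambda>y\<in>X. (\<lambda>y\<in>X. \<alpha> j) y * f j y) y + (\<lambda>y\<in>X. \<Sum>j\<in>J. \<alpha> j * f j y) y)"
    using insert by (intro regulous_add regulous_mult regulous_const) auto
  moreover have "(\<lambda>y\<in>X. (\<lambda>y\<in>X. (\<lambda>y\<in>X. \<alpha> j) y * f j y) y + (\<lambda>y\<in>X. \<Sum>j\<in>J. \<alpha> j * f j y) y)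
      = (\<lambda>y\<in>X. \<Sum>j\<in>insert j J. \<alpha> j * f j y)"
    using insert.hyps by (auto simp: restrict_def)
  ultimately show ?case by (simp only:)
qed

lemma regulous_ring_carrier: "f \<in> carrier (regulous_ring k X) \<longleftrightarrow> f \<in> extensional X \<and> regulous k X f"
  by (simp add: regulous_ring_def)

lemma regulous_ring_uminus:
  assumes f: "f \<in> carrier (regulous_ring k X)"
  shows "\<ominus>\<^bsub>regulous_ring k X\<^esub> f = (\<lambda>y\<in>X. - f y)"
proof -
  interpret R: cring "regulous_ring k X" by (rule cring_regulous_ring)
  have "regulous k X (\<lambda>y\<in>X. (\<lambda>y\<in>X. - 1) y * f y)"
    using f by (intro regulous_mult regulous_const) (simp add: regulous_ring_carrier)
  moreover have "(\<lambda>y\<in>X. (\<lambda>y\<in>X. - 1) y * f y) = (\<lambda>y\<in>X. - f y)" by (auto simp: restrict_def)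
  ultimately have "(\<lambda>y\<in>X. - f y) \<in> carrier (regulous_ring k X)" by (simp add: regulous_ring_carrier)
  moreover have "(\<lambda>y\<in>X. - f y) \<oplus>\<^bsub>regulous_ring k X\<^esub> f = \<zero>\<^bsub>regulous_ring k X\<^esub>"
    by (auto simp: regulous_ring_def restrict_def)
  ultimately show ?thesis using R.minus_equality[OF _ f] by blast
qed

lemma ideal_regulousI:
  assumes sub: "J \<subseteq> carrier (regulous_ring k X)" and zero: "(\<lambda>y\<in>X. 0) \<in> J"
    and add: "\<And>f g. f \<in> J \<Longrightarrow> g \<in> J \<Longrightarrow> (\<lambda>y\<in>X. f y + g y) \<in> J"
    and mult: "\<And>f g. f \<in> J \<Longrightarrow> g \<in> carrier (regulous_ring k X) \<Longrightarrow> (\<lambda>y\<in>X. g y * f y) \<in> J"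
  shows "ideal J (regulous_ring k X)"
proof -
  interpret R: cring "regulous_ring k X" by (rule cring_regulous_ring)
  have neg1: "(\<lambda>y\<in>X. - 1) \<in> carrier (regulous_ring k X)" by (simp add: regulous_ring_carrier regulous_const)
  show ?thesis
  proof (rule idealI[OF R.ring_axioms])
    show "subgroup J (add_monoid (regulous_ring k X))"
    proof (rule R.add.subgroupI[OF sub])
      show "J \<noteq> {}" using zero by blast
      show "\<ominus>\<^bsub>regulous_ring k X\<^esub> f \<in> J" if f: "f \<in> J" for f
      proof -
        have "(\<lambda>y\<in>X. (\<lambda>y\<in>X. - 1) y * f y) \<in> J" by (rule mult[OF f neg1])
        moreover have "(\<lambda>y\<in>X. (\<lambda>y\<in>X. - 1) y * f y) = (\<lambda>y\<in>X. - f y)" by (auto simp: restrict_def)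
        ultimately show ?thesis unfolding regulous_ring_uminus[OF subsetD[OF sub f]] by (simp only:)
      qed
      show "f \<oplus>\<^bsub>regulous_ring k X\<^esub> g \<in> J" if "f \<in> J" "g \<in> J" for f g
        using add[OF that] by (simp add: regulous_ring_def)
    qed
    show "g \<otimes>\<^bsub>regulous_ring k X\<^esub> f \<in> J" if "f \<in> J" "g \<in> carrier (regulous_ring k X)" for f g
      using mult[OF that] by (simp add: regulous_ring_def)
    show "f \<otimes>\<^bsub>regulous_ring k X\<^esub> g \<in> J" if "f \<in> J" "g \<in> carrier (regulous_ring k X)" for f g
      using mult[OF that] by (simp add: regulous_ring_def mult.commute)
  qed
qed

lemma genideal_regulous:
  assumes A: "finite A" "A \<subseteq> carrier (regulous_ring k X)" and g: "g \<in> genideal (regulous_ring k X) A"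
  shows "\<exists>h. (\<forall>a\<in>A. h a \<in> carrier (regulous_ring k X)) \<and> (\<forall>y\<in>X. g y = (\<Sum>a\<in>A. h a y * a y))"
proof -
  interpret R: cring "regulous_ring k X" by (rule cring_regulous_ring)
  define J where "J = {g \<in> carrier (regulous_ring k X).
    \<exists>h. (\<forall>a\<in>A. h a \<in> carrier (regulous_ring k X)) \<and> (\<forall>y\<in>X. g y = (\<Sum>a\<in>A. h a y * a y))}"
  have c: "(\<lambda>y\<in>X. c) \<in> carrier (regulous_ring k X)" for c by (simp add: regulous_ring_carrier regulous_const)
  have add: "(\<lambda>y\<in>X. f y + g y) \<in> carrier (regulous_ring k X)"
    and mult: "(\<lambda>y\<in>X. f y * g y) \<in> carrier (regulous_ring k X)"
    if "f \<in> carrier (regulous_ring k X)" "g \<in> carrier (regulous_ring k X)" for f g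
    using that by (simp_all add: regulous_ring_carrier regulous_add regulous_mult)
  have "ideal J (regulous_ring k X)"
  proof (rule ideal_regulousI)
    show "J \<subseteq> carrier (regulous_ring k X)" by (auto simp: J_def)
    show "(\<lambda>y\<in>X. 0) \<in> J" unfolding J_def using c[of 0] by (auto intro!: exI[of _ "\<lambda>_. \<lambda>y\<in>X. 0"])
  next
    fix f g assume "f \<in> J" "g \<in> J"
    then obtain h h' where h: "f \<in> carrier (regulous_ring k X)" "g \<in> carrier (regulous_ring k X)"
      "\<forall>a\<in>A. h a \<in> carrier (regulous_ring k X)" "\<forall>y\<in>X. f y = (\<Sum>a\<in>A. h a y * a y)"
      "\<forall>a\<in>A. h' a \<in> carrier (regulous_ring k X)" "\<forall>y\<in>X. g y = (\<Sum>a\<in>A. h' a y * a y)" unfolding J_def by blast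
    have "\<forall>y\<in>X. (\<lambda>y\<in>X. f y + g y) y = (\<Sum>a\<in>A. (\<lambda>y\<in>X. h a y + h' a y) y * a y)"
      using h by (simp add: distrib_right sum.distrib)
    moreover have "\<forall>a\<in>A. (\<lambda>y\<in>X. h a y + h' a y) \<in> carrier (regulous_ring k X)" using h add by simp
    ultimately show "(\<lambda>y\<in>X. f y + g y) \<in> J"
      unfolding J_def using add[OF h(1,2)] by (intro CollectI conjI exI[of _ "\<lambda>a. \<lambda>y\<in>X. h a y + h' a y"])
  next
    fix f g assume "f \<in> J" and g: "g \<in> carrier (regulous_ring k X)"
    then obtain h where h: "f \<in> carrier (regulous_ring k X)"
      "\<forall>a\<in>A. h a \<in> carrier (regulous_ring k X)" "\<forall>y\<in>X. f y = (\<Sum>a\<in>A. h a y * a y)" unfolding J_def by blast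
    have "\<forall>y\<in>X. (\<lambda>y\<in>X. g y * f y) y = (\<Sum>a\<in>A. (\<lambda>y\<in>X. g y * h a y) y * a y)"
      using h by (simp add: sum_distrib_left mult.assoc)
    moreover have "\<forall>a\<in>A. (\<lambda>y\<in>X. g y * h a y) \<in> carrier (regulous_ring k X)" using h g mult by simp
    ultimately show "(\<lambda>y\<in>X. g y * f y) \<in> J"
      unfolding J_def using mult[OF g h(1)] by (intro CollectI conjI exI[of _ "\<lambda>a. \<lambda>y\<in>X. g y * h a y"])
  qed
  moreover have "A \<subseteq> J"
  proof
    fix e assume e: "e \<in> A"
    have "\<forall>y\<in>X. e y = (\<Sum>a\<in>A. (\<lambda>y\<in>X. if a = e then 1 else 0) y * a y)"
      using A(1) e by (simp add: if_distrib[of "\<lambda>z. z * _"] cong: if_cong)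
    then show "e \<in> J" unfolding J_def using A(2) e c
      by (intro CollectI conjI exI[of _ "\<lambda>a. \<lambda>y\<in>X. if a = e then 1 else 0"]) auto
  qed
  ultimately have "genideal (regulous_ring k X) A \<subseteq> J" by (rule R.genideal_minimal)
  then show ?thesis using g unfolding J_def by blast
qed

definition point_max :: "nat \<Rightarrow> (real ^ 'n) set \<Rightarrow> real ^ 'n \<Rightarrow> (real ^ 'n \<Rightarrow> real) set" where
  "point_max k X x = {f \<in> carrier (regulous_ring k X). f x = 0}"

lemma ideal_point_max:
  assumes "x \<in> X"
  shows "ideal (point_max k X x) (regulous_ring k X)"
  by (rule ideal_regulousI)
    (use assms in \<open>auto simp: point_max_def regulous_ring_carrier regulous_const regulous_add regulous_mult\<close>)

text \<open>With \<open>r\<close> generators, \<open>r + 1\<close> test functions suffice. The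
  values at \<open>x\<close> of their coefficients are \<open>r + 1\<close> vectors of length
  \<open>r\<close>, so a nontrivial combination of the test functions has coefficients vanishing at
  \<open>x\<close> and lies in the square of the ideal.\<close>

lemma point_max_not_fin_gen:
  assumes adapted: "adapted_coords X x b S" and X: "real_algebraic_set X" and S: "2 \<le> card S"
  shows "\<not> fin_gen_ideal (point_max k X x) (regulous_ring k X)"
proof
  interpret adapted_coords X x b S by fact
  interpret R: cring "regulous_ring k X" by (rule cring_regulous_ring)
  assume "fin_gen_ideal (point_max k X x) (regulous_ring k X)"
  then obtain A where A: "A \<subseteq> carrier (regulous_ring k X)" "finite A" "point_max k X x = genideal (regulous_ring k X) A"
    unfolding fin_gen_ideal_def by blast
  have "A \<subseteq> point_max k X x" unfolding A(3) by (rule R.genideal_self[OF A(1)])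
  then have Ax: "regulous k X a \<and> a x = 0" if "a \<in> A" for a
    using that by (auto simp: point_max_def regulous_ring_carrier)
  have S0: "S \<noteq> {}" using S by auto
  have "\<exists>v0 j. j \<in> S \<and> v0 $ j \<noteq> 0 \<and> (\<forall>v1. poly_leading k A v0 v1)" by (rule good_direction[OF X S0 A(2) Ax])
  then obtain v0 j where vj: "j \<in> S" "v0 $ j \<noteq> 0" "\<forall>v1. poly_leading k A v0 v1" by (elim exE conjE)
  have "\<exists>l\<in>S. l \<noteq> j"
  proof (rule ccontr)
    assume "\<not> (\<exists>l\<in>S. l \<noteq> j)"
    then have "S \<subseteq> {j}" by blast
    then have "card S \<le> card {j}" by (rule card_mono[rotated]) simp
    then show False using S by simp
  qed
  then obtain l where l: "l \<in> S" "l \<noteq> j" by blast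
  \<comment> \<open>The line moves in a coordinate different from \<open>j\<close>, while
    \<open>c\<close> is proportional to the gradient of \<open>b j\<close>; normalized at
    \<open>v0\<close>, it takes the value 1 on all velocities along the line.\<close>
  define v1 :: "real ^ 'a" where "v1 = axis l 1"
  define c where "c = (1 / (v0 $ j * ev Dt x)) *\<^sub>R grad (b j) x"
  have c0: "c \<bullet> vel v0 = 1" using vj ev_Dt by (simp add: c_def grad_vel)
  have c1: "c \<bullet> vel v1 = 0" using vj l by (simp add: c_def grad_vel v1_def axis_def)
  have "grad (b l) x \<bullet> vel v1 \<noteq> 0" using l ev_Dt by (simp add: grad_vel v1_def)
  then have w1: "vel v1 \<noteq> 0" by auto
  have cv: "c \<bullet> vel (v0 + \<beta> *\<^sub>R v1) = 1" for \<beta> by (simp add: vel_line inner_add_right c0 c1)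
  then have vnz: "vel (v0 + \<beta> *\<^sub>R v1) \<noteq> 0" for \<beta> by (metis inner_zero_right zero_neq_one)
  \<comment> \<open>The squared speed of the arcs along the line. It is quadratic because
    \<open>vel v1\<close> is nonzero, and it has no zero because \<open>c\<close> has value 1 on
    each velocity.\<close>
  define \<nu> where "\<nu> = [:vel v0 \<bullet> vel v0, 2 * (vel v0 \<bullet> vel v1), vel v1 \<bullet> vel v1:]"
  have \<nu>: "poly \<nu> \<beta> = norm (vel (v0 + \<beta> *\<^sub>R v1)) ^ 2" for \<beta>
    unfolding \<nu>_def vel_line power2_norm_eq_inner
    by (simp add: inner_add_left inner_add_right inner_commute[of "vel v1" "vel v0"] algebra_simps)
  have deg: "Polynomial.degree \<nu> = 2" using w1 by (simp add: \<nu>_def)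
  have nz: "poly \<nu> \<beta> \<noteq> 0" for \<beta> unfolding \<nu> using vnz[of \<beta>] by simp
  define r where "r = card A"
  define g where "g i = (\<lambda>y\<in>X. ev (linpoly x c ^ (k + 1 + 2 * i)) y / ev (rho x) y ^ i)" for i
  have gi: "g i \<in> point_max k X x" for i
  proof -
    have "linpoly x c \<in> mx x" by (simp add: mx_iff ev_linpoly)
    then have "linpoly x c ^ (k + 1 + 2 * i) \<in> ipow (mx x) (k + 1 + 2 * i)" by (rule ipow_power)
    then have "linpoly x c ^ (k + 1 + 2 * i) \<in> ipow (mx x) (2 * i + (k + 1))" by (simp only: add.commute)
    then have "regulous k X (g i)" unfolding g_def by (rule regulous_ratio[OF X S0])
    moreover have "g i x = 0" using xX by (simp add: g_def ev_linpoly)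
    ultimately show ?thesis by (simp add: point_max_def regulous_ring_carrier g_def)
  qed
  have "\<forall>i. \<exists>h. (\<forall>a\<in>A. h a \<in> carrier (regulous_ring k X)) \<and> (\<forall>y\<in>X. g i y = (\<Sum>a\<in>A. h a y * a y))"
    by (intro allI genideal_regulous[OF A(2,1)]) (rule gi[unfolded A(3)])
  from choice[OF this] obtain h where h: "\<forall>i. (\<forall>a\<in>A. h i a \<in> carrier (regulous_ring k X)) \<and> (\<forall>y\<in>X. g i y = (\<Sum>a\<in>A. h i a y * a y))"
    by (rule exE)
  \<comment> \<open>The index starts at 1: for index 0 the test function is a power of the linear
    form, whose coefficient is constant along the line.\<close>
  obtain \<alpha> where \<alpha>: "\<exists>i\<in>{1..Suc r}. \<alpha> i \<noteq> 0" "\<forall>a\<in>A. (\<Sum>i=1..Suc r. \<alpha> i * h i a x) = 0"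
    using linear_dependence[OF A(2), of "{1..Suc r}" "\<lambda>i a. h i a x"] by (auto simp: r_def)
  define H where "H a = (\<lambda>y\<in>X. \<Sum>i=1..Suc r. \<alpha> i * h i a y)" for a
  have HC: "\<forall>a\<in>A. Ck_function k X (H a) \<and> H a x = 0"
  proof
    fix a assume a: "a \<in> A"
    have "regulous k X (h i a)" for i
      using bspec[OF conjunct1[OF spec[OF h, of i]] a] by (simp add: regulous_ring_carrier)
    then have "regulous k X (H a)" unfolding H_def by (intro regulous_sum) simp_all
    moreover have "H a x = 0" unfolding H_def using bspec[OF \<alpha>(2) a] xX by (simp only: restrict_apply')
    ultimately show "Ck_function k X (H a) \<and> H a x = 0" by (simp add: regulous_def)
  qed
  from spec[OF vj(3)[unfolded poly_leading_def], of v1, THEN spec, THEN mp, OF HC]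
  obtain \<pi> E where \<pi>: "finite E" "\<forall>\<beta> L. \<beta> \<notin> E \<longrightarrow>
       ((\<lambda>t. (\<Sum>a\<in>A. H a (arc (v0 + \<beta> *\<^sub>R v1) t) * a (arc (v0 + \<beta> *\<^sub>R v1) t)) / t ^ Suc k) \<longlongrightarrow> L) (at 0) \<longrightarrow>
       L = poly \<pi> \<beta>"
    by (elim exE conjE)
  have HA: "(\<Sum>a\<in>A. H a y * a y) = (\<Sum>i=1..Suc r. \<alpha> i * (ev (linpoly x c ^ (k + 1 + 2 * i)) y / ev (rho x) y ^ i))"
    if y: "y \<in> X" for y
  proof -
    have "(\<Sum>a\<in>A. H a y * a y) = (\<Sum>a\<in>A. \<Sum>i=1..Suc r. \<alpha> i * (h i a y * a y))"
      using y by (simp add: H_def sum_distrib_right mult.assoc del: sum.cl_ivl_Suc)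
    also have "\<dots> = (\<Sum>i=1..Suc r. \<alpha> i * (\<Sum>a\<in>A. h i a y * a y))"
      by (subst sum.swap) (simp add: sum_distrib_left del: sum.cl_ivl_Suc)
    also have "\<dots> = (\<Sum>i=1..Suc r. \<alpha> i * g i y)" 
      by (intro sum.cong refl) (simp only: bspec[OF conjunct2[OF spec[OF h]] y])
    finally show ?thesis unfolding g_def restrict_apply'[OF y] .
  qed
  have "(\<Sum>i=1..Suc r. \<alpha> i * (1 / poly \<nu> \<beta>) ^ i) = poly \<pi> \<beta>" if \<beta>: "\<beta> \<notin> E" for \<beta>
  proof -
    let ?v = "v0 + \<beta> *\<^sub>R v1"
    have lim: "((\<lambda>t. \<Sum>i=1..Suc r. \<alpha> i * (ev (linpoly x c ^ (k + 1 + 2 * i)) (arc ?v t) / ev (rho x) (arc ?v t) ^ i / t ^ Suc k)) \<longlongrightarrow>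
        (\<Sum>i=1..Suc r. \<alpha> i * ((c \<bullet> vel ?v) ^ (k + 1 + 2 * i) / (norm (vel ?v) ^ 2) ^ i))) (at 0)"
      by (intro tendsto_sum tendsto_mult tendsto_const arc_ratio_limit vnz)
    have s: "(\<Sum>i=1..Suc r. \<alpha> i * ((c \<bullet> vel ?v) ^ (k + 1 + 2 * i) / (norm (vel ?v) ^ 2) ^ i))
        = (\<Sum>i=1..Suc r. \<alpha> i * (1 / poly \<nu> \<beta>) ^ i)"
      unfolding cv \<nu> by (simp only: power_one power_divide)
    have "\<forall>\<^sub>F t in at 0. (\<Sum>i=1..Suc r. \<alpha> i * (ev (linpoly x c ^ (k + 1 + 2 * i)) (arc ?v t) / ev (rho x) (arc ?v t) ^ i / t ^ Suc k))
        = (\<Sum>a\<in>A. H a (arc ?v t) * a (arc ?v t)) / t ^ Suc k"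
      using arc_in_X[OF X, of ?v]
    proof eventually_elim
      case (elim t)
      show ?case unfolding HA[OF elim] by (simp only: sum_divide_distrib times_divide_eq_right)
    qed
    from \<pi>(2)[rule_format, OF \<beta> Lim_transform_eventually[OF lim this]] show ?thesis unfolding s .
  qed
  from reciprocal_not_poly[OF deg \<pi>(1) nz this] have "\<forall>i\<in>{1..Suc r}. \<alpha> i = 0" .
  then show False using \<alpha>(1) by blast
qed

lemma fin_gen_maximal_point:
  assumes M: "maximalideal M (regulous_ring k X)" and fg: "fin_gen_ideal M (regulous_ring k X)"
  shows "\<exists>x\<in>X. M = point_max k X x"
proof -
  interpret R: cring "regulous_ring k X" by (rule cring_regulous_ring)
  interpret M: maximalideal M "regulous_ring k X" by fact
  obtain A where A: "A \<subseteq> carrier (regulous_ring k X)" "finite A" "M = genideal (regulous_ring k X) A"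
    using fg unfolding fin_gen_ideal_def by blast
  have AM: "A \<subseteq> M" unfolding A(3) by (rule R.genideal_self[OF A(1)])
  have sq: "(\<lambda>y\<in>X. \<Sum>a\<in>B. a y * a y) \<in> M" if "finite B" "B \<subseteq> A" for B
    using that
  proof (induction B rule: finite_induct)
    case empty
    have "(\<lambda>y\<in>X. 0) = \<zero>\<^bsub>regulous_ring k X\<^esub>" by (simp add: regulous_ring_def)
    then show ?case using additive_subgroup.zero_closed[OF M.is_additive_subgroup] by (simp only: sum.empty)
  next
    case (insert a B)
    have "(\<lambda>y\<in>X. \<Sum>a\<in>B. a y * a y) \<in> M" "a \<in> M" using insert AM by blast+
    then have "a \<otimes>\<^bsub>regulous_ring k X\<^esub> a \<oplus>\<^bsub>regulous_ring k X\<^esub> (\<lambda>y\<in>X. \<Sum>a\<in>B. a y * a y) \<in> M"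
      by (intro additive_subgroup.a_closed[OF M.is_additive_subgroup] M.I_l_closed M.Icarr)
    moreover have "a \<otimes>\<^bsub>regulous_ring k X\<^esub> a \<oplus>\<^bsub>regulous_ring k X\<^esub> (\<lambda>y\<in>X. \<Sum>a\<in>B. a y * a y) = (\<lambda>y\<in>X. \<Sum>a\<in>insert a B. a y * a y)"
      using insert.hyps by (auto simp: regulous_ring_def restrict_def)
    ultimately show ?case by (simp only:)
  qed
  define s where "s = (\<lambda>y\<in>X. \<Sum>a\<in>A. a y * a y)"
  have sM: "s \<in> M" unfolding s_def using sq A(2) by blast
  have "\<exists>x\<in>X. s x = 0"
  proof (rule ccontr)
    assume "\<not> (\<exists>x\<in>X. s x = 0)"
    then have nz: "s y \<noteq> 0" if "y \<in> X" for y using that by blast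
    have "regulous k X s" using M.Icarr[OF sM] by (simp add: regulous_ring_carrier)
    from regulous_inverse[OF this nz] have i: "(\<lambda>y\<in>X. inverse (s y)) \<in> carrier (regulous_ring k X)"
      by (simp add: regulous_ring_carrier)
    have "(\<lambda>y\<in>X. inverse (s y)) \<otimes>\<^bsub>regulous_ring k X\<^esub> s \<in> M" by (rule M.I_l_closed[OF sM i])
    moreover have "(\<lambda>y\<in>X. inverse (s y)) \<otimes>\<^bsub>regulous_ring k X\<^esub> s = \<one>\<^bsub>regulous_ring k X\<^esub>"
      using nz by (auto simp: regulous_ring_def restrict_def)
    ultimately have "\<one>\<^bsub>regulous_ring k X\<^esub> \<in> M" by simp
    then show False using M.one_imp_carrier M.I_notcarr by simp
  qed
  then obtain x where x: "x \<in> X" "s x = 0" by blast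
  have "a x = 0" if "a \<in> A" for a
  proof -
    have "\<forall>a\<in>A. a x * a x = 0" using x A(2) by (subst sum_nonneg_eq_0_iff[symmetric]) (auto simp: s_def)
    then show ?thesis using that by simp
  qed
  then have "A \<subseteq> point_max k X x" using A(1) by (auto simp: point_max_def)
  then have sub: "M \<subseteq> point_max k X x" unfolding A(3) by (rule R.genideal_minimal[OF ideal_point_max[OF x(1)]])
  have "point_max k X x = M \<or> point_max k X x = carrier (regulous_ring k X)"
    by (rule M.I_maximal[OF ideal_point_max[OF x(1)] sub]) (auto simp: point_max_def)
  moreover have "\<one>\<^bsub>regulous_ring k X\<^esub> \<notin> point_max k X x" using x(1) by (simp add: point_max_def regulous_ring_def)
  ultimately show ?thesis using x(1) R.one_closed by blast
qed

text \<open>The coordinate ring of the empty set is the zero ring, which has no prime ideal. The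
  point obtained here provides the ideal that refutes the noetherian property.\<close>

lemma has_krull_dim_nonempty:
  assumes "has_krull_dim (coord_ring X) d"
  shows "X \<noteq> {}"
proof
  assume "X = {}"
  then have "(1 :: 'a polyfun) \<in> van X" by (simp add: van_def)
  then have one: "\<one>\<^bsub>coord_ring X\<^esub> = \<zero>\<^bsub>coord_ring X\<^esub>" using cls_zero cls_one by metis
  obtain P where "primeideal (P 0) (coord_ring X)" using assms unfolding has_krull_dim_def prime_chain_def by auto
  then interpret P: primeideal "P 0" "coord_ring X" .
  have "\<one>\<^bsub>coord_ring X\<^esub> \<in> P 0" unfolding one by (rule additive_subgroup.zero_closed[OF P.is_additive_subgroup])
  then show False using P.one_imp_carrier P.I_notcarr by simp
qed

theorem theorem4p10:
  fixes k d :: nat and X :: "(real ^ 'n) set"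
  assumes "smooth_variety X d" and "d \<ge> 2"
  shows "(\<forall>M. maximalideal M (regulous_ring k X) \<longrightarrow> \<not> fin_gen_ideal M (regulous_ring k X)) \<and>
    \<not> noetherian_ring (regulous_ring k X)"
proof
  have X: "real_algebraic_set X" using assms(1) by (simp add: smooth_variety_def)
  have pm: "\<not> fin_gen_ideal (point_max k X x) (regulous_ring k X)" if x: "x \<in> X" for x
  proof -
    have "regular_local_ring (local_ring_at X x) d" using assms(1) x by (simp add: smooth_variety_def)
    then obtain b S where "adapted_coords X x b S" "card S = d" using adapted_coords_exist[OF x] by blast
    then show ?thesis using point_max_not_fin_gen[OF _ X] assms(2) by blast
  qed
  show "\<forall>M. maximalideal M (regulous_ring k X) \<longrightarrow> \<not> fin_gen_ideal M (regulous_ring k X)"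
    using fin_gen_maximal_point pm by blast
  show "\<not> noetherian_ring (regulous_ring k X)"
  proof
    assume "noetherian_ring (regulous_ring k X)"
    then interpret N: noetherian_ring "regulous_ring k X" .
    obtain x where x: "x \<in> X" using has_krull_dim_nonempty assms(1) unfolding smooth_variety_def by blast
    have "fin_gen_ideal (point_max k X x) (regulous_ring k X)"
      unfolding fin_gen_ideal_def using N.finetely_gen[OF ideal_point_max[OF x]] by blast
    then show False using pm[OF x] by contradiction
  qed
qed

end
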